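(* Consider the U(1)-symmetric setting described in the context: a finite graph $(\Lambda,\mathcal{E})$, operators $\{S_x\}_{x\in\Lambda}$, an interaction $(\Phi_A)_{A\subset\Lambda}$, and a correlator $O_{xy}$, for some $x,y\in\Lambda$, satisfying conditions (a)–(e) of the context, where $c\in\mathbb{R}$ is the constant appearing in (e). Suppose that the perimeter constant $\gamma$ is finite. Then there exist $C>0$ and $\xi(\beta)>0$ (uniform with respect to $\Lambda$ and $x,y\in\Lambda$) such that $$|\langle O_{xy}\rangle|\le C\,(d(x,y)+1)^{-\xi(\beta)}.$$ Moreover, if there exists a positive constant $K$ such that $\|\Phi\|_K$ is bounded uniformly in $\Lambda$, then $$\lim_{\beta\to\infty}\beta\,\xi(\beta)=\frac{c^2}{8\gamma\|\Phi\|_0}.$$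
   Context: Graph: $(\Lambda,\mathcal{E})$ is a finite graph with vertex set $\Lambda$ and edge set $\mathcal{E}$; $d:\Lambda\times\Lambda\to\mathbb{N}_0$ is the graph distance (length of the shortest connected path between two vertices), and $\mathrm{diam}(A)$ is the diameter of $A\subset\Lambda$ with respect to $d$. The perimeter constant is $\gamma=\max_{x\in\Lambda}\max_{\ell\in\mathbb{N}}\frac1\ell\,|\{y\in\Lambda: d(x,y)=\ell\}|$ (with $\ell\ge1$). Algebras and symmetry generators: $\mathcal{H}_\Lambda$ is a finite-dimensional Hilbert space and $\mathcal{B}(\mathcal{H}_\Lambda)$ is the algebra of linear operators on it. There are sub-algebras $\mathcal{B}_A\subset\mathcal{B}(\mathcal{H}_\Lambda)$ with $\mathbf{1}\in\mathcal{B}_A$ for all $A\subset\Lambda$ and $\mathcal{B}_A\subseteq\mathcal{B}_{A'}$ whenever $A\subseteq A'\subseteq\Lambda$, and hermitian operators $(S_x)_{x\in\Lambda}$. The conditions are: (a) $[S_x,S_y]=0$ for all $x,y\in\Lambda$ with $x\neq y$; (b) for all $x\in\Lambda$, $A\subset\Lambda$ and $\Psi\in\mathcal{B}_A$: $[S_x,\Psi]=0$ if $x\notin A$, and $[S_x,\Psi]\in\mathcal{B}_A$ if $x\in A$; (c) the hamiltonian is $H_\Lambda=\sum_{A\subset\Lambda}\Phi_A$, where each $\Phi_A$ is hermitian and belongs to $\mathcal{B}_A$, and $[\Phi_A,\sum_{x\in A}S_x]=0$ for all $A\subset\Lambda$; (d) $\|S_x\|=1$ for all $x\in\Lambda$ (operator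 norm); (e) $O_{xy}\in\mathcal{B}_\Lambda$, and there is a constant $c\in\mathbb{R}$ such that $[S_x,O_{xy}]=c\,O_{xy}$ and $[S_z,O_{xy}]=0$ for $z\neq x,y$. (Nothing is assumed about the commutator of $S_y$ with $O_{xy}$.) Norm on interactions: for $K\ge0$, $$\|\Phi\|_K=\sup_{y\in\Lambda}\ \sum_{A\subset\Lambda,\ A\ni y}\|\Phi_A\|\,(|A|-1)^2\,(\mathrm{diam}(A)+1)^{2K(|A|-1)+2}.$$ Gibbs state at inverse temperature $\beta$: $\langle a\rangle=\mathrm{Tr}(a\,e^{-\beta H_\Lambda})/\mathrm{Tr}(e^{-\beta H_\Lambda})$ for $a\in\mathcal{B}(\mathcal{H}_\Lambda)$.
   Formalization: Formally c is nonzero, the norms of O_xy are bounded uniformly in Λ, x, y, and in the first claim ξ(β) may depend on Λ through ‖Φ‖_0 and ‖Φ‖_K (it is uniform once ‖Φ‖_K is bounded); without these the claim fails. *)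

theory Defs
  imports Complex_Main "HOL-Library.Extended_Real" "Jordan_Normal_Form.Schur_Decomposition"
begin

text \<open>A finite connected graph is given by a vertex set and a symmetric adjacency relation.
  Connectedness is what makes the distance a function into the natural numbers.\<close>

definition finite_graph :: "'v set \<Rightarrow> ('v \<times> 'v) set \<Rightarrow> bool" where
  "finite_graph V E \<longleftrightarrow>
     finite V \<and> V \<noteq> {} \<and> E \<subseteq> V \<times> V \<and> sym E \<and> (\<forall>x\<in>V. \<forall>y\<in>V. (x, y) \<in> E\<^sup>*)"

text \<open>A walk of length \<open>n\<close> from \<open>x\<close> to \<open>y\<close> is a membership \<open>(x, y) \<in> E ^^ n\<close>.\<close>

definition graph_dist :: "('v \<times> 'v) set \<Rightarrow> 'v \<Rightarrow> 'v \<Rightarrow> nat" where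
  "graph_dist E x y = (LEAST n. (x, y) \<in> E ^^ n)"

text \<open>Only meaningful for finite nonempty \<open>A\<close>.\<close>

definition graph_diam :: "('v \<times> 'v) set \<Rightarrow> 'v set \<Rightarrow> nat" where
  "graph_diam E A = Max {graph_dist E x y | x y. x \<in> A \<and> y \<in> A}"

text \<open>For a finite vertex set the quotients take finitely many values (they vanish for large
  \<open>l\<close>), so that the supremum is a maximum.\<close>

definition perimeter_const :: "'v set \<Rightarrow> ('v \<times> 'v) set \<Rightarrow> real" where
  "perimeter_const V E =
     Sup {real (card {y \<in> V. graph_dist E x y = l}) / real l | x l. x \<in> V \<and> l \<ge> 1}"

text \<open>The Hilbert space of dimension \<open>n\<close> is \<open>carrier_vec n\<close> over the complex numbers with its
  standard inner product, and its operators are \<open>carrier_mat n n\<close>.\<close>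

definition vnorm :: "complex vec \<Rightarrow> real" where
  "vnorm v = sqrt (\<Sum>i<dim_vec v. (cmod (v $ i))\<^sup>2)"

definition opnorm :: "complex mat \<Rightarrow> real" where
  "opnorm A = Sup {vnorm (A *\<^sub>v v) | v. v \<in> carrier_vec (dim_col A) \<and> vnorm v \<le> 1}"

definition hermitian_mat :: "complex mat \<Rightarrow> bool" where
  "hermitian_mat A \<longleftrightarrow> mat_adjoint A = A"

definition commutator :: "complex mat \<Rightarrow> complex mat \<Rightarrow> complex mat" where
  "commutator A B = A * B - B * A"

definition mtrace :: "complex mat \<Rightarrow> complex" where
  "mtrace A = (\<Sum>i<dim_row A. A $$ (i, i))"

definition mexp :: "complex mat \<Rightarrow> complex mat" where
  "mexp A = mat (dim_row A) (dim_col A) (\<lambda>(i, j). \<Sum>k. (A ^\<^sub>m k) $$ (i, j) / fact k)"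

abbreviation msum :: "nat \<Rightarrow> ('a \<Rightarrow> complex mat) \<Rightarrow> 'a set \<Rightarrow> complex mat" where
  "msum n f X \<equiv> finsum (module_mat TYPE(complex) n n) f X"

text \<open>Unital subalgebras; no closure under adjoints is required.\<close>

definition unital_subalgebra :: "nat \<Rightarrow> complex mat set \<Rightarrow> bool" where
  "unital_subalgebra n B \<longleftrightarrow>
     B \<subseteq> carrier_mat n n \<and> 1\<^sub>m n \<in> B \<and>
     (\<forall>X\<in>B. \<forall>Y\<in>B. X + Y \<in> B) \<and> (\<forall>a. \<forall>X\<in>B. a \<cdot>\<^sub>m X \<in> B) \<and> (\<forall>X\<in>B. \<forall>Y\<in>B. X * Y \<in> B)"

record 'v qsystem =
  sites :: "'v set"
  edges :: "('v \<times> 'v) set"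
  hdim :: nat                               \<comment> \<open>dimension of the Hilbert space\<close>
  algs :: "'v set \<Rightarrow> complex mat set"
  gens :: "'v \<Rightarrow> complex mat"
  inter :: "'v set \<Rightarrow> complex mat"

definition qdist :: "'v qsystem \<Rightarrow> 'v \<Rightarrow> 'v \<Rightarrow> nat" where
  "qdist M = graph_dist (edges M)"

definition u1_system :: "'v qsystem \<Rightarrow> bool" where
  "u1_system M \<longleftrightarrow>
     finite_graph (sites M) (edges M) \<and>
     (\<forall>A. A \<subseteq> sites M \<longrightarrow> unital_subalgebra (hdim M) (algs M A)) \<and>
     (\<forall>A A'. A \<subseteq> A' \<longrightarrow> A' \<subseteq> sites M \<longrightarrow> algs M A \<subseteq> algs M A') \<and>
     (\<forall>x\<in>sites M. gens M x \<in> carrier_mat (hdim M) (hdim M) \<and>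
        hermitian_mat (gens M x) \<and> opnorm (gens M x) = 1) \<and>
     (\<forall>x\<in>sites M. \<forall>y\<in>sites M. x \<noteq> y \<longrightarrow>
        commutator (gens M x) (gens M y) = 0\<^sub>m (hdim M) (hdim M)) \<and>
     (\<forall>x\<in>sites M. \<forall>A. A \<subseteq> sites M \<longrightarrow> (\<forall>\<Psi>\<in>algs M A.
        (x \<notin> A \<longrightarrow> commutator (gens M x) \<Psi> = 0\<^sub>m (hdim M) (hdim M)) \<and>
        (x \<in> A \<longrightarrow> commutator (gens M x) \<Psi> \<in> algs M A))) \<and>
     (\<forall>A. A \<subseteq> sites M \<longrightarrow> inter M A \<in> algs M A \<and> hermitian_mat (inter M A) \<and>
        commutator (inter M A) (msum (hdim M) (gens M) A) = 0\<^sub>m (hdim M) (hdim M))"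

definition u1_correlator :: "'v qsystem \<Rightarrow> real \<Rightarrow> 'v \<Rightarrow> 'v \<Rightarrow> complex mat \<Rightarrow> bool" where
  "u1_correlator M c x y Oxy \<longleftrightarrow>
     Oxy \<in> algs M (sites M) \<and>
     commutator (gens M x) Oxy = complex_of_real c \<cdot>\<^sub>m Oxy \<and>
     (\<forall>z\<in>sites M. z \<noteq> x \<and> z \<noteq> y \<longrightarrow> commutator (gens M z) Oxy = 0\<^sub>m (hdim M) (hdim M))"

definition hamiltonian :: "'v qsystem \<Rightarrow> complex mat" where
  "hamiltonian M = msum (hdim M) (inter M) (Pow (sites M))"

definition gibbs :: "'v qsystem \<Rightarrow> real \<Rightarrow> complex mat \<Rightarrow> complex" where
  "gibbs M \<beta> a =
     mtrace (a * mexp (complex_of_real (- \<beta>) \<cdot>\<^sub>m hamiltonian M)) /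
     mtrace (mexp (complex_of_real (- \<beta>) \<cdot>\<^sub>m hamiltonian M))"

definition inter_norm :: "real \<Rightarrow> 'v qsystem \<Rightarrow> real" where
  "inter_norm K M = (SUP y\<in>sites M. \<Sum>A | A \<subseteq> sites M \<and> y \<in> A.
     opnorm (inter M A) * (real (card A) - 1)\<^sup>2 *
     (real (graph_diam (edges M) A) + 1) powr (2 * K * (real (card A) - 1) + 2))"

text \<open>Uniformity in the system is expressed for an arbitrary indexed family of systems; the
  perimeter constant and the interaction norm of the family are the suprema over its members,
  to be used only when these are finite.\<close>

definition qperimeter :: "'v qsystem \<Rightarrow> real" where
  "qperimeter M = perimeter_const (sites M) (edges M)"

definition family_perimeter :: "('i \<Rightarrow> 'v qsystem) \<Rightarrow> real" where
  "family_perimeter M = (SUP i. qperimeter (M i))"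

definition family_norm :: "real \<Rightarrow> ('i \<Rightarrow> 'v qsystem) \<Rightarrow> real" where
  "family_norm K M = (SUP i. inter_norm K (M i))"

end

(*
  McBryan-Spencer complex rotation.  Conjugating with exp (sum_z theta_z S_z) for real theta
  multiplies O_xy by exp (c theta_x) if theta_y = 0, and replaces H by an operator whose Hermitian
  part differs from H only at second order in the differences of theta, since each interaction
  term commutes with the total charge of its support.  The trace norm of the exponential of the
  rotated Hamiltonian is controlled by writing exp (- beta H) as the limit of T ^ m with
  T = 1 - beta H / m and R T R^-1 = M T with M close to 1: the Horn-type inequality
  |tr (O (M T) ^ m)| <= |O| |M| ^ m tr T ^ m for positive T follows by slicing T into
  projections onto initial segments of its ordered spectrum.  With the logarithmic profile
  theta_z = kappa (ln (d(x,y) + 1) - ln (d(x,z) + 1)) the total cost is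
  2 beta kappa^2 gamma |Phi|_0 ln (d(x,y) + 1) to leading order, against a gain of
  |c| kappa ln (d(x,y) + 1); the optimal slope kappa = |c| / (4 beta gamma |Phi|_0) gives the
  exponent c^2 / (8 beta gamma |Phi|_0).
*)
theory Submission
  imports Defs "HOL-Analysis.L2_Norm" "HOL-Real_Asymp.Real_Asymp"
begin

section \<open>Matrices, adjoints and the inner product\<close>

text \<open>The logarithm reflects at most two-dimensional growth: a sphere of radius
  \<open>l\<close> has at most \<open>\<gamma> l\<close> points, so a profile with slope
  \<open>\<kappa> / (l + 1)\<close> costs about \<open>\<kappa>^2 \<gamma> / l\<close> per shell.
  Gain and cost are then both logarithmic in the distance, but the gain is linear and the cost
  quadratic in \<open>\<kappa>\<close>, so a small slope always wins. Beyond the distance of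
  \<open>y\<close> the profile is cut off at zero; it vanishes at \<open>y\<close>, where the
  commutator with the correlator is unknown. The obstacle is large supports: the cost of rotating
  one interaction term is quadratic only while its size times the variation of the profile is small.
  The exponential excess is paid by the \<open>K\<close>-dependent weight, which confines
  \<open>\<kappa>\<close> to at most \<open>K\<close>; by convexity the excess enters with the
  factor \<open>\<kappa> / K\<close>, which vanishes as \<open>\<beta>\<close> grows. Hence the
  limit contains only the norm with parameter 0. The rotated Hamiltonian is not Hermitian, which is
  why powers of \<open>M T\<close> are handled one factor at a time. The exponent depends on a
  single system only through two norms, which yields uniformity. The limit lives in the extended
  reals since its denominator may vanish.\<close>

lemma mult_mat_index:
  fixes A B :: "complex mat"
  assumes "A \<in> carrier_mat n m" "B \<in> carrier_mat m k" "i < n" "j < k"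
  shows "(A * B) $$ (i, j) = (\<Sum>l<m. A $$ (i, l) * B $$ (l, j))"
  using assms by (auto simp: scalar_prod_def atLeast0LessThan intro!: sum.cong)

lemma mult_vec_index:
  fixes A :: "complex mat"
  assumes "A \<in> carrier_mat n m" "v \<in> carrier_vec m" "i < n"
  shows "(A *\<^sub>v v) $ i = (\<Sum>l<m. A $$ (i, l) * v $ l)"
  using assms by (auto simp: scalar_prod_def atLeast0LessThan intro!: sum.cong)

lemma mat_adjoint_carrier [simp]:
  fixes A :: "complex mat"
  assumes "A \<in> carrier_mat n m" shows "mat_adjoint A \<in> carrier_mat m n"
  using assms by (auto simp: mat_adjoint_def mat_of_rows_def)

lemma mat_adjoint_dim [simp]:
  fixes A :: "complex mat"
  shows "dim_row (mat_adjoint A) = dim_col A" "dim_col (mat_adjoint A) = dim_row A"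
  by (auto simp: mat_adjoint_def mat_of_rows_def)

lemma mat_adjoint_index:
  fixes A :: "complex mat"
  assumes "A \<in> carrier_mat n m" "i < m" "j < n"
  shows "mat_adjoint A $$ (i, j) = cnj (A $$ (j, i))"
  using assms by (simp add: mat_adjoint_def mat_of_rows_def)

lemma mat_adjoint_eqI:
  fixes A B :: "complex mat"
  assumes "A \<in> carrier_mat n m" "B \<in> carrier_mat m n"
    and "\<And>i j. i < m \<Longrightarrow> j < n \<Longrightarrow> B $$ (i, j) = cnj (A $$ (j, i))"
  shows "mat_adjoint A = B"
  using assms by (intro eq_matI) (auto simp: mat_adjoint_index)

lemma mat_adjoint_adjoint:
  fixes A :: "complex mat"
  assumes "A \<in> carrier_mat n m" shows "mat_adjoint (mat_adjoint A) = A"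
  using assms by (intro mat_adjoint_eqI[of _ m n]) (auto simp: mat_adjoint_index)

lemma mat_adjoint_mult:
  fixes A B :: "complex mat"
  assumes "A \<in> carrier_mat n m" "B \<in> carrier_mat m k"
  shows "mat_adjoint (A * B) = mat_adjoint B * mat_adjoint A"
proof (rule mat_adjoint_eqI[of _ n k])
  fix i j assume "i < k" "j < n"
  then show "(mat_adjoint B * mat_adjoint A) $$ (i, j) = cnj ((A * B) $$ (j, i))"
    using assms
    by (simp add: mult_mat_index[of _ k m _ n] mult_mat_index[of A n m B k] mat_adjoint_index
        mult.commute del: index_mult_mat)
qed (use assms in auto)

lemma hermitian_index:
  assumes "A \<in> carrier_mat n n" "hermitian_mat A" "i < n" "j < n"
  shows "A $$ (i, j) = cnj (A $$ (j, i))"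
  using mat_adjoint_index[OF assms(1,3,4)] assms(2) unfolding hermitian_mat_def by metis

lemma hermitian_matI:
  assumes "A \<in> carrier_mat n n"
    and "\<And>i j. i < n \<Longrightarrow> j < n \<Longrightarrow> A $$ (i, j) = cnj (A $$ (j, i))"
  shows "hermitian_mat A"
  unfolding hermitian_mat_def using assms(1,1,2) by (rule mat_adjoint_eqI)

section \<open>The standard inner product and the Euclidean norm\<close>

definition cip :: "nat \<Rightarrow> complex vec \<Rightarrow> complex vec \<Rightarrow> complex" where
  "cip n v w = (\<Sum>i<n. cnj (v $ i) * w $ i)"

lemma cip_add_left:
  "\<lbrakk>u \<in> carrier_vec n; v \<in> carrier_vec n\<rbrakk> \<Longrightarrow> cip n (u + v) w = cip n u w + cip n v w"
  by (simp add: cip_def sum.distrib algebra_simps)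

lemma cip_add_right:
  "\<lbrakk>v \<in> carrier_vec n; w \<in> carrier_vec n\<rbrakk> \<Longrightarrow> cip n u (v + w) = cip n u v + cip n u w"
  by (simp add: cip_def sum.distrib algebra_simps)

lemma cip_diff_right:
  "\<lbrakk>v \<in> carrier_vec n; w \<in> carrier_vec n\<rbrakk> \<Longrightarrow> cip n u (v - w) = cip n u v - cip n u w"
  by (simp add: cip_def sum_subtractf algebra_simps)

lemma cip_commute: "cip n v w = cnj (cip n w v)"
  by (simp add: cip_def mult.commute)

lemma cip_adjoint:
  assumes "A \<in> carrier_mat n n" "v \<in> carrier_vec n" "w \<in> carrier_vec n"
  shows "cip n v (A *\<^sub>v w) = cip n (mat_adjoint A *\<^sub>v v) w"
proof -
  have "cip n v (A *\<^sub>v w) = (\<Sum>i<n. \<Sum>l<n. cnj (v $ i) * (A $$ (i, l) * w $ l))"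
    unfolding cip_def using assms
    by (simp add: mult_vec_index[of A n n] sum_distrib_left del: index_mult_mat_vec)
  also have "\<dots> = (\<Sum>l<n. \<Sum>i<n. cnj (v $ i) * (A $$ (i, l) * w $ l))"
    by (rule sum.swap)
  also have "\<dots> = cip n (mat_adjoint A *\<^sub>v v) w"
    unfolding cip_def using assms
    by (intro sum.cong) (auto simp: mult_vec_index[of "mat_adjoint A" n n] sum_distrib_right
        sum_distrib_left mat_adjoint_index ac_simps simp del: index_mult_mat_vec)
  finally show ?thesis .
qed

lemma vnorm_L2: "v \<in> carrier_vec n \<Longrightarrow> vnorm v = L2_set (\<lambda>i. cmod (v $ i)) {..<n}"
  by (auto simp: vnorm_def L2_set_def)

lemma vnorm_nonneg [simp]: "0 \<le> vnorm v"
  by (simp add: vnorm_def sum_nonneg)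

lemma vnorm_triangle:
  assumes "v \<in> carrier_vec n" "w \<in> carrier_vec n"
  shows "vnorm (v + w) \<le> vnorm v + vnorm w"
proof -
  have "vnorm (v + w) = L2_set (\<lambda>i. cmod ((v + w) $ i)) {..<n}"
    using assms by (intro vnorm_L2) auto
  also have "\<dots> \<le> L2_set (\<lambda>i. cmod (v $ i) + cmod (w $ i)) {..<n}"
    using assms by (intro L2_set_mono) (auto intro: norm_triangle_ineq)
  also have "\<dots> \<le> vnorm v + vnorm w"
    using L2_set_triangle_ineq[of "\<lambda>i. cmod (v $ i)" "\<lambda>i. cmod (w $ i)" "{..<n}"] assms
    by (simp add: vnorm_L2)
  finally show ?thesis .
qed

lemma vnorm_smult: "vnorm (a \<cdot>\<^sub>v v) = cmod a * vnorm v"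
proof -
  have "vnorm (a \<cdot>\<^sub>v v) = sqrt ((cmod a)\<^sup>2 * (\<Sum>i<dim_vec v. (cmod (v $ i))\<^sup>2))"
    unfolding vnorm_def sum_distrib_left
    by (auto intro!: sum.cong simp: norm_mult power_mult_distrib)
  then show ?thesis by (simp add: vnorm_def real_sqrt_mult)
qed

lemma cip_self: "v \<in> carrier_vec n \<Longrightarrow> cip n v v = complex_of_real ((vnorm v)\<^sup>2)"
proof -
  assume v: "v \<in> carrier_vec n"
  have "(vnorm v)\<^sup>2 = (\<Sum>i<n. (cmod (v $ i))\<^sup>2)"
    using v by (simp add: vnorm_def sum_nonneg)
  then show ?thesis
    by (simp add: cip_def complex_norm_square mult.commute del: of_real_power)
qed

lemma cip_Cauchy_Schwarz:
  assumes "v \<in> carrier_vec n" "w \<in> carrier_vec n"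
  shows "cmod (cip n v w) \<le> vnorm v * vnorm w"
proof -
  have "cmod (cip n v w) \<le> (\<Sum>i<n. \<bar>cmod (v $ i)\<bar> * \<bar>cmod (w $ i)\<bar>)"
    unfolding cip_def by (rule order_trans[OF norm_sum]) (simp add: norm_mult)
  also have "\<dots> \<le> vnorm v * vnorm w"
    using L2_set_mult_ineq[of "\<lambda>i. cmod (v $ i)" "\<lambda>i. cmod (w $ i)" "{..<n}"] assms
    by (simp add: vnorm_L2)
  finally show ?thesis .
qed

section \<open>Operator norm bounds\<close>

text \<open>A relation instead of the supremum \<open>opnorm\<close>: it passes through sums,
  products and scalings without any reasoning about suprema, and the bound may be any convenient
  number above the norm.\<close>

definition mat_bound :: "nat \<Rightarrow> complex mat \<Rightarrow> real \<Rightarrow> bool" where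
  "mat_bound n A a \<longleftrightarrow>
     A \<in> carrier_mat n n \<and> (\<forall>v\<in>carrier_vec n. vnorm (A *\<^sub>v v) \<le> a * vnorm v)"

lemma mat_boundD: "\<lbrakk>mat_bound n A a; v \<in> carrier_vec n\<rbrakk> \<Longrightarrow> vnorm (A *\<^sub>v v) \<le> a * vnorm v"
  and mat_bound_carrier: "mat_bound n A a \<Longrightarrow> A \<in> carrier_mat n n"
  by (auto simp: mat_bound_def)

lemma mat_bound_mono: "\<lbrakk>mat_bound n A a; a \<le> b\<rbrakk> \<Longrightarrow> mat_bound n A b"
  unfolding mat_bound_def by (meson mult_right_mono order_trans vnorm_nonneg)

lemma mat_bound_mult:
  assumes A: "mat_bound n A a" and B: "mat_bound n B b" and "0 \<le> a"
  shows "mat_bound n (A * B) (a * b)"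
  unfolding mat_bound_def
proof (intro conjI ballI)
  show "A * B \<in> carrier_mat n n" using A[THEN mat_bound_carrier] B[THEN mat_bound_carrier] by auto
  fix v :: "complex vec" assume v: "v \<in> carrier_vec n"
  have "vnorm (A * B *\<^sub>v v) = vnorm (A *\<^sub>v (B *\<^sub>v v))"
    using A[THEN mat_bound_carrier] B[THEN mat_bound_carrier] v
    by (simp add: assoc_mult_mat_vec[of _ n n _ n])
  also have "\<dots> \<le> a * vnorm (B *\<^sub>v v)"
    using mat_boundD[OF A] mat_bound_carrier[OF B] v by auto
  also have "\<dots> \<le> a * (b * vnorm v)"
    using mat_boundD[OF B v] \<open>0 \<le> a\<close> by (rule mult_left_mono)
  finally show "vnorm (A * B *\<^sub>v v) \<le> a * b * vnorm v" by (simp add: mult.assoc)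
qed

lemma mult_vec_smult_mat:
  fixes A :: "complex mat"
  assumes "A \<in> carrier_mat n m" "v \<in> carrier_vec m"
  shows "(a \<cdot>\<^sub>m A) *\<^sub>v v = a \<cdot>\<^sub>v (A *\<^sub>v v)"
  using assms by (intro eq_vecI) auto

lemma mat_bound_smult:
  assumes "mat_bound n A a"
  shows "mat_bound n (c \<cdot>\<^sub>m A) (cmod c * a)"
  unfolding mat_bound_def
proof (intro conjI ballI)
  note c = mat_bound_carrier[OF assms]
  show "c \<cdot>\<^sub>m A \<in> carrier_mat n n" using c by simp
  fix v :: "complex vec" assume v: "v \<in> carrier_vec n"
  show "vnorm ((c \<cdot>\<^sub>m A) *\<^sub>v v) \<le> cmod c * a * vnorm v"
    using mult_left_mono[OF mat_boundD[OF assms v], of "cmod c"]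
    by (simp add: mult_vec_smult_mat[OF c v] vnorm_smult mult.assoc)
qed

lemma mat_bound_add:
  assumes "mat_bound n A a" "mat_bound n B b"
  shows "mat_bound n (A + B) (a + b)"
  unfolding mat_bound_def
proof (intro conjI ballI)
  note c = assms[THEN mat_bound_carrier]
  show "A + B \<in> carrier_mat n n" using c by auto
  fix v :: "complex vec" assume v: "v \<in> carrier_vec n"
  have "vnorm ((A + B) *\<^sub>v v) = vnorm (A *\<^sub>v v + B *\<^sub>v v)"
    using c v by (simp add: add_mult_distrib_mat_vec)
  also have "\<dots> \<le> vnorm (A *\<^sub>v v) + vnorm (B *\<^sub>v v)"
    using c v by (intro vnorm_triangle[of _ n]) auto
  also have "\<dots> \<le> a * vnorm v + b * vnorm v"
    using assms v by (intro add_mono mat_boundD)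
  finally show "vnorm ((A + B) *\<^sub>v v) \<le> (a + b) * vnorm v" by (simp add: algebra_simps)
qed

lemma mat_bound_one: "mat_bound n (1\<^sub>m n) 1"
  by (simp add: mat_bound_def)

lemma vnorm_unit: "i < n \<Longrightarrow> vnorm (unit_vec n i) = 1"
proof -
  assume "i < n"
  have "(\<Sum>j<n. (cmod (unit_vec n i $ j))\<^sup>2) = (\<Sum>j<n. if j = i then 1 else 0)"
    by (intro sum.cong) (auto simp: unit_vec_def)
  with \<open>i < n\<close> show ?thesis by (simp add: vnorm_def)
qed

lemma member_le_vnorm: "i < dim_vec v \<Longrightarrow> cmod (v $ i) \<le> vnorm v"
  using member_le_L2_set[of "{..<dim_vec v}" i "\<lambda>i. cmod (v $ i)"]
  by (simp add: vnorm_L2[of v "dim_vec v"])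

lemma mat_bound_index:
  assumes A: "mat_bound n A a" and "i < n" "j < n"
  shows "cmod (A $$ (i, j)) \<le> a"
proof -
  note c = mat_bound_carrier[OF A]
  have "(A *\<^sub>v unit_vec n j) $ i = (\<Sum>l<n. A $$ (i, l) * (if l = j then 1 else 0))"
    using c assms by (subst mult_vec_index[of _ n n]) (auto intro!: sum.cong)
  also have "\<dots> = A $$ (i, j)"
    using assms by (simp add: if_distrib cong: if_cong)
  finally have "cmod (A $$ (i, j)) = cmod ((A *\<^sub>v unit_vec n j) $ i)" by simp
  also have "\<dots> \<le> vnorm (A *\<^sub>v unit_vec n j)" using c assms by (intro member_le_vnorm) auto
  also have "\<dots> \<le> a" using mat_boundD[OF A, of "unit_vec n j"] assms by (simp add: vnorm_unit)
  finally show ?thesis .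
qed

text \<open>The sum of the moduli of all entries is a crude bound. It makes the set behind
  \<open>opnorm\<close> bounded, the exponential series converge, and the second order error of the
  time discretization finite.\<close>

lemma mat_bound_ex:
  assumes A: "A \<in> carrier_mat n n"
  shows "\<exists>a\<ge>0. mat_bound n A a"
proof (intro exI conjI)
  let ?a = "\<Sum>i<n. \<Sum>l<n. cmod (A $$ (i, l))"
  show "0 \<le> ?a" by (intro sum_nonneg) auto
  show "mat_bound n A ?a" unfolding mat_bound_def
  proof (intro conjI ballI A)
    fix v :: "complex vec" assume v: "v \<in> carrier_vec n"
    have "vnorm (A *\<^sub>v v) \<le> (\<Sum>i<n. cmod ((A *\<^sub>v v) $ i))"
      using A v by (subst vnorm_L2[of _ n]) (auto intro!: L2_set_le_sum simp del: index_mult_mat_vec)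
    also have "\<dots> \<le> (\<Sum>i<n. \<Sum>l<n. cmod (A $$ (i, l)) * vnorm v)"
    proof (rule sum_mono)
      fix i assume "i \<in> {..<n}"
      then have "cmod ((A *\<^sub>v v) $ i) \<le> (\<Sum>l<n. cmod (A $$ (i, l) * v $ l))"
        using A v by (subst mult_vec_index[of _ n n]) (auto intro: norm_sum)
      also have "\<dots> \<le> (\<Sum>l<n. cmod (A $$ (i, l)) * vnorm v)"
        using v by (intro sum_mono) (auto simp: norm_mult intro!: mult_left_mono member_le_vnorm)
      finally show "cmod ((A *\<^sub>v v) $ i) \<le> \<dots>" .
    qed
    finally show "vnorm (A *\<^sub>v v) \<le> ?a * vnorm v" by (simp add: sum_distrib_right)
  qed
qed

section \<open>The operator norm as a bound\<close>

lemma bdd_above_opnorm: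
  assumes A: "A \<in> carrier_mat n n"
  shows "bdd_above {vnorm (A *\<^sub>v v) | v. v \<in> carrier_vec (dim_col A) \<and> vnorm v \<le> 1}"
proof -
  obtain a where a: "a \<ge> 0" "mat_bound n A a" using mat_bound_ex[OF A] by auto
  show ?thesis
  proof (rule bdd_aboveI)
    fix y assume "y \<in> {vnorm (A *\<^sub>v v) | v. v \<in> carrier_vec (dim_col A) \<and> vnorm v \<le> 1}"
    then obtain v where v: "y = vnorm (A *\<^sub>v v)" "v \<in> carrier_vec n" "vnorm v \<le> 1"
      using A by auto
    then show "y \<le> a" using mat_boundD[OF a(2) v(2)] mult_left_mono[OF v(3) a(1)] by simp
  qed
qed

lemma opnorm_nonneg:
  assumes A: "A \<in> carrier_mat n n" shows "0 \<le> opnorm A"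
proof -
  have "0 = vnorm (0\<^sub>v n :: complex vec)" by (simp add: vnorm_def)
  moreover have "A *\<^sub>v 0\<^sub>v n = 0\<^sub>v n" using A by auto
  ultimately have "0 \<in> {vnorm (A *\<^sub>v v) | v. v \<in> carrier_vec (dim_col A) \<and> vnorm v \<le> 1}"
    using A by (auto intro!: exI[of _ "0\<^sub>v n"])
  then show ?thesis unfolding opnorm_def using bdd_above_opnorm[OF A] by (rule cSup_upper)
qed

lemma vnorm_eq_0: "v \<in> carrier_vec n \<Longrightarrow> vnorm v = 0 \<Longrightarrow> v = 0\<^sub>v n"
  by (intro eq_vecI) (auto simp: vnorm_def sum_nonneg_eq_0_iff)

lemma mat_bound_opnorm:
  assumes A: "A \<in> carrier_mat n n" shows "mat_bound n A (opnorm A)"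
  unfolding mat_bound_def
proof (intro conjI ballI A)
  fix v :: "complex vec" assume v: "v \<in> carrier_vec n"
  show "vnorm (A *\<^sub>v v) \<le> opnorm A * vnorm v"
  proof (cases "vnorm v = 0")
    case True
    then have "v = 0\<^sub>v n" using vnorm_eq_0[OF v] by simp
    then have "A *\<^sub>v v = 0\<^sub>v n" using A by auto
    then show ?thesis by (simp add: True) (simp add: vnorm_def)
  next
    case False
    define w where "w = complex_of_real (1 / vnorm v) \<cdot>\<^sub>v v"
    have w: "w \<in> carrier_vec n" "vnorm w = 1"
      using v False by (auto simp: w_def vnorm_smult norm_divide)
    have "v = complex_of_real (vnorm v) \<cdot>\<^sub>v w" using False v
      by (intro eq_vecI) (auto simp: w_def)
    then have "vnorm (A *\<^sub>v v) = vnorm v * vnorm (A *\<^sub>v w)"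
      using A w by (metis mult_mat_vec vnorm_smult norm_of_real abs_of_nonneg vnorm_nonneg)
    moreover have "vnorm (A *\<^sub>v w) \<le> opnorm A"
      unfolding opnorm_def using w A by (intro cSup_upper bdd_above_opnorm[OF A]) auto
    ultimately show ?thesis by (metis mult.commute mult_left_mono vnorm_nonneg)
  qed
qed

lemma mat_bound_diag:
  assumes "\<And>i. i < n \<Longrightarrow> cmod (d i) \<le> a"
  shows "mat_bound n (mat_diag n d) a"
  unfolding mat_bound_def
proof (intro conjI ballI)
  fix v :: "complex vec" assume v: "v \<in> carrier_vec n"
  have c: "mat_diag n d *\<^sub>v v \<in> carrier_vec n"
    using mat_diag_dim v by (rule mult_mat_vec_carrier)
  have e: "(mat_diag n d *\<^sub>v v) $ i = d i * v $ i" if "i < n" for i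
    using v that by (subst mult_vec_index[of _ n n])
      (auto simp: mat_diag_def if_distrib if_distribR cong: if_cong)
  show "vnorm (mat_diag n d *\<^sub>v v) \<le> a * vnorm v"
  \<comment> \<open>In dimension 0 the hypothesis is vacuous and \<open>a\<close> may be negative,
    but both norms are 0.\<close>
  proof (cases "n = 0")
    case True
    then show ?thesis using v by (simp add: vnorm_def mat_diag_def)
  next
    case False
    then have a: "0 \<le> a" using assms[of 0] by (meson norm_ge_zero order_trans neq0_conv)
    have "vnorm (mat_diag n d *\<^sub>v v) = L2_set (\<lambda>i. cmod (d i * v $ i)) {..<n}"
      unfolding vnorm_L2[OF c] using e by (intro L2_set_cong) auto
    also have "\<dots> \<le> L2_set (\<lambda>i. a * cmod (v $ i)) {..<n}"
      using assms by (intro L2_set_mono) (auto simp: norm_mult intro!: mult_right_mono)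
    also have "\<dots> = a * vnorm v" using a v by (simp add: vnorm_L2 L2_set_right_distrib)
    finally show ?thesis .
  qed
qed (simp add: mat_diag_def)

lemma mat_bound_isometry:
  assumes U: "U \<in> carrier_mat n n" and UU: "mat_adjoint U * U = 1\<^sub>m n"
  shows "mat_bound n U 1"
  unfolding mat_bound_def
proof (intro conjI ballI U)
  fix v :: "complex vec" assume v: "v \<in> carrier_vec n"
  have "complex_of_real ((vnorm (U *\<^sub>v v))\<^sup>2) = cip n (U *\<^sub>v v) (U *\<^sub>v v)"
    using U v by (subst cip_self) auto
  also have "\<dots> = cip n (mat_adjoint U *\<^sub>v (U *\<^sub>v v)) v"
    using U v by (intro cip_adjoint) auto
  also have "mat_adjoint U *\<^sub>v (U *\<^sub>v v) = v"
    using U v UU by (metis assoc_mult_mat_vec mat_adjoint_carrier one_mult_mat_vec)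
  also have "cip n v v = complex_of_real ((vnorm v)\<^sup>2)" using v by (rule cip_self)
  finally have "(vnorm (U *\<^sub>v v))\<^sup>2 = (vnorm v)\<^sup>2" using of_real_eq_iff by blast
  then show "vnorm (U *\<^sub>v v) \<le> 1 * vnorm v" by simp
qed

lemma mtrace_mult_commute:
  assumes "A \<in> carrier_mat n n" "B \<in> carrier_mat n n"
  shows "mtrace (A * B) = mtrace (B * A)"
proof -
  have "mtrace (A * B) = (\<Sum>i<n. \<Sum>l<n. A $$ (i, l) * B $$ (l, i))"
    using assms by (simp add: mtrace_def mult_mat_index[of _ n n] del: index_mult_mat(1))
  also have "\<dots> = (\<Sum>l<n. \<Sum>i<n. A $$ (i, l) * B $$ (l, i))" by (rule sum.swap)
  also have "\<dots> = mtrace (B * A)"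
    using assms
    by (simp add: mtrace_def mult_mat_index[of _ n n] mult.commute del: index_mult_mat(1))
  finally show ?thesis .
qed

section \<open>The spectral theorem for Hermitian matrices\<close>

text \<open>The characteristic polynomial splits over the complex numbers, so it has a root.
  Multiplying the eigenvector by a phase makes its first coordinate real and nonnegative, the
  normalization that \<open>householder\<close> relies on.\<close>

lemma unit_eigenvector_ex:
  fixes A :: "complex mat"
  assumes A: "A \<in> carrier_mat n n" and n: "0 < n"
  obtains v l r where "v \<in> carrier_vec n" "vnorm v = 1" "0 \<le> r" "v $ 0 = complex_of_real r"
    "A *\<^sub>v v = l \<cdot>\<^sub>v v"
proof -
  from char_poly_factorized[OF A] obtain as where
    as: "char_poly A = (\<Prod>a\<leftarrow>as. [:- a, 1:])" "length as = n" by auto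
  then obtain l where "l \<in> set as" using n by (cases as) auto
  then have "poly (char_poly A) l = 0" unfolding as by (induction as) auto
  then have "eigenvalue A l" using eigenvalue_root_char_poly[OF A] by simp
  then obtain w where w: "w \<in> carrier_vec n" "w \<noteq> 0\<^sub>v n" "A *\<^sub>v w = l \<cdot>\<^sub>v w"
    using A by (auto simp: eigenvalue_def eigenvector_def)
  have w0: "vnorm w > 0"
    using w vnorm_eq_0[OF w(1)] vnorm_nonneg[of w] by (metis order_le_less)
  define p where "p = (if w $ 0 = 0 then 1 else cnj (w $ 0) / complex_of_real (cmod (w $ 0)))"
  define v where "v = (p / complex_of_real (vnorm w)) \<cdot>\<^sub>v w"
  have p: "cmod p = 1" by (auto simp: p_def norm_divide)
  have pw: "p * w $ 0 = complex_of_real (cmod (w $ 0))"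
    using complex_norm_square[of "w $ 0"] by (auto simp: p_def power2_eq_square field_simps)
  show thesis
  proof
    show "v \<in> carrier_vec n" using w by (simp add: v_def)
    show "vnorm v = 1" using w0 p by (simp add: v_def vnorm_smult norm_divide)
    show "0 \<le> cmod (w $ 0) / vnorm w" by simp
    show "v $ 0 = complex_of_real (cmod (w $ 0) / vnorm w)"
      using w n pw by (simp add: v_def)
    show "A *\<^sub>v v = l \<cdot>\<^sub>v v"
      using A w by (simp add: v_def mult_mat_vec smult_smult_assoc mult.commute)
  qed
qed

text \<open>With \<open>u = v + e_0\<close> one has \<open>|u|^2 = 2 (1 + r)\<close>, and
  \<open>W = u u^* / (1 + r) - 1\<close> is the reflection that fixes the line through
  \<open>u\<close>; it exchanges \<open>e_0\<close> and \<open>v\<close>. Adding \<open>e_0\<close>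
  instead of subtracting it keeps the denominator at least 1, also when
  \<open>v = e_0\<close>.\<close>

lemma householder:
  fixes v :: "complex vec"
  assumes v: "v \<in> carrier_vec n" "vnorm v = 1" and n: "0 < n"
    and r: "0 \<le> r" "v $ 0 = complex_of_real r"
  obtains W where "W \<in> carrier_mat n n" "mat_adjoint W = W" "W * W = 1\<^sub>m n"
    "\<And>i. i < n \<Longrightarrow> W $$ (i, 0) = v $ i"
proof -
  define d where "d i j = (if i = j then 1 else 0 :: complex)" for i j :: nat
  define u where "u i = v $ i + d i 0" for i
  define c where "c = 1 + complex_of_real r"
  define x where "x = 1 / c"
  have "Re c \<noteq> 0" using r(1) by (simp add: c_def)
  then have "c \<noteq> 0" by auto
  then have xc: "x * c = 1" by (simp add: x_def)
  have cx: "cnj x = x" by (simp add: x_def c_def)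
  define W where "W = mat n n (\<lambda>(i, j). x * u i * cnj (u j) - d i j)"
  have Wi: "W $$ (i, j) = x * u i * cnj (u j) - d i j" if "i < n" "j < n" for i j
    using that by (simp add: W_def)
  have W: "W \<in> carrier_mat n n" by (simp add: W_def)
  have "(\<Sum>l<n. cnj (u l) * u l) =
      (\<Sum>l<n. cnj (v $ l) * v $ l + (if l = 0 then 2 * complex_of_real r + 1 else 0))"
    using r by (intro sum.cong) (auto simp: u_def d_def algebra_simps)
  also have "\<dots> = cip n v v + (2 * complex_of_real r + 1)"
    using n by (simp add: sum.distrib cip_def)
  also have "\<dots> = 2 * c" using v by (simp add: cip_self c_def)
  finally have uu: "(\<Sum>l<n. cnj (u l) * u l) = 2 * c" .
  show thesis
  proof
    show "mat_adjoint W = W"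
      using W by (intro mat_adjoint_eqI[of _ n n]) (auto simp: Wi d_def cx)
    show "W * W = 1\<^sub>m n"
    proof (rule eq_matI)
      fix i j assume ij: "i < dim_row (1\<^sub>m n :: complex mat)" "j < dim_col (1\<^sub>m n :: complex mat)"
      have "(W * W) $$ (i, j)
          = (\<Sum>l<n. (x * u i * cnj (u l) - d i l) * (x * u l * cnj (u j) - d l j))"
        using W ij by (subst mult_mat_index[of _ n n]) (auto simp: Wi intro!: sum.cong)
      also have "\<dots> = (\<Sum>l<n. (x * x * u i * cnj (u j)) * (cnj (u l) * u l)
          - (if l = j then x * u i * cnj (u l) else 0)
          - (if l = i then x * u l * cnj (u j) else 0) + (if l = i then d l j else 0))"
        by (intro sum.cong refl) (cases "i = j"; simp add: d_def ring_distribs ac_simps)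
      also have "\<dots> = (x * x * u i * cnj (u j)) * (\<Sum>l<n. cnj (u l) * u l) - x * u i * cnj (u j)
          - x * u i * cnj (u j) + d i j"
        unfolding sum.distrib sum_subtractf sum_distrib_left using ij by simp
      also have "\<dots> = 2 * (x * c) * x * u i * cnj (u j) - 2 * x * u i * cnj (u j) + d i j"
        unfolding uu by (simp add: algebra_simps)
      finally show "(W * W) $$ (i, j) = 1\<^sub>m n $$ (i, j)" using ij by (simp add: d_def xc)
    qed (use W in auto)
    fix i assume i: "i < n"
    have "cnj (u 0) = c" using r by (simp add: u_def d_def c_def)
    then have "x * u i * cnj (u 0) = (x * c) * u i" by simp
    then have "x * u i * cnj (u 0) = u i" by (simp add: xc)
    then have "W $$ (i, 0) = u i - d i 0" using Wi[OF i n] by simp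
    then show "W $$ (i, 0) = v $ i" by (simp add: u_def)
  qed (rule W)
qed

text \<open>The block diagonal sum of the 1 by 1 block \<open>a\<close> and \<open>X\<close>, into
  which the spectral theorem splits a matrix once one eigenvector is found.\<close>

definition ext_mat :: "complex \<Rightarrow> nat \<Rightarrow> complex mat \<Rightarrow> complex mat" where
  "ext_mat a m X = mat (Suc m) (Suc m)
     (\<lambda>(i, j). case (i, j) of (0, 0) \<Rightarrow> a | (Suc i', Suc j') \<Rightarrow> X $$ (i', j') | _ \<Rightarrow> 0)"

lemma ext_mat_carrier [simp]: "ext_mat a m X \<in> carrier_mat (Suc m) (Suc m)"
  by (simp add: ext_mat_def)

lemma ext_mat_index [simp]:
  "ext_mat a m X $$ (0, 0) = a"
  "j < m \<Longrightarrow> ext_mat a m X $$ (0, Suc j) = 0"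
  "i < m \<Longrightarrow> ext_mat a m X $$ (Suc i, 0) = 0"
  "i < m \<Longrightarrow> j < m \<Longrightarrow> ext_mat a m X $$ (Suc i, Suc j) = X $$ (i, j)"
  by (simp_all add: ext_mat_def)

lemma ext_mat_mult:
  assumes X: "X \<in> carrier_mat m m" and Y: "Y \<in> carrier_mat m m"
  shows "ext_mat a m X * ext_mat b m Y = ext_mat (a * b) m (X * Y)"
proof (rule eq_matI)
  fix i j assume "i < dim_row (ext_mat (a * b) m (X * Y))" "j < dim_col (ext_mat (a * b) m (X * Y))"
  then have ij: "i < Suc m" "j < Suc m" by (simp_all add: ext_mat_def)
  then show "(ext_mat a m X * ext_mat b m Y) $$ (i, j) = ext_mat (a * b) m (X * Y) $$ (i, j)"
    using X Y
    by (cases i; cases j)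
      (simp_all add: mult_mat_index[of _ "Suc m" "Suc m" _ "Suc m"] sum.lessThan_Suc_shift
        mult_mat_index[OF X Y] del: index_mult_mat(1) sum.lessThan_Suc)
qed (simp_all add: ext_mat_def)

lemma ext_mat_adjoint:
  assumes X: "X \<in> carrier_mat m m"
  shows "mat_adjoint (ext_mat a m X) = ext_mat (cnj a) m (mat_adjoint X)"
proof (rule mat_adjoint_eqI[of _ "Suc m" "Suc m"])
  fix i j assume "i < Suc m" "j < Suc m"
  then show "ext_mat (cnj a) m (mat_adjoint X) $$ (i, j) = cnj (ext_mat a m X $$ (j, i))"
    using X by (cases i; cases j) (simp_all add: mat_adjoint_index)
qed auto

lemma ext_mat_diag: "ext_mat a m (mat_diag m d) = mat_diag (Suc m) (case_nat a d)"
proof (rule eq_matI)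
  fix i j assume "i < dim_row (mat_diag (Suc m) (case_nat a d))"
    "j < dim_col (mat_diag (Suc m) (case_nat a d))"
  then show "ext_mat a m (mat_diag m d) $$ (i, j) = mat_diag (Suc m) (case_nat a d) $$ (i, j)"
    by (cases i; cases j) (auto simp: mat_diag_def)
qed (simp_all add: ext_mat_def mat_diag_def)

lemma ext_mat_one: "ext_mat 1 m (1\<^sub>m m) = 1\<^sub>m (Suc m)"
proof -
  have "case_nat 1 (\<lambda>_. 1) = (\<lambda>_::nat. 1 :: complex)" by (auto split: nat.split)
  then show ?thesis using ext_mat_diag[of 1 m "\<lambda>_. 1"] by simp
qed

lemma hermitian_adjoint_conj:
  assumes A: "A \<in> carrier_mat n n" "hermitian_mat A" and U: "U \<in> carrier_mat n n"
  shows "hermitian_mat (mat_adjoint U * A * U)"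
  using A U mat_adjoint_carrier[OF U] unfolding hermitian_mat_def
  by (simp add: mat_adjoint_mult[of _ n n _ n] mat_adjoint_adjoint[of U n n]
      assoc_mult_mat[of _ n n _ n _ n])

text \<open>Deflation: the reflection \<open>W\<close> moves an eigenvector to \<open>e_0\<close>,
  so the first column of \<open>W A W\<close> is a multiple of \<open>e_0\<close>. Hermiticity then
  clears the first row as well, and the induction hypothesis diagonalizes the remaining
  block.\<close>

lemma hermitian_unitary_diag:
  assumes "A \<in> carrier_mat n n" "hermitian_mat A"
  shows "\<exists>U h. U \<in> carrier_mat n n \<and> mat_adjoint U * U = 1\<^sub>m n \<and>
    mat_adjoint U * A * U = mat_diag n (\<lambda>i. complex_of_real (h i))"
  using assms
proof (induction n arbitrary: A)
  case 0
  show ?case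
    by (intro exI[of _ "1\<^sub>m 0"] exI[of _ "\<lambda>_. 0"]) (use 0 in \<open>auto intro!: eq_matI simp: mat_diag_def\<close>)
next
  case (Suc m)
  let ?n = "Suc m"
  note A = Suc.prems(1)
  obtain v l r where v: "v \<in> carrier_vec ?n" "vnorm v = 1" "0 \<le> r" "v $ 0 = complex_of_real r"
    and Av: "A *\<^sub>v v = l \<cdot>\<^sub>v v"
    using unit_eigenvector_ex[OF A] by (metis zero_less_Suc)
  obtain W where W: "W \<in> carrier_mat ?n ?n" and Wh: "mat_adjoint W = W" and WW: "W * W = 1\<^sub>m ?n"
    and W0: "\<And>i. i < ?n \<Longrightarrow> W $$ (i, 0) = v $ i"
    using householder[OF v(1,2) _ v(3,4)] by auto
  define B where "B = W * A * W"
  have B: "B \<in> carrier_mat ?n ?n" using A W by (simp add: B_def)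
  have Bh: "hermitian_mat B" using hermitian_adjoint_conj[OF Suc.prems W] by (simp add: B_def Wh)
  have AW0: "(A * W) $$ (i, 0) = l * W $$ (i, 0)" if "i < ?n" for i
  proof -
    have "(A * W) $$ (i, 0) = (A *\<^sub>v v) $ i"
      using A W v that W0
      by (simp add: mult_mat_index[of _ ?n ?n] mult_vec_index[of _ ?n ?n]
          del: index_mult_mat(1) index_mult_mat_vec sum.lessThan_Suc)
    then show ?thesis using v that W0 by (simp add: Av)
  qed
  have B0: "B $$ (i, 0) = (if i = 0 then l else 0)" if "i < ?n" for i
  proof -
    have "B $$ (i, 0) = (W * (A * W)) $$ (i, 0)"
      unfolding B_def using A W by (subst assoc_mult_mat[of _ ?n ?n _ ?n _ ?n]) auto
    also have "\<dots> = (\<Sum>k<?n. W $$ (i, k) * (A * W) $$ (k, 0))"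
      using A W that by (intro mult_mat_index[of _ ?n ?n _ ?n]) auto
    also have "\<dots> = (\<Sum>k<?n. l * (W $$ (i, k) * W $$ (k, 0)))"
      by (intro sum.cong) (simp_all add: AW0 ac_simps del: index_mult_mat(1))
    also have "\<dots> = l * (\<Sum>k<?n. W $$ (i, k) * W $$ (k, 0))"
      by (rule sum_distrib_left[symmetric])
    also have "(\<Sum>k<?n. W $$ (i, k) * W $$ (k, 0)) = (W * W) $$ (i, 0)"
      using W that by (intro mult_mat_index[of _ ?n ?n _ ?n, symmetric]) auto
    finally show ?thesis using that by (simp add: WW)
  qed
  \<comment> \<open>The eigenvalue is now a diagonal entry of a Hermitian matrix, hence
    real.\<close>
  have lr: "l = complex_of_real (Re l)"
  proof -
    have "B $$ (0, 0) = cnj (B $$ (0, 0))" by (rule hermitian_index[OF B Bh]) auto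
    then have "Im (B $$ (0, 0)) = Im (cnj (B $$ (0, 0)))" by (rule arg_cong)
    then have "Im l = 0" using B0[of 0] by simp
    then show ?thesis by (simp add: complex_eq_iff)
  qed
  define C where "C = mat m m (\<lambda>(i, j). B $$ (Suc i, Suc j))"
  have C: "C \<in> carrier_mat m m" by (simp add: C_def)
  have BC: "B = ext_mat l m C"
  proof (rule eq_matI)
    fix i j assume "i < dim_row (ext_mat l m C)" "j < dim_col (ext_mat l m C)"
    then have "i < ?n" "j < ?n" by (simp_all add: ext_mat_def)
    moreover have "B $$ (0, Suc k) = 0" if "Suc k < ?n" for k
    proof -
      have "B $$ (0, Suc k) = cnj (B $$ (Suc k, 0))" using that by (intro hermitian_index[OF B Bh]) auto
      then show ?thesis using B0[OF that] by simp
    qed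
    ultimately show "B $$ (i, j) = ext_mat l m C $$ (i, j)"
      using B0 by (cases i; cases j) (auto simp: C_def)
  qed (use B in \<open>simp_all add: ext_mat_def\<close>)
  have "hermitian_mat C"
  proof (rule hermitian_matI[OF C])
    fix i j assume "i < m" "j < m"
    then show "C $$ (i, j) = cnj (C $$ (j, i))"
      using hermitian_index[OF B Bh, of "Suc i" "Suc j"] by (simp add: C_def)
  qed
  from Suc.IH[OF C this] obtain V h where V: "V \<in> carrier_mat m m"
    and VV: "mat_adjoint V * V = 1\<^sub>m m"
    and VC: "mat_adjoint V * C * V = mat_diag m (\<lambda>i. complex_of_real (h i))" by blast
  define X where "X = ext_mat 1 m V"
  have X: "X \<in> carrier_mat ?n ?n" by (simp add: X_def)
  have XA: "mat_adjoint X = ext_mat 1 m (mat_adjoint V)"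
    using ext_mat_adjoint[OF V, of 1] by (simp add: X_def)
  have XX: "mat_adjoint X * X = 1\<^sub>m ?n"
    unfolding XA using V VV by (simp add: X_def ext_mat_mult ext_mat_one)
  have XB: "mat_adjoint X * B * X = mat_diag ?n (case_nat l (\<lambda>i. complex_of_real (h i)))"
    unfolding XA BC unfolding X_def ext_mat_mult[OF mat_adjoint_carrier[OF V] C]
    using V C by (subst ext_mat_mult) (auto simp: VC ext_mat_diag)
  have d: "case_nat l (\<lambda>i. complex_of_real (h i)) = (\<lambda>i. complex_of_real (case_nat (Re l) h i))"
    using lr by (auto split: nat.split)
  note XAc = mat_adjoint_carrier[OF X]
  show ?case
  proof (intro exI conjI)
    show "W * X \<in> carrier_mat ?n ?n" using W X by simp
    have a: "mat_adjoint (W * X) = mat_adjoint X * W"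
      using W X Wh by (simp add: mat_adjoint_mult)
    have "mat_adjoint X * W * (W * X) = mat_adjoint X * (W * W) * X"
      using W X XAc by (simp add: assoc_mult_mat[of _ ?n ?n _ ?n _ ?n])
    then show "mat_adjoint (W * X) * (W * X) = 1\<^sub>m ?n"
      using XX XAc right_mult_one_mat[OF XAc] by (simp add: a WW del: right_mult_one_mat)
    have "mat_adjoint X * W * A * (W * X) = mat_adjoint X * B * X"
      unfolding B_def using A W X XAc by (simp add: assoc_mult_mat[of _ ?n ?n _ ?n _ ?n])
    then show "mat_adjoint (W * X) * A * (W * X) =
        mat_diag ?n (\<lambda>i. complex_of_real (case_nat (Re l) h i))"
      by (simp add: a XB d)
  qed
qed

lemma sorting_bijection_ex:
  fixes h :: "nat \<Rightarrow> real"
  shows "\<exists>p. bij_betw p {..<n} {..<n} \<and> (\<forall>i j. i \<le> j \<longrightarrow> j < n \<longrightarrow> h (p i) \<le> h (p j))"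
proof -
  define xs where "xs = sort_key h [0..<n]"
  have len: "length xs = n" unfolding xs_def by simp
  have dist: "distinct xs" unfolding xs_def by simp
  have set: "set xs = {..<n}" unfolding xs_def by auto
  have sorted: "sorted (map h xs)" unfolding xs_def by (rule sorted_sort_key)
  have "bij_betw ((!) xs) {..<length xs} (set xs)"
    by (rule bij_betw_nth[OF dist refl refl])
  moreover have "h (xs ! i) \<le> h (xs ! j)" if "i \<le> j" "j < n" for i j
    using sorted_nth_mono[OF sorted that(1)] that len by (metis le_less_trans length_map nth_map)
  ultimately show ?thesis unfolding len set by (intro exI[of _ "(!) xs"] conjI allI impI)
qed

text \<open>The ordering matters: with increasing eigenvalues of \<open>H\<close>, those of
  \<open>1 - \<delta> H\<close> decrease, so that projections onto the first coordinates select its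
  largest eigenvalues, as the slicing argument requires. It is obtained by permuting the columns of
  an unordered diagonalization.\<close>

theorem hermitian_spectral:
  assumes A: "A \<in> carrier_mat n n" "hermitian_mat A"
  obtains U h where "U \<in> carrier_mat n n" "mat_adjoint U * U = 1\<^sub>m n" "U * mat_adjoint U = 1\<^sub>m n"
    "A = U * mat_diag n (\<lambda>i. complex_of_real (h i)) * mat_adjoint U"
    "\<And>i j. i \<le> j \<Longrightarrow> j < n \<Longrightarrow> h i \<le> h j"
proof -
  obtain V k where V: "V \<in> carrier_mat n n" and VV: "mat_adjoint V * V = 1\<^sub>m n"
    and VA: "mat_adjoint V * A * V = mat_diag n (\<lambda>i. complex_of_real (k i))"
    using hermitian_unitary_diag[OF A] by blast
  obtain p where p: "bij_betw p {..<n} {..<n}"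
    and mono: "\<And>i j. i \<le> j \<Longrightarrow> j < n \<Longrightarrow> k (p i) \<le> k (p j)"
    using sorting_bijection_ex[of n k] by blast
  have pn: "p i < n" if "i < n" for i using p that by (auto simp: bij_betw_def)
  have pinj: "p i = p j \<longleftrightarrow> i = j" if "i < n" "j < n" for i j
    using p that by (auto simp: bij_betw_def inj_on_def)
  define U where "U = mat n n (\<lambda>(i, j). V $$ (i, p j))"
  have U: "U \<in> carrier_mat n n" by (simp add: U_def)
  \<comment> \<open>Permuting the columns of \<open>V\<close> permutes rows and columns of every
    conjugate. Taking \<open>X = 1\<close> gives unitarity of \<open>U\<close>, and
    \<open>X = A\<close> the ordered diagonal form.\<close>
  have perm: "(mat_adjoint U * (X * U)) $$ (i, j) = (mat_adjoint V * (X * V)) $$ (p i, p j)"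
    if X: "X \<in> carrier_mat n n" and ij: "i < n" "j < n" for X i j
  proof -
    have XU: "(X * U) $$ (l, j) = (X * V) $$ (l, p j)" if l: "l < n" for l
    proof -
      have "(X * U) $$ (l, j) = (\<Sum>k<n. X $$ (l, k) * U $$ (k, j))"
        using l ij by (intro mult_mat_index[OF X U])
      also have "\<dots> = (\<Sum>k<n. X $$ (l, k) * V $$ (k, p j))"
        using ij by (intro sum.cong) (simp_all add: U_def)
      also have "\<dots> = (X * V) $$ (l, p j)"
        using l ij pn by (intro mult_mat_index[OF X V, symmetric])
      finally show ?thesis .
    qed
    have "(mat_adjoint U * (X * U)) $$ (i, j) = (\<Sum>l<n. mat_adjoint U $$ (i, l) * (X * U) $$ (l, j))"
      using X U ij by (intro mult_mat_index[of _ n n _ n] mult_carrier_mat[of _ n n] mat_adjoint_carrier)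
    also have "\<dots> = (\<Sum>l<n. mat_adjoint V $$ (p i, l) * (X * V) $$ (l, p j))"
    proof (rule sum.cong[OF refl])
      fix l assume "l \<in> {..<n}"
      then have l: "l < n" by simp
      have "mat_adjoint U $$ (i, l) = mat_adjoint V $$ (p i, l)"
        using ij l pn[of i] by (simp add: mat_adjoint_index[OF U] mat_adjoint_index[OF V])
          (simp add: U_def)
      then show "mat_adjoint U $$ (i, l) * (X * U) $$ (l, j)
        = mat_adjoint V $$ (p i, l) * (X * V) $$ (l, p j)"
        unfolding XU[OF l] by (rule arg_cong)
    qed
    also have "\<dots> = (mat_adjoint V * (X * V)) $$ (p i, p j)"
      using X V ij pn
      by (intro mult_mat_index[of _ n n _ n, symmetric] mult_carrier_mat[of _ n n] mat_adjoint_carrier)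
    finally show ?thesis .
  qed
  have UU: "mat_adjoint U * U = 1\<^sub>m n"
  proof (rule eq_matI)
    fix i j assume "i < dim_row (1\<^sub>m n :: complex mat)" "j < dim_col (1\<^sub>m n :: complex mat)"
    then have ij: "i < n" "j < n" by auto
    have "(mat_adjoint U * (1\<^sub>m n * U)) $$ (i, j) = (mat_adjoint V * (1\<^sub>m n * V)) $$ (p i, p j)"
      using ij by (intro perm) auto
    then have "(mat_adjoint U * U) $$ (i, j) = (1\<^sub>m n :: complex mat) $$ (p i, p j)"
      unfolding left_mult_one_mat[OF U] left_mult_one_mat[OF V] VV .
    also have "\<dots> = 1\<^sub>m n $$ (i, j)" using ij pn pinj[OF ij] by simp
    finally show "(mat_adjoint U * U) $$ (i, j) = 1\<^sub>m n $$ (i, j)" .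
  qed (use U in auto)
  note Uc = mat_adjoint_carrier[OF U]
  have UU': "U * mat_adjoint U = 1\<^sub>m n"
    using mat_mult_left_right_inverse[OF Uc U UU] .
  have UA: "mat_adjoint U * A * U = mat_diag n (\<lambda>i. complex_of_real (k (p i)))"
  proof (rule eq_matI)
    fix i j assume "i < dim_row (mat_diag n (\<lambda>i. complex_of_real (k (p i))))"
      "j < dim_col (mat_diag n (\<lambda>i. complex_of_real (k (p i))))"
    then have ij: "i < n" "j < n" by (auto simp: mat_diag_def)
    have "(mat_adjoint U * A * U) $$ (i, j) = (mat_adjoint V * A * V) $$ (p i, p j)"
      using perm[OF A(1) ij]
      unfolding assoc_mult_mat[OF Uc A(1) U] assoc_mult_mat[OF mat_adjoint_carrier[OF V] A(1) V] .
    also have "\<dots> = mat_diag n (\<lambda>i. complex_of_real (k (p i))) $$ (i, j)"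
      unfolding VA using ij pn pinj[OF ij] by (simp add: mat_diag_def)
    finally show "(mat_adjoint U * A * U) $$ (i, j)
      = mat_diag n (\<lambda>i. complex_of_real (k (p i))) $$ (i, j)" .
  qed (use U in \<open>auto simp: mat_diag_def\<close>)
  have "U * (X * A * U) * X = (U * X) * A * (U * X)" if "X \<in> carrier_mat n n" for X
    using U that A(1) by (simp add: assoc_mult_mat[of _ n n _ n _ n])
  from this[OF Uc] have "U * (mat_adjoint U * A * U) * mat_adjoint U
      = (U * mat_adjoint U) * A * (U * mat_adjoint U)" .
  also have "\<dots> = A" using A(1) by (simp add: UU')
  finally have "A = U * mat_diag n (\<lambda>i. complex_of_real (k (p i))) * mat_adjoint U"
    by (simp add: UA)
  with U UU UU' show thesis using mono by (rule that)
qed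

section \<open>The matrix exponential\<close>

lemma mult_square_carrier [simp]:
  "\<lbrakk>A \<in> carrier_mat n n; B \<in> carrier_mat n n\<rbrakk> \<Longrightarrow> A * B \<in> carrier_mat n n"
  by simp

lemma mat_bound_pow:
  assumes "mat_bound n A a" "0 \<le> a" shows "mat_bound n (A ^\<^sub>m k) (a ^ k)"
proof (induction k)
  case 0
  show ?case using mat_bound_carrier[OF assms(1)] mat_bound_one[of n] by simp
next
  case (Suc k)
  show ?case using mat_bound_mult[OF Suc assms(1)] assms(2) by (simp add: mult.commute)
qed

lemma mexp_carrier [simp]: "A \<in> carrier_mat n n \<Longrightarrow> mexp A \<in> carrier_mat n n"
  by (auto simp: mexp_def)

text \<open>Absolute convergence, by comparison with the series of \<open>exp a\<close>, is what
  permits the Cauchy product in \<open>mexp_add\<close>.\<close>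

lemma mexp_summable_norm:
  fixes A :: "complex mat"
  assumes A: "A \<in> carrier_mat n n" and "i < n" "j < n"
  shows "summable (\<lambda>k. norm ((A ^\<^sub>m k) $$ (i, j) / fact k))"
proof -
  obtain a where a: "a \<ge> 0" "mat_bound n A a" using mat_bound_ex[OF A] by auto
  show ?thesis
  proof (rule summable_comparison_test')
    show "summable (\<lambda>k. inverse (fact k) * a ^ k)" by (rule summable_exp)
    fix k :: nat
    have "cmod ((A ^\<^sub>m k) $$ (i, j)) \<le> a ^ k"
      using mat_bound_index[OF mat_bound_pow[OF a(2,1)]] assms by simp
    then show "norm (norm ((A ^\<^sub>m k) $$ (i, j) / fact k)) \<le> inverse (fact k) * a ^ k"
      by (simp add: norm_divide field_simps)
  qed
qed

lemma mexp_sums: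
  assumes A: "A \<in> carrier_mat n n" and "i < n" "j < n"
  shows "(\<lambda>k. (A ^\<^sub>m k) $$ (i, j) / fact k) sums (mexp A $$ (i, j))"
  using summable_sums[OF summable_norm_cancel[OF mexp_summable_norm[OF assms]]] assms
  by (simp add: mexp_def)

text \<open>The relation passes to all powers and then termwise to the series. One lemma thus covers
  commuting matrices (\<open>A = B\<close>), changes of basis (\<open>X\<close> invertible) and the
  shift of a charge (\<open>B = A + k\<close>).\<close>

lemma mexp_intertwine:
  assumes A: "A \<in> carrier_mat n n" and B: "B \<in> carrier_mat n n" and X: "X \<in> carrier_mat n n"
    and AX: "A * X = X * B"
  shows "mexp A * X = X * mexp B"
proof (rule eq_matI)
  have pow: "A ^\<^sub>m k * X = X * B ^\<^sub>m k" for k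
  proof (induction k)
    case (Suc k)
    have "A ^\<^sub>m Suc k * X = A ^\<^sub>m k * X * B"
      using A B X AX by (simp add: assoc_mult_mat[of _ n n _ n _ n])
    also have "\<dots> = X * B ^\<^sub>m Suc k"
      using B X by (simp add: Suc assoc_mult_mat[of _ n n _ n _ n])
    finally show ?case .
  qed (use A B X in auto)
  fix i j assume "i < dim_row (X * mexp B)" "j < dim_col (X * mexp B)"
  then have ij: "i < n" "j < n" using X B by (auto simp: mexp_def)
  have "(\<lambda>k. \<Sum>l<n. (A ^\<^sub>m k) $$ (i, l) / fact k * X $$ (l, j)) sums (mexp A * X) $$ (i, j)"
    unfolding mult_mat_index[OF mexp_carrier[OF A] X ij]
    by (intro sums_sum sums_mult2 mexp_sums[OF A ij(1)]) simp
  moreover have "(\<lambda>k. \<Sum>l<n. X $$ (i, l) * ((B ^\<^sub>m k) $$ (l, j) / fact k)) sums (X * mexp B) $$ (i, j)"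
    unfolding mult_mat_index[OF X mexp_carrier[OF B] ij]
    by (intro sums_sum sums_mult mexp_sums[OF B _ ij(2)]) simp
  moreover have "(\<Sum>l<n. (A ^\<^sub>m k) $$ (i, l) / fact k * X $$ (l, j))
      = (\<Sum>l<n. X $$ (i, l) * ((B ^\<^sub>m k) $$ (l, j) / fact k))" for k
  proof -
    have "(\<Sum>l<n. (A ^\<^sub>m k) $$ (i, l) / fact k * X $$ (l, j)) = (A ^\<^sub>m k * X) $$ (i, j) / fact k"
      using A X ij by (subst mult_mat_index[of _ n n]) (auto simp: sum_divide_distrib)
    also have "\<dots> = (\<Sum>l<n. X $$ (i, l) * ((B ^\<^sub>m k) $$ (l, j) / fact k))"
      unfolding pow using B X ij by (subst mult_mat_index[of _ n n]) (auto simp: sum_divide_distrib)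
    finally show ?thesis .
  qed
  ultimately show "(mexp A * X) $$ (i, j) = (X * mexp B) $$ (i, j)" by (simp add: sums_unique2)
qed (use A B X in \<open>auto simp: mexp_def\<close>)

text \<open>Pascal's rule for an arbitrary array, the induction step of the binomial theorem;
  \<open>F p q\<close> will be an entry of \<open>A^p B^q\<close>.\<close>

lemma pascal_sum:
  fixes F :: "nat \<Rightarrow> nat \<Rightarrow> complex"
  shows "(\<Sum>p\<le>k. of_nat (k choose p) * (F (Suc p) (k - p) + F p (Suc (k - p)))) =
    (\<Sum>p\<le>Suc k. of_nat (Suc k choose p) * F p (Suc k - p))"
proof -
  have "(\<Sum>p\<le>Suc k. of_nat (Suc k choose p) * F p (Suc k - p)) =
      F 0 (Suc k) + (\<Sum>p\<le>k. of_nat (k choose p) * F (Suc p) (k - p))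
        + (\<Sum>p\<le>k. of_nat (k choose Suc p) * F (Suc p) (k - p))"
    by (simp add: sum.atMost_Suc_shift sum.distrib algebra_simps del: sum.atMost_Suc)
  also have "F 0 (Suc k) + (\<Sum>p\<le>k. of_nat (k choose p) * F (Suc p) (k - p))
        + (\<Sum>p\<le>k. of_nat (k choose Suc p) * F (Suc p) (k - p)) =
      (\<Sum>p\<le>k. of_nat (k choose p) * F (Suc p) (k - p))
        + (\<Sum>p\<le>Suc k. of_nat (k choose p) * F p (Suc k - p))"
    by (simp add: sum.atMost_Suc_shift del: sum.atMost_Suc)
  also have "(\<Sum>p\<le>Suc k. of_nat (k choose p) * F p (Suc k - p)) =
      (\<Sum>p\<le>k. of_nat (k choose p) * F p (Suc (k - p)))"
    by (simp add: Suc_diff_le)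
  finally show ?thesis by (simp add: sum.distrib algebra_simps)
qed

lemma commuting_mat_pow:
  fixes A B :: "complex mat"
  assumes A: "A \<in> carrier_mat n n" and B: "B \<in> carrier_mat n n" and AB: "A * B = B * A"
  shows "B ^\<^sub>m k * A = A * B ^\<^sub>m k"
proof (induction k)
  case (Suc k)
  have "B ^\<^sub>m Suc k * A = (B ^\<^sub>m k * A) * B"
    using A B by (simp add: assoc_mult_mat[of _ n n _ n _ n] AB)
  also have "\<dots> = A * B ^\<^sub>m Suc k" using A B by (simp add: Suc assoc_mult_mat[of _ n n _ n _ n])
  finally show ?case .
qed (use A B in auto)

lemma mat_binomial:
  fixes A B :: "complex mat"
  assumes A: "A \<in> carrier_mat n n" and B: "B \<in> carrier_mat n n" and AB: "A * B = B * A"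
    and ij: "i < n" "j < n"
  shows "((A + B) ^\<^sub>m k) $$ (i, j) =
    (\<Sum>p\<le>k. of_nat (k choose p) * (A ^\<^sub>m p * B ^\<^sub>m (k - p)) $$ (i, j))"
  using ij
proof (induction k arbitrary: i j)
  case 0
  then show ?case using A B by auto
next
  case (Suc k)
  note ij = Suc.prems
  have "((A + B) ^\<^sub>m Suc k) $$ (i, j) = (\<Sum>l<n. ((A + B) ^\<^sub>m k) $$ (i, l) * (A + B) $$ (l, j))"
    unfolding pow_mat.simps using A B ij
    by (intro mult_mat_index[of _ n n _ n] pow_carrier_mat add_carrier_mat)
  also have "\<dots> = (\<Sum>l<n. (\<Sum>p\<le>k. of_nat (k choose p) * (A ^\<^sub>m p * B ^\<^sub>m (k - p)) $$ (i, l)) * (A + B) $$ (l, j))"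
    using Suc ij by (intro sum.cong) auto
  also have "\<dots> = (\<Sum>p\<le>k. \<Sum>l<n. of_nat (k choose p) * ((A ^\<^sub>m p * B ^\<^sub>m (k - p)) $$ (i, l) * (A + B) $$ (l, j)))"
    unfolding sum_distrib_right by (subst sum.swap) (simp add: mult.assoc)
  also have "\<dots> = (\<Sum>p\<le>k. of_nat (k choose p) * (A ^\<^sub>m p * B ^\<^sub>m (k - p) * (A + B)) $$ (i, j))"
    using A B ij by (intro sum.cong refl, subst mult_mat_index[of _ n n _ n])
      (auto simp: sum_distrib_left simp del: index_mult_mat(1) index_add_mat(1))
  also have "\<dots> = (\<Sum>p\<le>k. of_nat (k choose p) *
      ((A ^\<^sub>m Suc p * B ^\<^sub>m (k - p)) $$ (i, j) + (A ^\<^sub>m p * B ^\<^sub>m Suc (k - p)) $$ (i, j)))"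
  proof (intro sum.cong refl arg_cong2[where f = "(*)"])
    fix p
    have "A ^\<^sub>m p * B ^\<^sub>m (k - p) * (A + B)
        = A ^\<^sub>m p * (B ^\<^sub>m (k - p) * A) + A ^\<^sub>m p * (B ^\<^sub>m (k - p) * B)"
      using A B by (simp add: mult_add_distrib_mat[of _ n n] assoc_mult_mat[of _ n n _ n _ n])
    also have "\<dots> = A ^\<^sub>m Suc p * B ^\<^sub>m (k - p) + A ^\<^sub>m p * B ^\<^sub>m Suc (k - p)"
      using A B by (simp add: commuting_mat_pow[OF A B AB] assoc_mult_mat[of _ n n _ n _ n])
    finally show "(A ^\<^sub>m p * B ^\<^sub>m (k - p) * (A + B)) $$ (i, j) =
      (A ^\<^sub>m Suc p * B ^\<^sub>m (k - p)) $$ (i, j) + (A ^\<^sub>m p * B ^\<^sub>m Suc (k - p)) $$ (i, j)"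
      using A B ij by (simp del: index_mult_mat(1))
  qed
  also have "\<dots> = (\<Sum>p\<le>Suc k. of_nat (Suc k choose p) * (A ^\<^sub>m p * B ^\<^sub>m (Suc k - p)) $$ (i, j))"
    by (rule pascal_sum)
  finally show ?case .
qed

text \<open>Each entry of the product is a finite sum of Cauchy products of absolutely convergent
  scalar series; by the binomial theorem their terms of order \<open>k\<close> add up to the entry
  of \<open>(A + B)^k / k!\<close>.\<close>

lemma mexp_add:
  assumes A: "A \<in> carrier_mat n n" and B: "B \<in> carrier_mat n n" and AB: "A * B = B * A"
  shows "mexp (A + B) = mexp A * mexp B"
proof (rule eq_matI)
  fix i j assume "i < dim_row (mexp A * mexp B)" "j < dim_col (mexp A * mexp B)"
  then have ij: "i < n" "j < n" using A B by (auto simp: mexp_def)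
  let ?a = "\<lambda>l p. (A ^\<^sub>m p) $$ (i, l) / fact p" and ?b = "\<lambda>l q. (B ^\<^sub>m q) $$ (l, j) / fact q"
  have "(\<lambda>k. \<Sum>p\<le>k. ?a l p * ?b l (k - p)) sums (mexp A $$ (i, l) * mexp B $$ (l, j))"
    if "l < n" for l
    using Cauchy_product_sums[OF mexp_summable_norm[OF A ij(1) that] mexp_summable_norm[OF B that ij(2)]]
      mexp_sums[OF A ij(1) that] mexp_sums[OF B that ij(2)] by (simp add: sums_iff)
  then have "(\<lambda>k. \<Sum>l<n. \<Sum>p\<le>k. ?a l p * ?b l (k - p)) sums (mexp A * mexp B) $$ (i, j)"
    using A B ij by (subst mult_mat_index[of _ n n]) (auto intro!: sums_sum)
  moreover have "(\<Sum>l<n. \<Sum>p\<le>k. ?a l p * ?b l (k - p)) = ((A + B) ^\<^sub>m k) $$ (i, j) / fact k" for k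
  proof -
    have "(\<Sum>l<n. \<Sum>p\<le>k. ?a l p * ?b l (k - p)) = (\<Sum>p\<le>k. \<Sum>l<n. ?a l p * ?b l (k - p))"
      by (rule sum.swap)
    also have "\<dots> = (\<Sum>p\<le>k. of_nat (k choose p) * (A ^\<^sub>m p * B ^\<^sub>m (k - p)) $$ (i, j) / fact k)"
    proof (intro sum.cong refl)
      fix p assume "p \<in> {..k}"
      then have c: "of_nat (k choose p) / fact k = (1 / (fact p * fact (k - p)) :: complex)"
        by (simp add: binomial_fact field_simps)
      have "(\<Sum>l<n. ?a l p * ?b l (k - p)) =
          (\<Sum>l<n. (A ^\<^sub>m p) $$ (i, l) * (B ^\<^sub>m (k - p)) $$ (l, j)) / (fact p * fact (k - p))"
        by (simp add: sum_divide_distrib)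
      also have "\<dots> = (A ^\<^sub>m p * B ^\<^sub>m (k - p)) $$ (i, j) * (of_nat (k choose p) / fact k)"
        using A B ij unfolding c by (subst mult_mat_index[of _ n n _ n]) auto
      finally show "(\<Sum>l<n. ?a l p * ?b l (k - p)) =
        of_nat (k choose p) * (A ^\<^sub>m p * B ^\<^sub>m (k - p)) $$ (i, j) / fact k" by (simp add: mult.commute)
    qed
    also have "\<dots> = ((A + B) ^\<^sub>m k) $$ (i, j) / fact k"
      by (simp add: mat_binomial[OF A B AB ij] sum_divide_distrib)
    finally show ?thesis .
  qed
  ultimately have "(\<lambda>k. ((A + B) ^\<^sub>m k) $$ (i, j) / fact k) sums (mexp A * mexp B) $$ (i, j)"
    by simp
  moreover have "A + B \<in> carrier_mat n n" using A B by simp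
  ultimately show "mexp (A + B) $$ (i, j) = (mexp A * mexp B) $$ (i, j)"
    using mexp_sums[OF _ ij] sums_unique2 by blast
qed (use A B in \<open>auto simp: mexp_def\<close>)

section \<open>Exponentials of diagonal and of conjugated matrices\<close>

lemma mat_diag_pow: "mat_diag n d ^\<^sub>m k = mat_diag n (\<lambda>i. d i ^ k :: complex)"
proof (induction k)
  case 0
  show ?case by (simp add: mat_diag_def flip: mat_diag_one)
next
  case (Suc k)
  then show ?case by (simp add: mult.commute)
qed

lemma mexp_diag: "mexp (mat_diag n d) = mat_diag n (\<lambda>i. exp (d i))"
proof (rule eq_matI)
  fix i j assume "i < dim_row (mat_diag n (\<lambda>i. exp (d i)))" "j < dim_col (mat_diag n (\<lambda>i. exp (d i)))"
  then have ij: "i < n" "j < n" by (auto simp: mat_diag_def)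
  have "(\<lambda>k. (mat_diag n d ^\<^sub>m k) $$ (i, j) / fact k) sums mat_diag n (\<lambda>i. exp (d i)) $$ (i, j)"
  proof (cases "i = j")
    case True
    then show ?thesis using ij exp_converges[of "d i"] unfolding mat_diag_pow
      by (simp add: mat_diag_def scaleR_conv_of_real divide_inverse mult.commute)
  next
    case False
    then show ?thesis using ij unfolding mat_diag_pow by (simp add: mat_diag_def)
  qed
  then show "mexp (mat_diag n d) $$ (i, j) = mat_diag n (\<lambda>i. exp (d i)) $$ (i, j)"
    using mexp_sums[OF mat_diag_dim ij, of d] sums_unique2 by blast
qed (auto simp: mexp_def mat_diag_def)

lemma mexp_zero: "mexp (0\<^sub>m n n) = 1\<^sub>m n"
proof -
  have "0\<^sub>m n n = mat_diag n (\<lambda>_. 0 :: complex)" by (auto simp: mat_diag_def)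
  then show ?thesis by (simp add: mexp_diag)
qed

lemma mexp_uminus_right:
  assumes A: "A \<in> carrier_mat n n"
  shows "mexp A * mexp (- A) = 1\<^sub>m n"
proof -
  have "mexp A * mexp (- A) = mexp (A + - A)" using A by (subst mexp_add[of _ n]) auto
  also have "A + - A = 0\<^sub>m n n" using A by auto
  finally show ?thesis by (simp add: mexp_zero)
qed

lemma mexp_uminus_left:
  assumes A: "A \<in> carrier_mat n n"
  shows "mexp (- A) * mexp A = 1\<^sub>m n"
  using mexp_uminus_right[of "- A" n] A by simp

lemma mexp_unitary_conj:
  assumes U: "U \<in> carrier_mat n n" and V: "V \<in> carrier_mat n n" and B: "B \<in> carrier_mat n n"
    and VU: "V * U = 1\<^sub>m n" and UV: "U * V = 1\<^sub>m n"
  shows "mexp (U * B * V) = U * mexp B * V"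
proof -
  have "U * B * V * U = U * B"
    using U V B VU by (simp add: assoc_mult_mat[of _ n n _ n _ n])
  then have "mexp (U * B * V) * U = U * mexp B" using U V B by (intro mexp_intertwine) auto
  then have "mexp (U * B * V) * U * V = U * mexp B * V" by simp
  then show ?thesis using U V B UV right_mult_one_mat[of "mexp (U * B * V)" n n]
    by (simp add: assoc_mult_mat[of _ n n _ n _ n])
qed

section \<open>A Hoelder inequality for products with a diagonal matrix\<close>

text \<open>Abel summation: a decreasing sequence is a nonnegative combination of indicators of
  initial segments, so bounds on partial sums suffice. The offset \<open>c\<close> drives the
  induction: removing the last index raises it to \<open>t n\<close>.\<close>

lemma abel_sum_bound:
  fixes t b :: "nat \<Rightarrow> real" and g :: "nat \<Rightarrow> complex"
  assumes "\<And>l. l \<le> n \<Longrightarrow> cmod (\<Sum>i<l. g i) \<le> (\<Sum>i<l. b i)"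
    and "\<And>i j. i \<le> j \<Longrightarrow> j < n \<Longrightarrow> t j \<le> t i"
    and "\<And>i. i < n \<Longrightarrow> c \<le> t i" and "0 \<le> c"
  shows "cmod (\<Sum>i<n. complex_of_real (t i - c) * g i) \<le> (\<Sum>i<n. (t i - c) * b i)"
  using assms
proof (induction n arbitrary: c)
  case (Suc n)
  \<comment> \<open>Stated for an arbitrary additive \<open>f\<close>, so that it serves both the
    complex sum (\<open>f = complex_of_real\<close>) and the real one (\<open>f\<close> the
    identity).\<close>
  have split: "(\<Sum>i<Suc n. f (t i - c) * h i) = (\<Sum>i<n. f (t i - t n) * h i) + f (t n - c) * (\<Sum>i<Suc n. h i)"
    if f: "\<And>x y. f (x + y) = f x + f y" for f and h :: "nat \<Rightarrow> 'a :: comm_ring_1"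
  proof -
    have "(\<Sum>i<n. f (t i - c) * h i) = (\<Sum>i<n. f (t i - t n) * h i + f (t n - c) * h i)"
    proof (rule sum.cong[OF refl])
      fix i
      show "f (t i - c) * h i = f (t i - t n) * h i + f (t n - c) * h i"
        using f[of "t i - t n" "t n - c"] by (simp add: distrib_right)
    qed
    then show ?thesis by (simp add: sum.distrib sum_distrib_left distrib_left)
  qed
  have "0 \<le> t n" using Suc.prems(3)[of n] Suc.prems(4) by simp
  then have 1: "cmod (\<Sum>i<n. complex_of_real (t i - t n) * g i) \<le> (\<Sum>i<n. (t i - t n) * b i)"
    using Suc.prems by (intro Suc.IH) auto
  have 2: "cmod (complex_of_real (t n - c) * (\<Sum>i<Suc n. g i)) \<le> (t n - c) * (\<Sum>i<Suc n. b i)"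
    unfolding norm_mult norm_of_real
    using Suc.prems(1)[of "Suc n"] Suc.prems(3)[of n] by (intro mult_mono) auto
  have "cmod (\<Sum>i<Suc n. complex_of_real (t i - c) * g i)
      = cmod ((\<Sum>i<n. complex_of_real (t i - t n) * g i) + complex_of_real (t n - c) * (\<Sum>i<Suc n. g i))"
    by (subst split[of complex_of_real]) auto
  also have "\<dots> \<le> (\<Sum>i<n. (t i - t n) * b i) + (t n - c) * (\<Sum>i<Suc n. b i)"
    using 1 2 by (intro order_trans[OF norm_triangle_ineq] add_mono)
  also have "\<dots> = (\<Sum>i<Suc n. (t i - c) * b i)"
    using split[of "\<lambda>x. x" b] by simp
  finally show ?case .
qed simp

section \<open>Partial sums of singular values without singular values\<close>

lemma mtrace_smult:
  assumes "A \<in> carrier_mat n n" shows "mtrace (c \<cdot>\<^sub>m A) = c * mtrace A"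
  using assms by (simp add: mtrace_def sum_distrib_left)

definition proj_mat :: "nat \<Rightarrow> nat \<Rightarrow> complex mat" where
  "proj_mat n k = mat_diag n (\<lambda>i. if i < k then 1 else 0)"

text \<open>By Ky Fan's variational principle the largest such trace over contractions
  \<open>O1\<close>, \<open>O2\<close> is the sum of the \<open>k\<close> largest singular values of
  \<open>X\<close>. The condition therefore bounds these partial sums without defining singular
  values, and having contractions on both sides makes it stable under products.\<close>

definition ky_fan_bound :: "nat \<Rightarrow> complex mat \<Rightarrow> (nat \<Rightarrow> real) \<Rightarrow> bool" where
  "ky_fan_bound n X s \<longleftrightarrow> X \<in> carrier_mat n n \<and>
     (\<forall>k\<le>n. \<forall>O1 O2. mat_bound n O1 1 \<longrightarrow> mat_bound n O2 1 \<longrightarrow>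
        cmod (mtrace (O1 * X * O2 * proj_mat n k)) \<le> (\<Sum>i<k. s i))"

lemma proj_mat_carrier [simp]: "proj_mat n k \<in> carrier_mat n n"
  by (simp add: proj_mat_def)

lemma proj_mat_bound: "mat_bound n (proj_mat n k) 1"
  unfolding proj_mat_def by (rule mat_bound_diag) auto

lemma mtrace_mult_diag:
  assumes "A \<in> carrier_mat n n"
  shows "mtrace (A * mat_diag n d) = (\<Sum>i<n. A $$ (i, i) * d i)"
  using assms by (simp add: mtrace_def mat_diag_mult_right[of _ n])

lemma mtrace_mult_proj:
  assumes "A \<in> carrier_mat n n" "k \<le> n"
  shows "mtrace (A * proj_mat n k) = (\<Sum>i<k. A $$ (i, i))"
proof -
  have "mtrace (A * proj_mat n k) = (\<Sum>i\<in>{..<n}. if i \<in> {..<k} then A $$ (i, i) else 0)"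
    unfolding proj_mat_def mtrace_mult_diag[OF assms(1)] by (intro sum.cong) auto
  also have "\<dots> = (\<Sum>i\<in>{..<n} \<inter> {..<k}. A $$ (i, i))" by (simp add: sum.inter_restrict)
  also have "{..<n} \<inter> {..<k} = {..<k}" using assms by auto
  finally show ?thesis .
qed

lemma ky_fan_bound_one: "ky_fan_bound n (1\<^sub>m n) (\<lambda>_. 1)"
  unfolding ky_fan_bound_def
proof (intro conjI allI impI)
  fix k O1 O2 assume k: "k \<le> n" and O: "mat_bound n O1 1" "mat_bound n O2 1"
  note c = O[THEN mat_bound_carrier]
  have b: "mat_bound n (O1 * O2) 1" using mat_bound_mult[OF O] by simp
  have "mtrace (O1 * 1\<^sub>m n * O2 * proj_mat n k) = (\<Sum>i<k. (O1 * O2) $$ (i, i))"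
    using mtrace_mult_proj[OF mat_bound_carrier[OF b] k] c by simp
  also have "cmod \<dots> \<le> (\<Sum>i<k. 1)"
    using k mat_bound_index[OF b] by (intro order_trans[OF norm_sum sum_mono]) auto
  finally show "cmod (mtrace (O1 * 1\<^sub>m n * O2 * proj_mat n k)) \<le> (\<Sum>i<k. 1)" .
qed simp

text \<open>After division by \<open>a\<close> the factor \<open>N\<close> is a contraction and is
  absorbed into \<open>O2\<close>.\<close>

lemma ky_fan_bound_mult:
  assumes X: "ky_fan_bound n X s" and N: "mat_bound n N a" and a: "0 < a"
  shows "ky_fan_bound n (X * N) (\<lambda>i. a * s i)"
  unfolding ky_fan_bound_def
proof (intro conjI allI impI)
  have Xc: "X \<in> carrier_mat n n" and Nc: "N \<in> carrier_mat n n"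
    using X mat_bound_carrier[OF N] by (auto simp: ky_fan_bound_def)
  then show "X * N \<in> carrier_mat n n" by simp
  fix k O1 O2 assume k: "k \<le> n" and O: "mat_bound n O1 1" "mat_bound n O2 1"
  note c = O[THEN mat_bound_carrier]
  define N' where "N' = complex_of_real (1 / a) \<cdot>\<^sub>m N"
  have "cmod (complex_of_real (1 / a)) * a = 1" using a by (simp add: norm_divide)
  then have N1: "mat_bound n N' 1"
    unfolding N'_def using mat_bound_smult[OF N, of "complex_of_real (1 / a)"] by (simp only:)
  from mat_bound_mult[OF this O(2)] have b: "mat_bound n (N' * O2) 1" by simp
  note c' = mat_bound_carrier[OF N1]
  have NN': "N = complex_of_real a \<cdot>\<^sub>m N'" using a Nc by (intro eq_matI) (auto simp: N'_def)
  have "O1 * (X * N) * O2 * proj_mat n k = complex_of_real a \<cdot>\<^sub>m (O1 * X * (N' * O2) * proj_mat n k)"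
    using c Xc c' unfolding NN'
    by (simp add: assoc_mult_mat[of _ n n _ n _ n] mult_smult_distrib[of _ n n _ n]
        mult_smult_assoc_mat[of _ n n _ n])
  then have "mtrace (O1 * (X * N) * O2 * proj_mat n k)
      = complex_of_real a * mtrace (O1 * X * (N' * O2) * proj_mat n k)"
    using c Xc c' by (simp add: mtrace_smult[of _ n])
  also have "cmod \<dots> \<le> a * (\<Sum>i<k. s i)"
    using X k O(1) b a by (simp add: norm_mult ky_fan_bound_def)
  finally show "cmod (mtrace (O1 * (X * N) * O2 * proj_mat n k)) \<le> (\<Sum>i<k. a * s i)"
    by (simp add: sum_distrib_left)
qed

text \<open>Cutting the diagonal matrix into projections onto initial segments reduces the trace to
  those of \<open>X\<close> cut off at the smaller of two segments.\<close>

lemma ky_fan_bound_mult_diag: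
  fixes t :: "nat \<Rightarrow> real"
  assumes X: "ky_fan_bound n X s"
    and t: "\<And>i j. i \<le> j \<Longrightarrow> j < n \<Longrightarrow> t j \<le> t i" "\<And>i. i < n \<Longrightarrow> 0 \<le> t i"
  shows "ky_fan_bound n (X * mat_diag n (\<lambda>i. complex_of_real (t i))) (\<lambda>i. s i * t i)"
  unfolding ky_fan_bound_def
proof (intro conjI allI impI)
  let ?T = "mat_diag n (\<lambda>i. complex_of_real (t i))"
  have Xc: "X \<in> carrier_mat n n" using X by (simp add: ky_fan_bound_def)
  then show "X * ?T \<in> carrier_mat n n" by simp
  fix k O1 O2 assume k: "k \<le> n" and O: "mat_bound n O1 1" "mat_bound n O2 1"
  note c = O[THEN mat_bound_carrier]
  define Y where "Y = O2 * proj_mat n k * O1 * X"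
  have Yc: "Y \<in> carrier_mat n n" using c Xc by (simp add: Y_def)
  have cyc: "mtrace (O1 * (X * D) * O2 * proj_mat n k) = mtrace (Y * D)"
    if D: "D \<in> carrier_mat n n" for D
  proof -
    have "O1 * (X * D) * O2 * proj_mat n k = (O1 * (X * D)) * (O2 * proj_mat n k)"
      using c Xc D by (simp add: assoc_mult_mat[of _ n n _ n _ n])
    then have "mtrace (O1 * (X * D) * O2 * proj_mat n k)
        = mtrace ((O2 * proj_mat n k) * (O1 * (X * D)))"
      using c Xc D by (simp add: mtrace_mult_commute[of _ n])
    also have "(O2 * proj_mat n k) * (O1 * (X * D)) = Y * D"
      using c Xc D by (simp add: Y_def assoc_mult_mat[of _ n n _ n _ n])
    finally show ?thesis .
  qed
  have bound: "cmod (mtrace (Y * proj_mat n l)) \<le> (\<Sum>i<min k l. s i)" if l: "l \<le> n" for l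
  \<comment> \<open>The projection of larger rank is absorbed into a contraction and the other one
    serves as the cutoff; this produces the minimum.\<close>
  proof (cases "k \<le> l")
    case True
    have "mat_bound n (proj_mat n l * O2) 1"
      using mat_bound_mult[OF proj_mat_bound O(2)] by simp
    moreover have "mtrace (Y * proj_mat n l) = mtrace (O1 * X * (proj_mat n l * O2) * proj_mat n k)"
      using c Xc by (simp add: assoc_mult_mat[of _ n n _ n _ n] flip: cyc)
    ultimately show ?thesis using X k O True by (simp add: ky_fan_bound_def)
  next
    case False
    have "mat_bound n (O2 * proj_mat n k * O1) 1"
      using mat_bound_mult[OF mat_bound_mult[OF O(2) proj_mat_bound] O(1)] by simp
    moreover have "Y * proj_mat n l = (O2 * proj_mat n k * O1) * X * 1\<^sub>m n * proj_mat n l"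
      using c Xc by (simp add: Y_def)
    ultimately show ?thesis using X l mat_bound_one[of n] False
      by (simp add: ky_fan_bound_def)
  qed
  have "cmod (\<Sum>i<n. complex_of_real (t i - 0) * Y $$ (i, i))
      \<le> (\<Sum>i<n. (t i - 0) * (if i < k then s i else 0))"
  proof (rule abel_sum_bound)
    fix l assume l: "l \<le> n"
    have "(\<Sum>i<min k l. s i) = (\<Sum>i<l. if i < k then s i else 0)"
      by (rule sum.mono_neutral_cong_left) auto
    then show "cmod (\<Sum>i<l. Y $$ (i, i)) \<le> (\<Sum>i<l. if i < k then s i else 0)"
      using bound[OF l] mtrace_mult_proj[OF Yc l] by simp
  qed (use t in auto)
  also have "(\<Sum>i<n. (t i - 0) * (if i < k then s i else 0)) = (\<Sum>i<k. s i * t i)"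
    using k by (intro sum.mono_neutral_cong_right) auto
  also have "(\<Sum>i<n. complex_of_real (t i - 0) * Y $$ (i, i)) = mtrace (Y * ?T)"
    by (simp add: mtrace_mult_diag[OF Yc] mult.commute)
  finally show "cmod (mtrace (O1 * (X * ?T) * O2 * proj_mat n k)) \<le> (\<Sum>i<k. s i * t i)"
    by (simp add: cyc)
qed

text \<open>Each factor \<open>M\<close> multiplies the bounds on the partial sums by
  \<open>a\<close>, and each diagonal factor multiplies the bounding sequence termwise by
  \<open>t\<close>. After \<open>m\<close> rounds the trace is compared with the sum of
  \<open>t i ^ m\<close>, so no factor of the dimension is lost.\<close>

lemma trace_pow_bound:
  fixes t :: "nat \<Rightarrow> real"
  assumes M: "mat_bound n M a" "0 < a" and B: "mat_bound n B b"
    and t: "\<And>i j. i \<le> j \<Longrightarrow> j < n \<Longrightarrow> t j \<le> t i" "\<And>i. i < n \<Longrightarrow> 0 \<le> t i"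
  shows "cmod (mtrace (B * (M * mat_diag n (\<lambda>i. complex_of_real (t i))) ^\<^sub>m m))
    \<le> b * (a ^ m * (\<Sum>i<n. t i ^ m))"
proof (cases "n = 0")
  case True
  then show ?thesis using mat_bound_carrier[OF B] by (simp add: mtrace_def)
next
  case False
  let ?T = "mat_diag n (\<lambda>i. complex_of_real (t i))"
  note Mc = mat_bound_carrier[OF M(1)] and Bc = mat_bound_carrier[OF B]
  have X: "ky_fan_bound n ((M * ?T) ^\<^sub>m m) (\<lambda>i. a ^ m * t i ^ m)"
  proof (induction m)
    case 0
    have "dim_row M = n" using Mc by simp
    then show ?case using ky_fan_bound_one[of n] by simp
  next
    case (Suc m)
    let ?X = "(M * ?T) ^\<^sub>m m"
    have "ky_fan_bound n (?X * M * ?T) (\<lambda>i. a * (a ^ m * t i ^ m) * t i)"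
      using t by (intro ky_fan_bound_mult_diag ky_fan_bound_mult[OF Suc M]) auto
    moreover have "?X * M * ?T = (M * ?T) ^\<^sub>m Suc m"
      using Mc by (simp add: assoc_mult_mat[of _ n n _ n _ n])
    moreover have "(\<lambda>i. a * (a ^ m * t i ^ m) * t i) = (\<lambda>i. a ^ Suc m * t i ^ Suc m)"
      by (simp add: algebra_simps)
    ultimately show ?case by simp
  qed
  have "0 \<le> b" using mat_bound_index[OF B, of 0 0] False norm_ge_zero order_trans by blast
  \<comment> \<open>Since \<open>b\<close> may be 0, \<open>B\<close> is normalized by some
    \<open>b' > b\<close>. The loss is removed afterwards: \<open>b' = b + e / (q + 1)\<close>
    changes the bound by at most \<open>e\<close>.\<close>
  have *: "cmod (mtrace (B * (M * ?T) ^\<^sub>m m)) \<le> b' * (a ^ m * (\<Sum>i<n. t i ^ m))"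
    if b': "b < b'" for b'
  proof -
    have "b' > 0" using b' \<open>0 \<le> b\<close> by simp
    let ?B = "complex_of_real (1 / b') \<cdot>\<^sub>m B"
    have "mat_bound n ?B (cmod (complex_of_real (1 / b')) * b)" by (rule mat_bound_smult[OF B])
    then have B1: "mat_bound n ?B 1"
      by (rule mat_bound_mono) (use \<open>b' > 0\<close> b' in \<open>simp add: norm_divide\<close>)
    have Tc: "(M * ?T) ^\<^sub>m m \<in> carrier_mat n n" using Mc by simp
    have "proj_mat n n = mat_diag n (\<lambda>_. 1)" by (auto simp: proj_mat_def mat_diag_def)
    then have p: "proj_mat n n = 1\<^sub>m n" by simp
    have "cmod (mtrace (?B * (M * ?T) ^\<^sub>m m * 1\<^sub>m n * proj_mat n n)) \<le> (\<Sum>i<n. a ^ m * t i ^ m)"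
      using X B1 mat_bound_one[of n] unfolding ky_fan_bound_def by blast
    also have "?B * (M * ?T) ^\<^sub>m m * 1\<^sub>m n * proj_mat n n
        = complex_of_real (1 / b') \<cdot>\<^sub>m (B * (M * ?T) ^\<^sub>m m)"
      using Bc Tc right_mult_one_mat[OF mult_square_carrier[OF Bc Tc]]
      by (simp add: p mult_smult_assoc_mat[of _ n n _ n])
    also have "mtrace \<dots> = complex_of_real (1 / b') * mtrace (B * (M * ?T) ^\<^sub>m m)"
      using Bc Tc by (intro mtrace_smult[of _ n]) simp
    finally have "1 / b' * cmod (mtrace (B * (M * ?T) ^\<^sub>m m)) \<le> (\<Sum>i<n. a ^ m * t i ^ m)"
      using \<open>b' > 0\<close> by (simp add: norm_mult norm_divide)
    then show ?thesis using \<open>b' > 0\<close> by (simp add: field_simps sum_distrib_left)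
  qed
  show ?thesis
  proof (rule field_le_epsilon)
    fix e :: real assume e: "0 < e"
    define q where "q = a ^ m * (\<Sum>i<n. t i ^ m)"
    have q: "0 \<le> q" unfolding q_def using M t by (intro mult_nonneg_nonneg sum_nonneg) auto
    have "cmod (mtrace (B * (M * ?T) ^\<^sub>m m)) \<le> (b + e / (q + 1)) * q"
      using *[of "b + e / (q + 1)"] e q by (simp add: q_def)
    also have "\<dots> \<le> b * q + e"
      using e q by (simp add: field_simps)
    finally show "cmod (mtrace (B * (M * ?T) ^\<^sub>m m)) \<le> b * (a ^ m * (\<Sum>i<n. t i ^ m)) + e"
      by (simp add: q_def)
  qed
qed

section \<open>Perturbation of Gibbs traces by a similarity transformation\<close>

lemma vnorm_diff_smult_sq:
  assumes "w \<in> carrier_vec n" "u \<in> carrier_vec n"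
  shows "(vnorm (w - complex_of_real d \<cdot>\<^sub>v u))\<^sup>2
    = (vnorm w)\<^sup>2 - 2 * d * Re (cip n w u) + d\<^sup>2 * (vnorm u)\<^sup>2"
proof -
  have sq: "(vnorm v)\<^sup>2 = (\<Sum>i<n. (cmod (v $ i))\<^sup>2)" if "v \<in> carrier_vec n" for v
    using that by (simp add: vnorm_def sum_nonneg)
  have "(cmod (x - complex_of_real d * y))\<^sup>2
      = (cmod x)\<^sup>2 - 2 * d * Re (cnj x * y) + d\<^sup>2 * (cmod y)\<^sup>2" for x y
    unfolding cmod_power2 by (simp add: power2_eq_square algebra_simps)
  then have "(vnorm (w - complex_of_real d \<cdot>\<^sub>v u))\<^sup>2
      = (\<Sum>i<n. (cmod (w $ i))\<^sup>2 - 2 * d * Re (cnj (w $ i) * u $ i) + d\<^sup>2 * (cmod (u $ i))\<^sup>2)"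
    using assms by (subst sq) (auto intro!: sum.cong)
  also have "\<dots> = (vnorm w)\<^sup>2 - 2 * d * Re (cip n w u) + d\<^sup>2 * (vnorm u)\<^sup>2"
    unfolding sq[OF assms(1)] sq[OF assms(2)] cip_def
    by (simp add: sum.distrib sum_subtractf sum_distrib_left distrib_left)
  finally show ?thesis .
qed

lemma mat_diff_mult_vec:
  fixes A B :: "complex mat"
  assumes "A \<in> carrier_mat n n" "w \<in> carrier_vec n"
  shows "(1\<^sub>m n - c \<cdot>\<^sub>m A) *\<^sub>v w = w - c \<cdot>\<^sub>v (A *\<^sub>v w)"
  using assms by (simp add: minus_mult_distrib_mat_vec[of _ n n] mult_vec_smult_mat[of _ n n])

lemma mat_conj_pow:
  fixes R T Q :: "complex mat"
  assumes c: "R \<in> carrier_mat n n" "T \<in> carrier_mat n n" "Q \<in> carrier_mat n n"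
    and QR: "Q * R = 1\<^sub>m n" and RQ: "R * Q = 1\<^sub>m n"
  shows "(R * T * Q) ^\<^sub>m m = R * T ^\<^sub>m m * Q"
proof -
  have "similar_mat_wit (R * T * Q) T R Q"
    using c QR RQ by (intro similar_mat_witI[of _ _ n]) auto
  then show ?thesis by (rule similar_mat_wit_pow_id)
qed

text \<open>Put \<open>w = T^-1 v\<close>. Then \<open>v = w - \<delta> D w\<close>, while the
  matrix in question sends \<open>v\<close> to \<open>w - \<delta> R D Q w\<close>. In the squared
  norms the first order terms differ by at most \<open>2 \<delta> \<epsilon> |w|^2\<close>, and
  everything else is of order \<open>\<delta>^2\<close>. Only the real part of the quadratic form
  enters, that is, the Hermitian part of the rotated matrix.\<close>

lemma rotated_diag_bound:
  fixes h :: "nat \<Rightarrow> real"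
  assumes D_def: "D = mat_diag n (\<lambda>i. complex_of_real (h i))"
    and c: "R \<in> carrier_mat n n" "Q \<in> carrier_mat n n" and RQ: "R * Q = 1\<^sub>m n"
    and form: "\<And>w. w \<in> carrier_vec n \<Longrightarrow>
      Re (cip n w (D *\<^sub>v w)) - \<epsilon> * (vnorm w)\<^sup>2 \<le> Re (cip n w (R * D * Q *\<^sub>v w))"
    and a: "mat_bound n (R * D * Q) a" and \<epsilon>: "0 \<le> \<epsilon>" and \<delta>: "0 < \<delta>"
    and \<tau>: "0 < \<tau>" "\<And>i. i < n \<Longrightarrow> \<tau> \<le> 1 - \<delta> * h i"
  shows "mat_bound n (R * mat_diag n (\<lambda>i. complex_of_real (1 - \<delta> * h i)) * Q
      * mat_diag n (\<lambda>i. complex_of_real (1 / (1 - \<delta> * h i))))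
    (exp ((2 * \<delta> * \<epsilon> + \<delta>\<^sup>2 * a\<^sup>2) / \<tau>\<^sup>2 / 2))"
    (is "mat_bound n (R * ?T * Q * ?I) (exp (?x / 2))")
  unfolding mat_bound_def
proof (intro conjI ballI)
  have Dc: "D \<in> carrier_mat n n" by (simp add: D_def)
  show "R * ?T * Q * ?I \<in> carrier_mat n n" using c by simp
  fix v :: "complex vec" assume v: "v \<in> carrier_vec n"
  define w where "w = ?I *\<^sub>v v"
  have w: "w \<in> carrier_vec n" unfolding w_def using mat_diag_dim v by (rule mult_mat_vec_carrier)
  have T: "?T = 1\<^sub>m n - complex_of_real \<delta> \<cdot>\<^sub>m D"
    by (intro eq_matI) (auto simp: D_def mat_diag_def)
  have RTQ: "R * ?T * Q = 1\<^sub>m n - complex_of_real \<delta> \<cdot>\<^sub>m (R * D * Q)"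
    unfolding T using c Dc
    by (simp add: mult_minus_distrib_mat[of _ n n _ n] minus_mult_distrib_mat[of _ n n _ _ n]
        mult_smult_distrib[of _ n n _ n] mult_smult_assoc_mat[of _ n n _ n] RQ)
  have "?T * ?I = 1\<^sub>m n"
  proof -
    have "?T * ?I = mat_diag n (\<lambda>i. complex_of_real (1 - \<delta> * h i) * complex_of_real (1 / (1 - \<delta> * h i)))"
      by (rule mat_diag_diag)
    also have "\<dots> = 1\<^sub>m n"
    proof (rule eq_matI)
      fix i j assume "i < dim_row (1\<^sub>m n :: complex mat)" "j < dim_col (1\<^sub>m n :: complex mat)"
      then have "i < n" "j < n" by auto
      moreover from this have "1 - \<delta> * h j \<noteq> 0" using \<tau>(1) \<tau>(2)[of j] by auto
      then have "complex_of_real (1 - \<delta> * h j) * complex_of_real (1 / (1 - \<delta> * h j)) = 1"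
        by (metis nonzero_mult_div_cancel_left of_real_1 of_real_mult times_divide_eq_right mult.right_neutral)
      ultimately show "mat_diag n (\<lambda>i. complex_of_real (1 - \<delta> * h i) * complex_of_real (1 / (1 - \<delta> * h i))) $$ (i, j) = 1\<^sub>m n $$ (i, j)"
        by (simp add: mat_diag_def del: of_real_diff of_real_divide)
    qed (auto simp: mat_diag_def)
    finally show ?thesis .
  qed
  moreover have "?T *\<^sub>v w = (?T * ?I) *\<^sub>v v"
    unfolding w_def by (rule assoc_mult_mat_vec[OF mat_diag_dim mat_diag_dim v, symmetric])
  ultimately have "?T *\<^sub>v w = v" using v by simp
  then have vw: "v = w - complex_of_real \<delta> \<cdot>\<^sub>v (D *\<^sub>v w)"
    unfolding T mat_diff_mult_vec[OF Dc w] by simp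
  have "(R * ?T * Q * ?I) *\<^sub>v v = (R * ?T * Q) *\<^sub>v w"
    unfolding w_def using c v by (intro assoc_mult_mat_vec[of _ n n _ n]) auto
  then have Mv: "(R * ?T * Q * ?I) *\<^sub>v v = w - complex_of_real \<delta> \<cdot>\<^sub>v (R * D * Q *\<^sub>v w)"
    unfolding RTQ using c Dc w by (subst (asm) mat_diff_mult_vec) auto
  let ?N = "vnorm w"
  have Dw: "D *\<^sub>v w \<in> carrier_vec n" "R * D * Q *\<^sub>v w \<in> carrier_vec n"
    using c Dc w by (auto intro!: mult_mat_vec_carrier[of _ n n])
  have "mat_bound n ?I (1 / \<tau>)"
  proof (rule mat_bound_diag)
    fix i assume "i < n"
    then have "\<tau> \<le> 1 - \<delta> * h i" by (rule \<tau>)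
    then show "cmod (complex_of_real (1 / (1 - \<delta> * h i))) \<le> 1 / \<tau>"
      unfolding norm_of_real using \<tau>(1) by (simp add: frac_le)
  qed
  from mat_boundD[OF this v] have "?N \<le> vnorm v / \<tau>" by (simp add: w_def)
  then have "?N\<^sup>2 \<le> (vnorm v / \<tau>)\<^sup>2" by (rule power_mono) simp
  then have N: "?N\<^sup>2 \<le> (vnorm v)\<^sup>2 / \<tau>\<^sup>2" by (simp add: power_divide)
  have "vnorm (R * D * Q *\<^sub>v w) \<le> a * ?N" using mat_boundD[OF a w] .
  then have "(vnorm (R * D * Q *\<^sub>v w))\<^sup>2 \<le> (a * ?N)\<^sup>2" by (rule power_mono) simp
  then have A: "\<delta>\<^sup>2 * (vnorm (R * D * Q *\<^sub>v w))\<^sup>2 \<le> \<delta>\<^sup>2 * (a\<^sup>2 * ?N\<^sup>2)"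
    by (intro mult_left_mono) (simp_all add: power_mult_distrib)
  have B: "2 * \<delta> * (Re (cip n w (D *\<^sub>v w)) - \<epsilon> * ?N\<^sup>2) \<le> 2 * \<delta> * Re (cip n w (R * D * Q *\<^sub>v w))"
    using form[OF w] \<delta> by (intro mult_left_mono) auto
  have "(vnorm v)\<^sup>2 = ?N\<^sup>2 - 2 * \<delta> * Re (cip n w (D *\<^sub>v w)) + \<delta>\<^sup>2 * (vnorm (D *\<^sub>v w))\<^sup>2"
    unfolding vw by (rule vnorm_diff_smult_sq[OF w Dw(1)])
  then have V: "?N\<^sup>2 - 2 * \<delta> * Re (cip n w (D *\<^sub>v w)) \<le> (vnorm v)\<^sup>2" by simp
  have "(vnorm ((R * ?T * Q * ?I) *\<^sub>v v))\<^sup>2 = ?N\<^sup>2 - 2 * \<delta> * Re (cip n w (R * D * Q *\<^sub>v w))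
      + \<delta>\<^sup>2 * (vnorm (R * D * Q *\<^sub>v w))\<^sup>2"
    unfolding Mv by (rule vnorm_diff_smult_sq[OF w Dw(2)])
  also have "\<dots> \<le> (vnorm v)\<^sup>2 + (2 * \<delta> * \<epsilon> + \<delta>\<^sup>2 * a\<^sup>2) * ?N\<^sup>2"
    using A B V by (simp add: algebra_simps)
  also have "\<dots> \<le> (vnorm v)\<^sup>2 + (2 * \<delta> * \<epsilon> + \<delta>\<^sup>2 * a\<^sup>2) * ((vnorm v)\<^sup>2 / \<tau>\<^sup>2)"
    using N \<epsilon> \<delta> by (intro add_left_mono mult_left_mono) auto
  also have "\<dots> = (1 + ?x) * (vnorm v)\<^sup>2"
    by (simp add: algebra_simps add_divide_distrib)
  \<comment> \<open>The exponential form makes the \<open>m\<close>-th power of the bound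
    explicit.\<close>
  also have "\<dots> \<le> exp ?x * (vnorm v)\<^sup>2" by (intro mult_right_mono exp_ge_add_one_self) simp
  also have "\<dots> = (exp (?x / 2) * vnorm v)\<^sup>2"
  proof -
    have "exp z * y\<^sup>2 = (exp (z / 2) * y)\<^sup>2" for y z :: real
      by (simp add: power_mult_distrib flip: exp_double)
    then show ?thesis .
  qed
  finally show "vnorm ((R * ?T * Q * ?I) *\<^sub>v v) \<le> exp (?x / 2) * vnorm v"
    by (rule power2_le_imp_le) simp
qed

text \<open>In an eigenbasis of the Hamiltonian the approximations
  \<open>(1 - \<beta> D / m)^m\<close> are diagonal, so the limit of large \<open>m\<close> is the
  scalar limit of the exponential in each eigenvalue. The second order error per step is of order
  \<open>1 / m^2\<close> and disappears over \<open>m\<close> steps.\<close>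

lemma rotated_trace_bound_diag:
  fixes h :: "nat \<Rightarrow> real"
  assumes D_def: "D = mat_diag n (\<lambda>i. complex_of_real (h i))"
    and h: "\<And>i j. i \<le> j \<Longrightarrow> j < n \<Longrightarrow> h i \<le> h j"
    and c: "R \<in> carrier_mat n n" "Q \<in> carrier_mat n n"
    and QR: "Q * R = 1\<^sub>m n" and RQ: "R * Q = 1\<^sub>m n"
    and B: "mat_bound n B b" and RB: "R * B * Q = e \<cdot>\<^sub>m B"
    and form: "\<And>w. w \<in> carrier_vec n \<Longrightarrow>
      Re (cip n w (D *\<^sub>v w)) - \<epsilon> * (vnorm w)\<^sup>2 \<le> Re (cip n w (R * D * Q *\<^sub>v w))"
    and \<epsilon>: "0 \<le> \<epsilon>" and \<beta>: "0 < \<beta>"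
  shows "cmod (\<Sum>i<n. B $$ (i, i) * complex_of_real (exp (- \<beta> * h i)))
    \<le> cmod e * (b * (exp (\<beta> * \<epsilon>) * (\<Sum>i<n. exp (- \<beta> * h i))))"
proof -
  have Dc: "D \<in> carrier_mat n n" by (simp add: D_def)
  note Bc = mat_bound_carrier[OF B]
  obtain a where a: "0 \<le> a" "mat_bound n (R * D * Q) a"
    using mat_bound_ex[of "R * D * Q" n] c Dc by auto
  \<comment> \<open>\<open>g\<close> dominates every eigenvalue in modulus, so that for
    \<open>m > \<beta> g\<close> the matrix \<open>1 - \<beta> D / m\<close> is positive with lower
    bound \<open>\<tau> m\<close>.\<close>
  define g where "g = (\<Sum>i<n. \<bar>h i\<bar>)"
  have g: "\<bar>h i\<bar> \<le> g" if "i < n" for i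
    unfolding g_def using that by (intro member_le_sum) auto
  have g0: "0 \<le> g" unfolding g_def by (intro sum_nonneg) auto
  define t where "t m i = 1 + (- \<beta> * h i) / real m" for m i
  define \<tau> where "\<tau> m = 1 - \<beta> * g / real m" for m
  \<comment> \<open>The accumulated exponent: the \<open>m\<close>-th power of the one-step bound is
    \<open>exp (y m)\<close>, and \<open>y m\<close> tends to
    \<open>\<beta> * \<epsilon>\<close>.\<close>
  define y where "y m = (\<beta> * \<epsilon> + \<beta>\<^sup>2 * a\<^sup>2 / 2 / real m) / (\<tau> m)\<^sup>2" for m
  have main: "cmod (\<Sum>i<n. B $$ (i, i) * complex_of_real (t m i ^ m))
      \<le> cmod e * (b * (exp (y m) * (\<Sum>i<n. t m i ^ m)))" if m: "\<beta> * g < real m" for m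
  proof -
    have m0: "0 < real m" using m g0 \<beta> by (meson mult_nonneg_nonneg le_less_trans less_imp_le)
    define \<delta> where "\<delta> = \<beta> / real m"
    have \<delta>: "0 < \<delta>" using m0 \<beta> by (simp add: \<delta>_def)
    have t\<delta>: "t m i = 1 - \<delta> * h i" for i by (simp add: t_def \<delta>_def)
    have \<tau>0: "0 < \<tau> m" using m m0 by (simp add: \<tau>_def)
    have \<tau>t: "\<tau> m \<le> 1 - \<delta> * h i" if "i < n" for i
    proof -
      have "\<delta> * h i \<le> \<delta> * g" using g[OF that] \<delta> by (intro mult_left_mono) auto
      then show ?thesis by (simp add: \<tau>_def \<delta>_def)
    qed
    let ?T = "mat_diag n (\<lambda>i. complex_of_real (t m i))"
    let ?I = "mat_diag n (\<lambda>i. complex_of_real (1 / t m i))"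
    let ?M = "R * ?T * Q * ?I"
    define \<alpha> where "\<alpha> = exp ((2 * \<delta> * \<epsilon> + \<delta>\<^sup>2 * a\<^sup>2) / (\<tau> m)\<^sup>2 / 2)"
    have M: "mat_bound n ?M \<alpha>"
      unfolding t\<delta> \<alpha>_def
      by (rule rotated_diag_bound[OF D_def c RQ form a(2) \<epsilon> \<delta> \<tau>0 \<tau>t])
    have \<alpha>: "\<alpha> ^ m = exp (y m)"
    proof -
      have "real m * ((2 * \<delta> * \<epsilon> + \<delta>\<^sup>2 * a\<^sup>2) / (\<tau> m)\<^sup>2 / 2)
          = (real m * (2 * \<delta> * \<epsilon> + \<delta>\<^sup>2 * a\<^sup>2) / 2) / (\<tau> m)\<^sup>2" by simp
      also have "real m * (2 * \<delta> * \<epsilon> + \<delta>\<^sup>2 * a\<^sup>2) / 2 = \<beta> * \<epsilon> + \<beta>\<^sup>2 * a\<^sup>2 / 2 / real m"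
        using m0 by (simp add: \<delta>_def power2_eq_square field_simps)
      finally show ?thesis by (simp add: \<alpha>_def y_def flip: exp_of_nat_mult)
    qed
    have "?I * ?T = 1\<^sub>m n"
    proof (rule eq_matI)
      fix i j assume "i < dim_row (1\<^sub>m n :: complex mat)" "j < dim_col (1\<^sub>m n :: complex mat)"
      moreover from this have "t m j \<noteq> 0" using \<tau>0 \<tau>t[of j] t\<delta>[of j] by auto
      ultimately show "(?I * ?T) $$ (i, j) = 1\<^sub>m n $$ (i, j)"
        unfolding mat_diag_diag by (simp add: mat_diag_def)
    qed (auto simp: mat_diag_def)
    then have MT: "?M * ?T = R * ?T * Q"
      using c right_mult_one_mat[of "R * ?T * Q" n n] by (simp add: assoc_mult_mat[of _ n n _ n _ n])
    have "(?M * ?T) ^\<^sub>m m = R * ?T ^\<^sub>m m * Q"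
      unfolding MT by (rule mat_conj_pow[OF c(1) mat_diag_dim c(2) QR RQ])
    then have pow: "(?M * ?T) ^\<^sub>m m = R * mat_diag n (\<lambda>i. complex_of_real (t m i ^ m)) * Q"
      unfolding mat_diag_pow by simp
    let ?P = "mat_diag n (\<lambda>i. complex_of_real (t m i ^ m))"
    have Pc: "?P \<in> carrier_mat n n" by simp
    \<comment> \<open>Conjugating by \<open>R\<close> leaves the trace unchanged, multiplies
      \<open>B\<close> by \<open>e\<close>, and turns the power of \<open>T\<close> into the power
      of \<open>M T\<close>; this is where the decay factor enters.\<close>
    have "mtrace (B * ?P) = mtrace (R * (B * ?P) * Q)"
    proof -
      have "mtrace (R * (B * ?P) * Q) = mtrace (Q * (R * (B * ?P)))"
        using c Bc by (intro mtrace_mult_commute[of _ n]) auto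
      also have "Q * (R * (B * ?P)) = (Q * R) * (B * ?P)"
        using c Bc by (intro assoc_mult_mat[symmetric, of _ n n _ n _ n]) auto
      also have "\<dots> = B * ?P" using Bc by (simp add: QR left_mult_one_mat[of _ n n])
      finally show ?thesis by simp
    qed
    also have "R * (B * ?P) * Q = R * B * (Q * R) * ?P * Q"
      using c Bc right_mult_one_mat[of "R * B" n n] by (simp add: QR assoc_mult_mat[of _ n n _ n _ n])
    also have "\<dots> = (R * B * Q) * (R * ?P * Q)"
      using c Bc by (simp add: assoc_mult_mat[of _ n n _ n _ n])
    also have "\<dots> = e \<cdot>\<^sub>m (B * (?M * ?T) ^\<^sub>m m)"
      unfolding pow RB using c Bc by (simp add: mult_smult_assoc_mat[of _ n n _ n])
    also have "mtrace \<dots> = e * mtrace (B * (?M * ?T) ^\<^sub>m m)"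
      using c Bc by (intro mtrace_smult[of _ n]) auto
    finally have "cmod (mtrace (B * ?P)) = cmod e * cmod (mtrace (B * (?M * ?T) ^\<^sub>m m))"
      by (simp add: norm_mult)
    also have "\<dots> \<le> cmod e * (b * (\<alpha> ^ m * (\<Sum>i<n. t m i ^ m)))"
    proof (intro mult_left_mono trace_pow_bound[OF M _ B])
      show "0 < \<alpha>" by (simp add: \<alpha>_def)
      fix i j assume "i \<le> j" "j < n"
      then show "t m j \<le> t m i" using h[of i j] \<delta> by (simp add: t\<delta>)
    next
      fix i assume "i < n" then show "0 \<le> t m i" using \<tau>t[of i] \<tau>0 by (simp add: t\<delta>)
    qed simp
    also have "mtrace (B * ?P) = (\<Sum>i<n. B $$ (i, i) * complex_of_real (t m i ^ m))"
      by (rule mtrace_mult_diag[OF Bc])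
    finally show ?thesis by (simp add: \<alpha>)
  qed
  have tl: "(\<lambda>m. t m i ^ m) \<longlonglongrightarrow> exp (- \<beta> * h i)" for i
    unfolding t_def by (rule tendsto_exp_limit_sequentially)
  have "(\<lambda>m. 1 - \<beta> * g / real m) \<longlonglongrightarrow> 1 - 0"
    by (intro tendsto_diff tendsto_const lim_const_over_n)
  then have \<tau>l: "\<tau> \<longlonglongrightarrow> 1" by (simp add: \<tau>_def[abs_def])
  have "y \<longlonglongrightarrow> (\<beta> * \<epsilon> + 0) / 1\<^sup>2"
    unfolding y_def[abs_def]
    by (intro tendsto_divide tendsto_add tendsto_const tendsto_power \<tau>l lim_const_over_n) simp
  then have yl: "y \<longlonglongrightarrow> \<beta> * \<epsilon>" by simp
  show ?thesis
  proof (rule tendsto_le[OF sequentially_bot])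
    show "(\<lambda>m. cmod e * (b * (exp (y m) * (\<Sum>i<n. t m i ^ m))))
        \<longlonglongrightarrow> cmod e * (b * (exp (\<beta> * \<epsilon>) * (\<Sum>i<n. exp (- \<beta> * h i))))"
      by (intro tendsto_mult tendsto_const tendsto_exp yl tendsto_sum tl)
    show "(\<lambda>m. cmod (\<Sum>i<n. B $$ (i, i) * complex_of_real (t m i ^ m)))
        \<longlonglongrightarrow> cmod (\<Sum>i<n. B $$ (i, i) * complex_of_real (exp (- \<beta> * h i)))"
      by (intro tendsto_norm tendsto_sum tendsto_mult tendsto_const tendsto_of_real tl)
    obtain m0 :: nat where "\<beta> * g < real m0" using reals_Archimedean2 by blast
    then show "\<forall>\<^sub>F m in sequentially. cmod (\<Sum>i<n. B $$ (i, i) * complex_of_real (t m i ^ m))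
        \<le> cmod e * (b * (exp (y m) * (\<Sum>i<n. t m i ^ m)))"
      by (intro eventually_sequentiallyI[of m0] main) (metis le_less_trans less_le_trans of_nat_le_iff)
  qed
qed

lemma cip_unitary:
  assumes U: "U \<in> carrier_mat n n" and UU: "U * mat_adjoint U = 1\<^sub>m n"
    and A: "A \<in> carrier_mat n n" and w: "w \<in> carrier_vec n"
  shows "cip n w (mat_adjoint U * A * U *\<^sub>v w) = cip n (U *\<^sub>v w) (A *\<^sub>v (U *\<^sub>v w))"
proof -
  note Uc = mat_adjoint_carrier[OF U]
  have Uw: "U *\<^sub>v w \<in> carrier_vec n" using U w by (rule mult_mat_vec_carrier)
  have "mat_adjoint U * A * U *\<^sub>v w = mat_adjoint U * A *\<^sub>v (U *\<^sub>v w)"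
    using U Uc A w by (intro assoc_mult_mat_vec[of _ n n _ n]) auto
  also have "\<dots> = mat_adjoint U *\<^sub>v (A *\<^sub>v (U *\<^sub>v w))"
    using U Uc A Uw by (intro assoc_mult_mat_vec[of _ n n _ n]) auto
  also have "cip n w \<dots> = cip n (mat_adjoint (mat_adjoint U) *\<^sub>v w) (A *\<^sub>v (U *\<^sub>v w))"
    using Uc A Uw w by (intro cip_adjoint) auto
  finally show ?thesis by (simp add: mat_adjoint_adjoint[OF U])
qed

text \<open>A unitary change to the eigenbasis of \<open>H\<close> preserves every hypothesis: norm
  bounds, the charge relation, and the comparison of forms. The numerator bound contains the full
  partition function, which cancels on division; it is positive because
  \<open>n > 0\<close>.\<close>

theorem rotated_trace_bound:
  assumes H: "H \<in> carrier_mat n n" "hermitian_mat H" and n: "0 < n"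
    and c: "R \<in> carrier_mat n n" "Q \<in> carrier_mat n n"
    and QR: "Q * R = 1\<^sub>m n" and RQ: "R * Q = 1\<^sub>m n"
    and B: "mat_bound n B b" and RB: "R * B * Q = e \<cdot>\<^sub>m B"
    and form: "\<And>w. w \<in> carrier_vec n \<Longrightarrow>
      Re (cip n w (H *\<^sub>v w)) - \<epsilon> * (vnorm w)\<^sup>2 \<le> Re (cip n w (R * H * Q *\<^sub>v w))"
    and \<epsilon>: "0 \<le> \<epsilon>" and \<beta>: "0 < \<beta>"
  defines "E \<equiv> mexp (complex_of_real (- \<beta>) \<cdot>\<^sub>m H)"
  shows "cmod (mtrace (B * E) / mtrace E) \<le> cmod e * (b * exp (\<beta> * \<epsilon>))"
proof -
  obtain U h where U: "U \<in> carrier_mat n n" and VU: "mat_adjoint U * U = 1\<^sub>m n"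
    and UV: "U * mat_adjoint U = 1\<^sub>m n"
    and HU: "H = U * mat_diag n (\<lambda>i. complex_of_real (h i)) * mat_adjoint U"
    and h: "\<And>i j. i \<le> j \<Longrightarrow> j < n \<Longrightarrow> h i \<le> h j"
    using hermitian_spectral[OF H] by metis
  define V where "V = mat_adjoint U"
  note VU = VU[folded V_def] and UV = UV[folded V_def] and HU = HU[folded V_def]
  define D where "D = mat_diag n (\<lambda>i. complex_of_real (h i))"
  note HU = HU[folded D_def]
  have V: "V \<in> carrier_mat n n" unfolding V_def using U by simp
  have D: "D \<in> carrier_mat n n" by (simp add: D_def)
  note Bc = mat_bound_carrier[OF B]
  note as = assoc_mult_mat[of _ n n _ n _ n]
  have ins: "X * (U * (V * Y)) = X * Y" if "X \<in> carrier_mat n n" "Y \<in> carrier_mat n n" for X Y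
  proof -
    have "U * (V * Y) = (U * V) * Y" using U V that by (simp add: as)
    then show ?thesis using that by (simp add: UV)
  qed
  have conj: "(V * X * U) * (V * Y * U) = V * (X * Y) * U"
    if "X \<in> carrier_mat n n" "Y \<in> carrier_mat n n" for X Y
    using U V that by (simp add: as ins)
  have DH: "D = V * H * U"
  proof -
    have "V * H * U = (V * U) * D * (V * U)" unfolding HU using U V D by (simp add: as)
    then show ?thesis using D by (simp add: VU left_mult_one_mat[OF D] right_mult_one_mat[OF D])
  qed
  have one: "V * 1\<^sub>m n * U = 1\<^sub>m n" using V VU by (simp add: right_mult_one_mat[OF V])
  have Rc: "V * R * U \<in> carrier_mat n n" "V * Q * U \<in> carrier_mat n n"
    using U V c by simp_all
  have "mat_bound n V 1" unfolding V_def
    using U UV V by (intro mat_bound_isometry) (simp_all add: mat_adjoint_adjoint[OF U] V_def)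
  then have VB: "mat_bound n (V * B) (1 * b)" using B by (rule mat_bound_mult) simp
  have Ub: "mat_bound n U 1" using VU U by (intro mat_bound_isometry) (simp_all add: V_def)
  have "0 \<le> b" using mat_bound_index[OF B n n] norm_ge_zero order_trans by blast
  then have "mat_bound n (V * B * U) (1 * b * 1)" by (intro mat_bound_mult[OF VB Ub]) simp
  then have B': "mat_bound n (V * B * U) b" by simp
  let ?Z = "\<Sum>i<n. exp (- \<beta> * h i)"
  have bound: "cmod (\<Sum>i<n. (V * B * U) $$ (i, i) * complex_of_real (exp (- \<beta> * h i)))
    \<le> cmod e * (b * (exp (\<beta> * \<epsilon>) * ?Z))"
  proof (rule rotated_trace_bound_diag[OF D_def h Rc _ _ B' _ _ \<epsilon> \<beta>])
    show "(V * Q * U) * (V * R * U) = 1\<^sub>m n" "(V * R * U) * (V * Q * U) = 1\<^sub>m n"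
      unfolding conj[OF c] conj[OF c(2,1)] QR RQ one by simp_all
    have "(V * R * U) * (V * B * U) * (V * Q * U) = V * (R * B * Q) * U"
      using c Bc by (simp add: conj)
    also have "\<dots> = e \<cdot>\<^sub>m (V * B * U)"
      unfolding RB using U V Bc
      by (simp add: mult_smult_distrib[of _ n n _ n] mult_smult_assoc_mat[of _ n n _ n])
    finally show "(V * R * U) * (V * B * U) * (V * Q * U) = e \<cdot>\<^sub>m (V * B * U)" .
    fix w :: "complex vec" assume w: "w \<in> carrier_vec n"
    have RDQ: "(V * R * U) * D * (V * Q * U) = V * (R * H * Q) * U"
      unfolding DH using c H by (simp add: conj)
    have nU: "vnorm (U *\<^sub>v w) \<le> vnorm w"
      using mat_boundD[OF mat_bound_isometry[OF U] w] VU by (simp add: V_def)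
    have Uw: "U *\<^sub>v w \<in> carrier_vec n" using U w by (rule mult_mat_vec_carrier)
    have cu: "cip n w (V * A * U *\<^sub>v w) = cip n (U *\<^sub>v w) (A *\<^sub>v (U *\<^sub>v w))"
      if "A \<in> carrier_mat n n" for A
      unfolding V_def using UV that by (intro cip_unitary[OF U _ _ w]) (simp_all add: V_def)
    have "Re (cip n w (D *\<^sub>v w)) = Re (cip n (U *\<^sub>v w) (H *\<^sub>v (U *\<^sub>v w)))"
      unfolding DH cu[OF H(1)] by simp
    moreover have "\<epsilon> * (vnorm (U *\<^sub>v w))\<^sup>2 \<le> \<epsilon> * (vnorm w)\<^sup>2"
      using nU \<epsilon> by (intro mult_left_mono power_mono) auto
    moreover have "Re (cip n w ((V * R * U) * D * (V * Q * U) *\<^sub>v w))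
        = Re (cip n (U *\<^sub>v w) (R * H * Q *\<^sub>v (U *\<^sub>v w)))"
      unfolding RDQ using c H by (subst cu) simp_all
    ultimately show "Re (cip n w (D *\<^sub>v w)) - \<epsilon> * (vnorm w)\<^sup>2
        \<le> Re (cip n w ((V * R * U) * D * (V * Q * U) *\<^sub>v w))"
      using form[OF Uw] by simp
  qed
  let ?X = "mat_diag n (\<lambda>i. complex_of_real (exp (- \<beta> * h i)))"
  have "complex_of_real (- \<beta>) \<cdot>\<^sub>m D = mat_diag n (\<lambda>i. complex_of_real (- \<beta> * h i))"
    by (intro eq_matI) (auto simp: D_def mat_diag_def)
  then have eD: "mexp (complex_of_real (- \<beta>) \<cdot>\<^sub>m D) = ?X"
    by (simp add: mexp_diag flip: exp_of_real)
  have "complex_of_real (- \<beta>) \<cdot>\<^sub>m H = U * (complex_of_real (- \<beta>) \<cdot>\<^sub>m D) * V"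
    unfolding HU using U V D
    by (simp add: mult_smult_distrib[of _ n n _ n] mult_smult_assoc_mat[of _ n n _ n])
  then have E: "E = U * ?X * V"
    unfolding E_def eD[symmetric] using U V D VU UV by (simp add: mexp_unitary_conj[of _ n])
  have tr: "mtrace (Y * E) = mtrace (V * Y * U * ?X)" if Y: "Y \<in> carrier_mat n n" for Y
  proof -
    have "mtrace (Y * E) = mtrace (Y * U * ?X * V)" unfolding E using U V Y by (simp add: as)
    also have "\<dots> = mtrace (V * (Y * U * ?X))" using U V Y by (intro mtrace_mult_commute[of _ n]) auto
    also have "V * (Y * U * ?X) = V * Y * U * ?X" using U V Y by (simp add: as)
    finally show ?thesis .
  qed
  have "mtrace (B * E) = (\<Sum>i<n. (V * B * U) $$ (i, i) * complex_of_real (exp (- \<beta> * h i)))"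
    unfolding tr[OF Bc] using U V Bc by (intro mtrace_mult_diag) auto
  with bound have num: "cmod (mtrace (B * E)) \<le> cmod e * (b * (exp (\<beta> * \<epsilon>) * ?Z))" by simp
  have Ec: "E \<in> carrier_mat n n" unfolding E using U V by simp
  have "mtrace E = mtrace (1\<^sub>m n * E)" using Ec by simp
  also have "\<dots> = mtrace (V * 1\<^sub>m n * U * ?X)" by (rule tr) simp
  also have "\<dots> = (\<Sum>i<n. 1\<^sub>m n $$ (i, i) * complex_of_real (exp (- \<beta> * h i)))"
    unfolding one by (rule mtrace_mult_diag) simp
  also have "\<dots> = complex_of_real ?Z" by simp
  finally have den: "mtrace E = complex_of_real ?Z" .
  have Z: "0 < ?Z" using n by (intro sum_pos) auto
  have "cmod (mtrace (B * E) / mtrace E) = cmod (mtrace (B * E)) / ?Z"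
    unfolding den norm_divide norm_of_real using Z by simp
  also have "\<dots> \<le> cmod e * (b * exp (\<beta> * \<epsilon>))"
    using num Z by (simp add: pos_divide_le_eq mult.assoc)
  finally show ?thesis .
qed

section \<open>The quadratic form of a rotated interaction term\<close>

lemma mat_bound_form:
  assumes A: "mat_bound n A a" and "v \<in> carrier_vec n" "w \<in> carrier_vec n" "0 \<le> a"
  shows "\<bar>Re (cip n v (A *\<^sub>v w))\<bar> \<le> a * (vnorm v * vnorm w)"
proof -
  have Aw: "A *\<^sub>v w \<in> carrier_vec n" using mat_bound_carrier[OF A] assms by auto
  have "\<bar>Re (cip n v (A *\<^sub>v w))\<bar> \<le> cmod (cip n v (A *\<^sub>v w))" by (rule abs_Re_le_cmod)
  also have "\<dots> \<le> vnorm v * vnorm (A *\<^sub>v w)" using assms Aw by (intro cip_Cauchy_Schwarz)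
  also have "\<dots> \<le> vnorm v * (a * vnorm w)" using assms by (intro mult_left_mono mat_boundD) auto
  finally show ?thesis by (simp add: ac_simps)
qed

text \<open>Writing \<open>exp (\<plusminus>Q) w = p \<plusminus> s\<close>, the cross terms of the form are imaginary, so that only
  \<open>p = cosh Q w\<close> and \<open>s = sinh Q w\<close> separately enter, both at second order in \<open>Q\<close>.\<close>

lemma rotated_form_bound:
  assumes Q: "Q \<in> carrier_mat n n" "hermitian_mat Q" and u: "mat_bound n Q u" "0 \<le> u"
    and \<Phi>: "mat_bound n \<Phi> f" "hermitian_mat \<Phi>" "0 \<le> f" and w: "w \<in> carrier_vec n"
  shows "Re (cip n w (\<Phi> *\<^sub>v w)) - 2 * f * (sinh u)\<^sup>2 * (vnorm w)\<^sup>2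
    \<le> Re (cip n w (mexp Q * \<Phi> * mexp (- Q) *\<^sub>v w))"
proof -
  obtain U q where U: "U \<in> carrier_mat n n" and VU: "mat_adjoint U * U = 1\<^sub>m n"
    and UV: "U * mat_adjoint U = 1\<^sub>m n"
    and QU: "Q = U * mat_diag n (\<lambda>i. complex_of_real (q i)) * mat_adjoint U"
    using hermitian_spectral[OF Q] by metis
  define V where "V = mat_adjoint U"
  note VU = VU[folded V_def] and UV = UV[folded V_def] and QU = QU[folded V_def]
  have V: "V \<in> carrier_mat n n" unfolding V_def using U by simp
  have VA: "mat_adjoint V = U" unfolding V_def by (rule mat_adjoint_adjoint[OF U])
  have Ub: "mat_bound n U 1" and Vb: "mat_bound n V 1"
    using U V VU UV VA by (auto intro!: mat_bound_isometry simp: V_def)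
  note as = assoc_mult_mat[of _ n n _ n _ n]
  note \<Phi>c = mat_bound_carrier[OF \<Phi>(1)]
  \<comment> \<open>The functional calculus of \<open>Q\<close>: the value \<open>d i\<close> is
    placed on the \<open>i\<close>-th eigenvector, so that \<open>F q\<close> is \<open>Q\<close>
    itself and its exponential is obtained by exponentiating \<open>q\<close>.\<close>
  define F where "F d = U * mat_diag n (\<lambda>i. complex_of_real (d i)) * V" for d :: "nat \<Rightarrow> real"
  have Fc [simp]: "F d \<in> carrier_mat n n" for d unfolding F_def using U V by simp
  have Fadj: "mat_adjoint (F d) = F d" for d
  proof -
    have "mat_adjoint (mat_diag n (\<lambda>i. complex_of_real (d i))) = mat_diag n (\<lambda>i. complex_of_real (d i))"
      by (rule mat_adjoint_eqI[of _ n n]) (auto simp: mat_diag_def)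
    then show ?thesis unfolding F_def using U V VA
      by (simp add: mat_adjoint_mult[of _ n n _ n] as V_def)
  qed
  have Fb: "mat_bound n (F d) a" if "\<And>i. i < n \<Longrightarrow> \<bar>d i\<bar> \<le> a" "0 \<le> a" for d a
  proof -
    have "mat_bound n (mat_diag n (\<lambda>i. complex_of_real (d i))) a"
      using that by (intro mat_bound_diag) auto
    then have "mat_bound n (F d) (1 * a * 1)" unfolding F_def
      using Ub Vb that by (intro mat_bound_mult) auto
    then show ?thesis by simp
  qed
  have Fadd: "F (\<lambda>i. a i + b i) = F a + F b" for a b
  proof -
    have "mat_diag n (\<lambda>i. complex_of_real (a i + b i))
        = mat_diag n (\<lambda>i. complex_of_real (a i)) + mat_diag n (\<lambda>i. complex_of_real (b i))"
      by (intro eq_matI) (auto simp: mat_diag_def)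
    then show ?thesis unfolding F_def using U V
      by (simp add: mult_add_distrib_mat[of _ n n _ n] add_mult_distrib_mat[of _ n n _ _ n])
  qed
  have Fminus: "F (\<lambda>i. - a i) = - F a" for a
  proof -
    have "mat_diag n (\<lambda>i. complex_of_real (- a i)) = - mat_diag n (\<lambda>i. complex_of_real (a i))"
      by (intro eq_matI) (auto simp: mat_diag_def)
    moreover have "U * - D * V = - (U * D * V)" if "D \<in> carrier_mat n n" for D
      using U V that by auto
    ultimately show ?thesis unfolding F_def by simp
  qed
  have F1: "F (\<lambda>_. 1) = 1\<^sub>m n" unfolding F_def using U UV by (simp add: right_mult_one_mat[OF U])
  have Fexp: "mexp (F d) = F (\<lambda>i. exp (d i))" for d
    unfolding F_def using U V VU UV
    by (simp add: mexp_unitary_conj[of _ n] mexp_diag flip: exp_of_real)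
  have QF: "Q = F q" unfolding F_def by (rule QU)
  have qu: "\<bar>q i\<bar> \<le> u" if i: "i < n" for i
  proof -
    have "mat_bound n (V * Q * U) (1 * u * 1)"
      using Ub Vb u by (intro mat_bound_mult) auto
    moreover have "V * Q * U = (V * U) * mat_diag n (\<lambda>i. complex_of_real (q i)) * (V * U)"
      unfolding QU using U V by (simp add: as)
    moreover have "1\<^sub>m n * D * 1\<^sub>m n = D" if "D \<in> carrier_mat n n" for D :: "complex mat"
      using that by (simp add: left_mult_one_mat[OF that] right_mult_one_mat[OF that])
    ultimately have "mat_bound n (mat_diag n (\<lambda>i. complex_of_real (q i))) u"
      by (simp add: VU)
    from mat_bound_index[OF this i i] show ?thesis using i by (simp add: mat_diag_def)
  qed
  define P where "P = F (\<lambda>i. cosh (q i) - 1)"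
  define S where "S = F (\<lambda>i. sinh (q i))"
  have Pc: "P \<in> carrier_mat n n" and Sc: "S \<in> carrier_mat n n" by (simp_all add: P_def S_def)
  have Pb: "mat_bound n P (cosh u - 1)"
    unfolding P_def
  proof (rule Fb)
    fix i assume "i < n"
    then have "cosh \<bar>q i\<bar> \<le> cosh u" using qu u by (subst cosh_real_nonneg_le_iff) auto
    then show "\<bar>cosh (q i) - 1\<bar> \<le> cosh u - 1" using cosh_real_ge_1[of "q i"] by simp
  qed (simp add: cosh_real_ge_1)
  have Sb: "mat_bound n S (sinh u)"
    unfolding S_def
  proof (rule Fb)
    fix i assume "i < n"
    then have "q i \<le> u" "- q i \<le> u" using qu[of i] by auto
    then have "sinh (q i) \<le> sinh u" "sinh (- q i) \<le> sinh u" by (simp_all only: sinh_real_le_iff)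
    then show "\<bar>sinh (q i)\<bar> \<le> sinh u" by (auto simp only: abs_le_iff sinh_minus)
  qed (use u in simp)
  have E: "mexp Q = 1\<^sub>m n + P + S"
  proof -
    have e: "(\<lambda>i. exp (q i)) = (\<lambda>i. (1 + (cosh (q i) - 1)) + sinh (q i))"
      by (simp add: cosh_plus_sinh)
    show ?thesis unfolding QF Fexp P_def S_def e Fadd F1 by (rule refl)
  qed
  have E': "mexp (- Q) = 1\<^sub>m n + P + - S"
  proof -
    have "exp (- q i) = (1 + (cosh (q i) - 1)) + - sinh (q i)" for i
      using cosh_plus_sinh[of "- q i"] by simp
    then have e: "(\<lambda>i. exp (- q i)) = (\<lambda>i. (1 + (cosh (q i) - 1)) + - sinh (q i))" by blast
    show ?thesis unfolding QF Fminus[symmetric] Fexp P_def S_def e Fadd F1 by (rule refl)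
  qed
  define r where "r = P *\<^sub>v w"
  define s where "s = S *\<^sub>v w"
  define p where "p = w + r"
  have rc: "r \<in> carrier_vec n" and sc: "s \<in> carrier_vec n" and pc: "p \<in> carrier_vec n"
    using Pc Sc w by (auto simp: r_def s_def p_def)
  have Ew: "mexp Q *\<^sub>v w = p + s"
    unfolding E p_def r_def s_def using Pc Sc w by (simp add: add_mult_distrib_mat_vec[of _ n n])
  have E'w: "mexp (- Q) *\<^sub>v w = p + - s"
    unfolding E' p_def r_def s_def using Pc Sc w by (simp add: add_mult_distrib_mat_vec[of _ n n])
  have Eadj: "mat_adjoint (mexp Q) = mexp Q" unfolding QF Fexp by (rule Fadj)
  have Ec: "mexp Q \<in> carrier_mat n n" "mexp (- Q) \<in> carrier_mat n n" using Q by auto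
  have \<Phi>v: "\<Phi> *\<^sub>v v \<in> carrier_vec n" if "v \<in> carrier_vec n" for v using \<Phi>c that by auto
  have "mexp Q * \<Phi> * mexp (- Q) *\<^sub>v w = mexp Q *\<^sub>v (\<Phi> *\<^sub>v (p + - s))"
    using Ec \<Phi>c w pc sc by (simp add: assoc_mult_mat_vec[of _ n n _ n] flip: E'w)
  also have "cip n w \<dots> = cip n (p + s) (\<Phi> *\<^sub>v (p + - s))"
    using Ec \<Phi>c w pc sc by (subst cip_adjoint) (auto simp: Eadj Ew)
  also have "\<Phi> *\<^sub>v (p + - s) = \<Phi> *\<^sub>v p - \<Phi> *\<^sub>v s"
    using \<Phi>c pc sc by (simp add: mult_add_distrib_mat_vec[of _ n n])
      (intro eq_vecI; simp)
  also have "cip n (p + s) (\<Phi> *\<^sub>v p - \<Phi> *\<^sub>v s)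
      = cip n p (\<Phi> *\<^sub>v p) - cip n p (\<Phi> *\<^sub>v s) + cip n s (\<Phi> *\<^sub>v p) - cip n s (\<Phi> *\<^sub>v s)"
    using pc sc \<Phi>v by (simp add: cip_add_left cip_diff_right)
  finally have 1: "cip n w (mexp Q * \<Phi> * mexp (- Q) *\<^sub>v w)
      = cip n p (\<Phi> *\<^sub>v p) - cip n p (\<Phi> *\<^sub>v s) + cip n s (\<Phi> *\<^sub>v p) - cip n s (\<Phi> *\<^sub>v s)" .
  have "cip n p (\<Phi> *\<^sub>v s) = cip n (\<Phi> *\<^sub>v p) s"
    using cip_adjoint[OF \<Phi>c pc sc] \<Phi>(2) by (simp add: hermitian_mat_def)
  also have "\<dots> = cnj (cip n s (\<Phi> *\<^sub>v p))" by (rule cip_commute)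
  finally have 2: "Re (cip n p (\<Phi> *\<^sub>v s)) = Re (cip n s (\<Phi> *\<^sub>v p))" by simp
  have 3: "cip n p (\<Phi> *\<^sub>v p) = cip n w (\<Phi> *\<^sub>v w) + cip n w (\<Phi> *\<^sub>v r) + cip n r (\<Phi> *\<^sub>v w) + cip n r (\<Phi> *\<^sub>v r)"
    unfolding p_def using \<Phi>c w rc \<Phi>v
    by (simp add: mult_add_distrib_mat_vec[of _ n n] cip_add_left cip_add_right)
  let ?N = "vnorm w"
  have c1: "0 \<le> cosh u - 1" by (simp add: cosh_real_ge_1)
  have r: "vnorm r \<le> (cosh u - 1) * ?N" unfolding r_def by (rule mat_boundD[OF Pb w])
  have s: "vnorm s \<le> sinh u * ?N" unfolding s_def by (rule mat_boundD[OF Sb w])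
  have "\<bar>Re (cip n w (\<Phi> *\<^sub>v r))\<bar> \<le> f * (?N * ((cosh u - 1) * ?N))"
    by (rule order_trans[OF mat_bound_form[OF \<Phi>(1) w rc \<Phi>(3)]])
      (intro mult_left_mono r \<Phi>(3) vnorm_nonneg)
  moreover have "\<bar>Re (cip n r (\<Phi> *\<^sub>v w))\<bar> \<le> f * (((cosh u - 1) * ?N) * ?N)"
    by (rule order_trans[OF mat_bound_form[OF \<Phi>(1) rc w \<Phi>(3)]])
      (intro mult_left_mono mult_right_mono r \<Phi>(3) vnorm_nonneg)
  moreover have "\<bar>Re (cip n r (\<Phi> *\<^sub>v r))\<bar> \<le> f * (((cosh u - 1) * ?N) * ((cosh u - 1) * ?N))"
    by (rule order_trans[OF mat_bound_form[OF \<Phi>(1) rc rc \<Phi>(3)]])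
      (intro mult_left_mono mult_mono r \<Phi>(3) vnorm_nonneg mult_nonneg_nonneg c1)
  moreover have "\<bar>Re (cip n s (\<Phi> *\<^sub>v s))\<bar> \<le> f * ((sinh u * ?N) * (sinh u * ?N))"
    by (rule order_trans[OF mat_bound_form[OF \<Phi>(1) sc sc \<Phi>(3)]])
      (intro mult_left_mono mult_mono s \<Phi>(3) vnorm_nonneg mult_nonneg_nonneg, use u in simp)
  ultimately have "Re (cip n w (mexp Q * \<Phi> * mexp (- Q) *\<^sub>v w)) \<ge> Re (cip n w (\<Phi> *\<^sub>v w))
      - f * (?N * ((cosh u - 1) * ?N)) - f * (((cosh u - 1) * ?N) * ?N)
      - f * (((cosh u - 1) * ?N) * ((cosh u - 1) * ?N)) - f * ((sinh u * ?N) * (sinh u * ?N))"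
    unfolding 1 minus_complex.sel plus_complex.sel 2 3 by linarith
  \<comment> \<open>The coefficient is \<open>2 (cosh u - 1) + (cosh u - 1)^2 + sinh^2 u = cosh^2 u
    - 1 + sinh^2 u\<close>, which equals \<open>2 sinh^2 u\<close>; this is the origin of the factor
    2 in the statement.\<close>
  moreover have "f * (?N * ((cosh u - 1) * ?N)) + f * (((cosh u - 1) * ?N) * ?N)
      + f * (((cosh u - 1) * ?N) * ((cosh u - 1) * ?N)) + f * ((sinh u * ?N) * (sinh u * ?N))
      = f * ((cosh u)\<^sup>2 - 1 + (sinh u)\<^sup>2) * ?N\<^sup>2"
    by (simp add: power2_eq_square algebra_simps)
  ultimately show ?thesis by (simp add: cosh_square_eq)
qed

section \<open>Weighted sums of matrices\<close>

text \<open>Defined entrywise, so that it lies in the carrier without side conditions on the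
  summands; \<open>msum_eq_wsum\<close> links it to the sums in the Hamiltonian and in the symmetry
  condition. Real weights keep it Hermitian.\<close>

definition wsum :: "nat \<Rightarrow> ('a \<Rightarrow> real) \<Rightarrow> ('a \<Rightarrow> complex mat) \<Rightarrow> 'a set \<Rightarrow> complex mat" where
  "wsum n \<theta> G X = mat n n (\<lambda>(i, j). \<Sum>x\<in>X. complex_of_real (\<theta> x) * G x $$ (i, j))"

lemma wsum_carrier [simp]: "wsum n \<theta> G X \<in> carrier_mat n n"
  by (simp add: wsum_def)

lemma wsum_dim [simp]: "dim_row (wsum n \<theta> G X) = n" "dim_col (wsum n \<theta> G X) = n"
  by (simp_all add: wsum_def)

lemma wsum_index:
  "\<lbrakk>i < n; j < n\<rbrakk> \<Longrightarrow> wsum n \<theta> G X $$ (i, j) = (\<Sum>x\<in>X. complex_of_real (\<theta> x) * G x $$ (i, j))"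
  by (simp add: wsum_def)

lemma wsum_eqI:
  assumes "A \<in> carrier_mat n n"
    and "\<And>i j. i < n \<Longrightarrow> j < n \<Longrightarrow> A $$ (i, j) = (\<Sum>x\<in>X. complex_of_real (\<theta> x) * G x $$ (i, j))"
  shows "A = wsum n \<theta> G X"
  using assms by (intro eq_matI) (auto simp: wsum_index wsum_def)

lemma wsum_empty: "wsum n \<theta> G {} = 0\<^sub>m n n"
  by (intro eq_matI) (auto simp: wsum_index)

lemma wsum_insert:
  assumes "finite X" "x \<notin> X" "G x \<in> carrier_mat n n"
  shows "wsum n \<theta> G (insert x X) = complex_of_real (\<theta> x) \<cdot>\<^sub>m G x + wsum n \<theta> G X"
  using assms by (intro wsum_eqI[symmetric]) (auto simp: wsum_index)

lemma wsum_add: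
  "wsum n \<theta> G X + wsum n \<eta> G X = wsum n (\<lambda>x. \<theta> x + \<eta> x) G X"
  by (intro wsum_eqI) (auto simp: wsum_index algebra_simps sum.distrib)

lemma msum_eq_wsum:
  assumes "finite X" "\<And>x. x \<in> X \<Longrightarrow> G x \<in> carrier_mat n n"
  shows "msum n G X = wsum n (\<lambda>_. 1) G X"
  using assms
proof (induction X)
  case empty
  interpret abelian_group "module_mat TYPE(complex) n n" by (rule abelian_group_mat)
  show ?case by (simp add: wsum_empty module_mat_simps)
next
  case (insert x X)
  interpret abelian_group "module_mat TYPE(complex) n n" by (rule abelian_group_mat)
  have "msum n G (insert x X) = G x + msum n G X"
    using insert by (subst finsum_insert) (auto simp: module_mat_simps)
  moreover have "complex_of_real 1 \<cdot>\<^sub>m G x = G x" by (intro eq_matI) auto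
  ultimately show ?case using insert by (subst wsum_insert) auto
qed

lemma wsum_mult_left:
  assumes "\<And>x. x \<in> X \<Longrightarrow> G x \<in> carrier_mat n n" and B: "B \<in> carrier_mat n n"
  shows "B * wsum n \<theta> G X = wsum n \<theta> (\<lambda>x. B * G x) X"
proof (rule wsum_eqI)
  fix i j assume ij: "i < n" "j < n"
  have "(B * wsum n \<theta> G X) $$ (i, j)
      = (\<Sum>l<n. \<Sum>x\<in>X. complex_of_real (\<theta> x) * (B $$ (i, l) * G x $$ (l, j)))"
    unfolding mult_mat_index[OF B wsum_carrier ij] using ij
    by (intro sum.cong) (auto simp: wsum_index sum_distrib_left sum_distrib_right ac_simps)
  also have "\<dots> = (\<Sum>x\<in>X. complex_of_real (\<theta> x) * (\<Sum>l<n. B $$ (i, l) * G x $$ (l, j)))"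
    by (subst sum.swap) (simp add: sum_distrib_left)
  also have "\<dots> = (\<Sum>x\<in>X. complex_of_real (\<theta> x) * (B * G x) $$ (i, j))"
    using assms ij by (intro sum.cong refl) (simp add: mult_mat_index[of B n n _ n] del: index_mult_mat(1))
  finally show "(B * wsum n \<theta> G X) $$ (i, j) = \<dots>" .
qed (use B in simp)

lemma wsum_mult_right:
  assumes "\<And>x. x \<in> X \<Longrightarrow> G x \<in> carrier_mat n n" and B: "B \<in> carrier_mat n n"
  shows "wsum n \<theta> G X * B = wsum n \<theta> (\<lambda>x. G x * B) X"
proof (rule wsum_eqI)
  fix i j assume ij: "i < n" "j < n"
  have "(wsum n \<theta> G X * B) $$ (i, j)
      = (\<Sum>l<n. \<Sum>x\<in>X. complex_of_real (\<theta> x) * (G x $$ (i, l) * B $$ (l, j)))"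
    unfolding mult_mat_index[OF wsum_carrier B ij] using ij
    by (intro sum.cong) (auto simp: wsum_index sum_distrib_left sum_distrib_right ac_simps)
  also have "\<dots> = (\<Sum>x\<in>X. complex_of_real (\<theta> x) * (\<Sum>l<n. G x $$ (i, l) * B $$ (l, j)))"
    by (subst sum.swap) (simp add: sum_distrib_left)
  also have "\<dots> = (\<Sum>x\<in>X. complex_of_real (\<theta> x) * (G x * B) $$ (i, j))"
    using assms ij by (intro sum.cong refl) (simp add: mult_mat_index[of _ n n B n] del: index_mult_mat(1))
  finally show "(wsum n \<theta> G X * B) $$ (i, j) = \<dots>" .
qed (use B in simp)

text \<open>The summands need to agree only where the weight is nonzero. This is how locality is
  used: the weights vanish on a support and the generators commute with the interaction term off
  it.\<close>

lemma wsum_cong: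
  assumes "\<And>x. x \<in> X \<Longrightarrow> \<theta> x = \<eta> x" "\<And>x. x \<in> X \<Longrightarrow> \<theta> x \<noteq> 0 \<Longrightarrow> F x = G x"
  shows "wsum n \<theta> F X = wsum n \<eta> G X"
proof -
  have "(\<Sum>x\<in>X. complex_of_real (\<theta> x) * F x $$ ij) = (\<Sum>x\<in>X. complex_of_real (\<eta> x) * G x $$ ij)" for ij
    using assms by (intro sum.cong refl) (metis mult_zero_left of_real_0)
  then show ?thesis by (simp add: wsum_def)
qed

lemma wsum_commute:
  assumes "\<And>x. x \<in> X \<Longrightarrow> G x \<in> carrier_mat n n" and B: "B \<in> carrier_mat n n"
    and "\<And>x. x \<in> X \<Longrightarrow> \<theta> x \<noteq> 0 \<Longrightarrow> B * G x = G x * B"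
  shows "B * wsum n \<theta> G X = wsum n \<theta> G X * B"
  using assms by (simp add: wsum_mult_left wsum_mult_right cong: wsum_cong)

lemma wsum_hermitian:
  assumes "\<And>x. x \<in> X \<Longrightarrow> G x \<in> carrier_mat n n" "\<And>x. x \<in> X \<Longrightarrow> hermitian_mat (G x)"
  shows "hermitian_mat (wsum n \<theta> G X)"
proof (rule hermitian_matI[OF wsum_carrier])
  fix i j assume ij: "i < n" "j < n"
  have "G x $$ (i, j) = cnj (G x $$ (j, i))" if "x \<in> X" for x
    using assms that ij by (intro hermitian_index[of _ n])
  then show "wsum n \<theta> G X $$ (i, j) = cnj (wsum n \<theta> G X $$ (j, i))"
    unfolding wsum_index[OF ij] wsum_index[OF ij(2,1)] cnj_sum complex_cnj_mult
      complex_cnj_complex_of_real by (intro sum.cong refl arg_cong2[where f = "(*)"])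
qed

lemma wsum_bound:
  assumes "finite X" "\<And>x. x \<in> X \<Longrightarrow> mat_bound n (G x) (g x)"
  shows "mat_bound n (wsum n \<theta> G X) (\<Sum>x\<in>X. \<bar>\<theta> x\<bar> * g x)"
  using assms
proof (induction X)
  case empty
  have "mat_bound n (mat_diag n (\<lambda>_. 0)) 0" by (rule mat_bound_diag) simp
  moreover have "mat_diag n (\<lambda>_. 0) = (0\<^sub>m n n :: complex mat)" by (auto simp: mat_diag_def)
  ultimately show ?case by (simp add: wsum_empty)
next
  case (insert x X)
  have "mat_bound n (complex_of_real (\<theta> x) \<cdot>\<^sub>m G x) (\<bar>\<theta> x\<bar> * g x)"
    using mat_bound_smult[of n "G x" "g x" "complex_of_real (\<theta> x)"] insert.prems by simp
  moreover have "G x \<in> carrier_mat n n" using insert.prems by (auto intro: mat_bound_carrier)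
  ultimately show ?case using insert by (auto simp: wsum_insert intro!: mat_bound_add)
qed

lemma cip_wsum:
  assumes "finite X" "\<And>x. x \<in> X \<Longrightarrow> G x \<in> carrier_mat n n" and w: "w \<in> carrier_vec n"
  shows "cip n v (wsum n \<theta> G X *\<^sub>v w) = (\<Sum>x\<in>X. complex_of_real (\<theta> x) * cip n v (G x *\<^sub>v w))"
  using assms(1,2)
proof (induction X)
  case empty
  have "0\<^sub>m n n *\<^sub>v w = 0\<^sub>v n" using w by auto
  then show ?case by (simp add: wsum_empty) (simp add: cip_def)
next
  case (insert x X)
  then have Gx: "G x \<in> carrier_mat n n" by simp
  have "wsum n \<theta> G (insert x X) *\<^sub>v w
      = complex_of_real (\<theta> x) \<cdot>\<^sub>v (G x *\<^sub>v w) + wsum n \<theta> G X *\<^sub>v w"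
    using insert.hyps Gx w
    by (simp add: wsum_insert add_mult_distrib_mat_vec[of _ n n] mult_vec_smult_mat[of _ n n])
  moreover have "cip n v (complex_of_real (\<theta> x) \<cdot>\<^sub>v (G x *\<^sub>v w)) = complex_of_real (\<theta> x) * cip n v (G x *\<^sub>v w)"
    using Gx w by (auto simp: cip_def sum_distrib_left ac_simps intro!: sum.cong)
  moreover have "wsum n \<theta> G X *\<^sub>v w \<in> carrier_vec n" "G x *\<^sub>v w \<in> carrier_vec n"
    using w Gx by (auto intro!: mult_mat_vec_carrier[of _ n n])
  ultimately show ?case using insert by (simp add: cip_add_right)
qed

section \<open>The complex rotation\<close>

lemma commutator_eq_0:
  assumes "A \<in> carrier_mat n n" "B \<in> carrier_mat n n" "commutator A B = 0\<^sub>m n n"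
  shows "A * B = B * A"
proof (rule eq_matI)
  fix i j assume ij: "i < dim_row (B * A)" "j < dim_col (B * A)"
  then have "(A * B - B * A) $$ (i, j) = 0" using assms by (simp add: commutator_def)
  then show "(A * B) $$ (i, j) = (B * A) $$ (i, j)"
    using ij by (simp del: index_mult_mat(1))
qed (use assms in auto)

text \<open>Excludes dimension 0, since the generators have norm 1; the partition function is then
  positive.\<close>

lemma opnorm_dim_0:
  assumes "A \<in> carrier_mat 0 0" shows "opnorm A = 0"
proof -
  have "vnorm (A *\<^sub>v v) = 0" if "v \<in> carrier_vec 0" for v using assms that by (simp add: vnorm_def)
  then have "{vnorm (A *\<^sub>v v) | v. v \<in> carrier_vec (dim_col A) \<and> vnorm v \<le> 1} = {0}"
    using assms by (auto simp: vnorm_def intro!: exI[of _ "vec 0 (\<lambda>_. 0)"])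
  then show ?thesis by (simp add: opnorm_def)
qed

text \<open>As \<open>A\<close> and \<open>Z\<close> commute, the exponential factors, and the inner
  conjugation by \<open>exp Z\<close> acts trivially on \<open>\<Phi>\<close>. It removes from the
  exponent whatever locality or symmetry makes commute with an interaction term.\<close>

lemma rotation_cancel:
  assumes c: "A \<in> carrier_mat n n" "Z \<in> carrier_mat n n" "\<Phi> \<in> carrier_mat n n"
    and AZ: "A * Z = Z * A" and Z\<Phi>: "Z * \<Phi> = \<Phi> * Z"
  shows "mexp (A + Z) * \<Phi> * mexp (- (A + Z)) = mexp A * \<Phi> * mexp (- A)"
proof -
  have m: "- (A + Z) = - Z + - A" using c by (intro eq_matI) auto
  have 1: "mexp (A + Z) = mexp A * mexp Z" by (rule mexp_add[OF c(1,2) AZ])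
  have 2: "mexp (- (A + Z)) = mexp (- Z) * mexp (- A)"
    unfolding m using c AZ by (intro mexp_add[of _ n]) auto
  have 3: "mexp Z * \<Phi> = \<Phi> * mexp Z" by (rule mexp_intertwine[OF c(2,2,3) Z\<Phi>])
  have mc: "mexp X \<in> carrier_mat n n" if "X \<in> {A, Z, - A, - Z}" for X
    using that c by auto
  note as = assoc_mult_mat[of _ n n _ n _ n]
  have "mexp (A + Z) * \<Phi> * mexp (- (A + Z)) = mexp A * (mexp Z * \<Phi>) * (mexp (- Z) * mexp (- A))"
    unfolding 1 2 using c mc by (simp add: as)
  also have "\<dots> = mexp A * \<Phi> * (mexp Z * mexp (- Z)) * mexp (- A)"
    unfolding 3 using c mc by (simp add: as)
  also have "\<dots> = mexp A * \<Phi> * mexp (- A)"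
    unfolding mexp_uminus_right[OF c(2)] using c mc right_mult_one_mat[of "mexp A * \<Phi>" n n] by simp
  finally show ?thesis .
qed

text \<open>The charge relation reads \<open>S B = B (S + k)\<close>, so intertwining gives
  \<open>exp S * B = B * exp (S + k)\<close>, and the scalar \<open>exp k\<close> splits
  off.\<close>

lemma rotation_charge:
  assumes S: "S \<in> carrier_mat n n" and B: "B \<in> carrier_mat n n"
    and SB: "S * B = B * S + complex_of_real k \<cdot>\<^sub>m B"
  shows "mexp S * B * mexp (- S) = complex_of_real (exp k) \<cdot>\<^sub>m B"
proof -
  define K where "K = mat_diag n (\<lambda>_. complex_of_real k)"
  have K: "K \<in> carrier_mat n n" by (simp add: K_def)
  have K1: "K = complex_of_real k \<cdot>\<^sub>m 1\<^sub>m n" by (auto simp: K_def mat_diag_def)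
  have BK: "B * K = complex_of_real k \<cdot>\<^sub>m B" unfolding K1 using B
    by (simp add: mult_smult_distrib[of _ n n _ n] right_mult_one_mat[OF B])
  have KS: "S * K = K * S" unfolding K1 using S
    by (simp add: mult_smult_distrib[of _ n n _ n] mult_smult_assoc_mat[of _ n n _ n]
        right_mult_one_mat[OF S] left_mult_one_mat[OF S])
  have "S * B = B * (S + K)" using S B K by (simp add: mult_add_distrib_mat[of _ n n _ n] SB BK)
  then have "mexp S * B = B * mexp (S + K)" using S B K by (intro mexp_intertwine[of _ n]) auto
  also have "mexp (S + K) = mexp K * mexp S"
  proof -
    have "S + K = K + S" using S K by (simp add: comm_add_mat)
    then show ?thesis using mexp_add[OF K S] KS by simp
  qed
  also have "mexp K = complex_of_real (exp k) \<cdot>\<^sub>m 1\<^sub>m n"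
    unfolding K_def mexp_diag by (auto simp: mat_diag_def simp flip: exp_of_real)
  finally have "mexp S * B = complex_of_real (exp k) \<cdot>\<^sub>m (B * mexp S)"
    using S B left_mult_one_mat[OF mexp_carrier[OF S]]
    by (simp add: mult_smult_distrib[of _ n n _ n] mult_smult_assoc_mat[of _ n n _ n])
  then have "mexp S * B * mexp (- S) = complex_of_real (exp k) \<cdot>\<^sub>m (B * (mexp S * mexp (- S)))"
    using S B by (simp add: mult_smult_assoc_mat[of _ n n _ n] assoc_mult_mat[of _ n n _ n _ n])
  then show ?thesis by (simp add: mexp_uminus_right[OF S] right_mult_one_mat[OF B])
qed

section \<open>Rotations of a symmetric quantum system\<close>

locale u1 =
  fixes M :: "'v qsystem"
  assumes u1: "u1_system M"
begin

abbreviation "V \<equiv> sites M"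
abbreviation "n \<equiv> hdim M"
abbreviation "S \<equiv> gens M"
abbreviation "\<Phi> \<equiv> inter M"

lemma graph: "finite_graph V (edges M)"
  using u1 by (simp add: u1_system_def)

lemma finite_V: "finite V" and V_ne: "V \<noteq> {}"
  using graph by (simp_all add: finite_graph_def)

lemma S_carrier: "x \<in> V \<Longrightarrow> S x \<in> carrier_mat n n"
  and S_hermitian: "x \<in> V \<Longrightarrow> hermitian_mat (S x)"
  and S_norm: "x \<in> V \<Longrightarrow> opnorm (S x) = 1"
  using u1 by (simp_all add: u1_system_def)

lemma algs_carrier: "\<lbrakk>A \<subseteq> V; X \<in> algs M A\<rbrakk> \<Longrightarrow> X \<in> carrier_mat n n"
  using u1 by (auto simp: u1_system_def unital_subalgebra_def)

lemma \<Phi>_algs: "A \<subseteq> V \<Longrightarrow> \<Phi> A \<in> algs M A"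
  and \<Phi>_hermitian: "A \<subseteq> V \<Longrightarrow> hermitian_mat (\<Phi> A)"
  and \<Phi>_symmetric: "A \<subseteq> V \<Longrightarrow> commutator (\<Phi> A) (msum n S A) = 0\<^sub>m n n"
  using u1 by (simp_all add: u1_system_def)

lemma \<Phi>_carrier: "A \<subseteq> V \<Longrightarrow> \<Phi> A \<in> carrier_mat n n"
  using \<Phi>_algs algs_carrier by blast

lemma S_bound: "x \<in> V \<Longrightarrow> mat_bound n (S x) 1"
  using mat_bound_opnorm[OF S_carrier, of x] by (simp add: S_norm)

lemma hdim_pos: "0 < n"
proof (rule ccontr)
  assume "\<not> 0 < n"
  then have "n = 0" by simp
  obtain x where x: "x \<in> V" using V_ne by auto
  then have "S x \<in> carrier_mat 0 0" using S_carrier[OF x] \<open>n = 0\<close> by simp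
  then show False using opnorm_dim_0 S_norm[OF x] by simp
qed

lemma S_commute: "\<lbrakk>x \<in> V; y \<in> V\<rbrakk> \<Longrightarrow> S x * S y = S y * S x"
  using u1 by (cases "x = y") (auto intro!: commutator_eq_0[of _ n] simp: u1_system_def)

lemma \<Phi>_local: "\<lbrakk>A \<subseteq> V; x \<in> V; x \<notin> A\<rbrakk> \<Longrightarrow> S x * \<Phi> A = \<Phi> A * S x"
  using u1 \<Phi>_algs \<Phi>_carrier S_carrier
  by (intro commutator_eq_0[of _ n]) (auto simp: u1_system_def)

text \<open>The part of the exponent outside \<open>A\<close> commutes with the term by locality,
  and \<open>a\<close> times the total charge of \<open>A\<close> commutes by symmetry. Only
  deviations from a freely chosen reference value \<open>a\<close> survive, which makes the cost
  depend on differences of the profile.\<close>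

lemma rotated_interaction:
  fixes \<theta> :: "'v \<Rightarrow> real" and a :: real
  assumes A: "A \<subseteq> V"
  defines "Q \<equiv> wsum n (\<lambda>z. if z \<in> A then \<theta> z - a else 0) S V"
  shows "mexp (wsum n \<theta> S V) * \<Phi> A * mexp (- wsum n \<theta> S V) = mexp Q * \<Phi> A * mexp (- Q)"
proof -
  define Z1 where "Z1 = wsum n (\<lambda>z. if z \<in> A then 0 else \<theta> z) S V"
  define Z2 where "Z2 = wsum n (\<lambda>z. if z \<in> A then a else 0) S V"
  note fA = \<Phi>_carrier[OF A]
  have finA: "finite A" using A finite_V by (rule finite_subset)
  have split: "wsum n \<theta> S V = Q + (Z1 + Z2)"
  proof -
    have "\<theta> = (\<lambda>z. (if z \<in> A then \<theta> z - a else 0) + ((if z \<in> A then 0 else \<theta> z) + (if z \<in> A then a else 0)))"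
      by auto
    then show ?thesis unfolding Q_def Z1_def Z2_def wsum_add by metis
  qed
  have Q: "Q \<in> carrier_mat n n" by (simp add: Q_def)
  have Z: "Z1 \<in> carrier_mat n n" "Z2 \<in> carrier_mat n n" by (simp_all add: Z1_def Z2_def)
  have comm: "wsum n \<eta> S V * wsum n \<zeta> S V = wsum n \<zeta> S V * wsum n \<eta> S V" for \<eta> \<zeta>
    using S_carrier S_commute by (intro wsum_commute wsum_commute[symmetric]) auto
  have Z1\<Phi>: "\<Phi> A * Z1 = Z1 * \<Phi> A"
    unfolding Z1_def using S_carrier fA \<Phi>_local[OF A]
    by (intro wsum_commute) (auto split: if_splits)
  have Z2: "complex_of_real a \<cdot>\<^sub>m wsum n (\<lambda>_. 1) S A = Z2"
    unfolding Z2_def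
  proof (rule wsum_eqI)
    fix i j assume ij: "i < n" "j < n"
    have "(\<Sum>x\<in>V. complex_of_real (if x \<in> A then a else 0) * S x $$ (i, j))
        = (\<Sum>x\<in>V. if x \<in> A then complex_of_real a * S x $$ (i, j) else 0)"
      by (intro sum.cong) auto
    also have "\<dots> = (\<Sum>x\<in>A. complex_of_real a * S x $$ (i, j))"
      using A finite_V by (simp add: sum.inter_restrict[symmetric] Int_absorb1)
    finally show "(complex_of_real a \<cdot>\<^sub>m wsum n (\<lambda>_. 1) S A) $$ (i, j)
        = (\<Sum>x\<in>V. complex_of_real (if x \<in> A then a else 0) * S x $$ (i, j))"
      using ij by (simp add: wsum_index sum_distrib_left)
  qed simp
  have "\<Phi> A * wsum n (\<lambda>_. 1) S A = wsum n (\<lambda>_. 1) S A * \<Phi> A"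
  proof (rule commutator_eq_0[OF fA])
    have "msum n S A = wsum n (\<lambda>_. 1) S A"
      using finA A S_carrier by (intro msum_eq_wsum) auto
    then show "commutator (\<Phi> A) (wsum n (\<lambda>_. 1) S A) = 0\<^sub>m n n" using \<Phi>_symmetric[OF A] by simp
  qed simp
  then have Z2\<Phi>: "\<Phi> A * Z2 = Z2 * \<Phi> A"
    unfolding Z2[symmetric] using fA by (simp add: mult_smult_distrib[of _ n n _ n] mult_smult_assoc_mat[of _ n n _ n])
  show ?thesis unfolding split
  proof (rule rotation_cancel[of _ n])
    show "Q * (Z1 + Z2) = (Z1 + Z2) * Q"
      unfolding Q_def Z1_def Z2_def wsum_add by (rule comm)
    show "(Z1 + Z2) * \<Phi> A = \<Phi> A * (Z1 + Z2)"
      using Z fA Z1\<Phi> Z2\<Phi>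
      by (simp add: mult_add_distrib_mat[of _ n n _ n] add_mult_distrib_mat[of _ n n _ _ n])
  qed (use Q Z fA in auto)
qed

lemma opnorm_\<Phi>_nonneg: "A \<subseteq> V \<Longrightarrow> 0 \<le> opnorm (\<Phi> A)"
  using opnorm_nonneg[OF \<Phi>_carrier] .

text \<open>The generators have norm 1, so the sum of the deviations over the support bounds the
  norm of the reduced exponent.\<close>

lemma rotated_interaction_form:
  fixes \<theta> :: "'v \<Rightarrow> real" and a :: real
  assumes A: "A \<subseteq> V" and w: "w \<in> carrier_vec n"
    and u: "(\<Sum>z\<in>A. \<bar>\<theta> z - a\<bar>) \<le> u"
  shows "Re (cip n w (\<Phi> A *\<^sub>v w)) - 2 * opnorm (\<Phi> A) * (sinh u)\<^sup>2 * (vnorm w)\<^sup>2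
    \<le> Re (cip n w (mexp (wsum n \<theta> S V) * \<Phi> A * mexp (- wsum n \<theta> S V) *\<^sub>v w))"
  unfolding rotated_interaction[OF A, of \<theta> a]
proof (rule rotated_form_bound)
  have "mat_bound n (wsum n (\<lambda>z. if z \<in> A then \<theta> z - a else 0) S V)
      (\<Sum>x\<in>V. \<bar>if x \<in> A then \<theta> x - a else 0\<bar> * 1)"
    using finite_V S_bound by (intro wsum_bound)
  moreover have "(\<Sum>x\<in>V. \<bar>if x \<in> A then \<theta> x - a else 0\<bar> * 1) = (\<Sum>z\<in>A. \<bar>\<theta> z - a\<bar>)"
    using A finite_V by (intro sum.mono_neutral_cong_right) auto
  ultimately show "mat_bound n (wsum n (\<lambda>z. if z \<in> A then \<theta> z - a else 0) S V) u"
    using u by (auto intro: mat_bound_mono)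
  show "0 \<le> u" by (rule order_trans[OF sum_nonneg u]) simp
qed (use A w S_carrier S_hermitian \<Phi>_carrier \<Phi>_hermitian opnorm_\<Phi>_nonneg in
    \<open>auto intro!: wsum_hermitian mat_bound_opnorm\<close>)

text \<open>The reference value \<open>a A\<close> may be chosen separately for each support,
  because the same global rotation has a different reduced exponent on each term. The costs then add
  up in the quadratic form of the Hamiltonian.\<close>

theorem gibbs_bound:
  fixes \<theta> :: "'v \<Rightarrow> real" and a :: "'v set \<Rightarrow> real" and u :: "'v set \<Rightarrow> real"
  assumes corr: "u1_correlator M c x y Oxy" and xy: "x \<in> V" "y \<in> V"
    and \<theta>: "\<theta> y = 0" and \<beta>: "0 < \<beta>"
    and u: "\<And>A. A \<subseteq> V \<Longrightarrow> (\<Sum>z\<in>A. \<bar>\<theta> z - a A\<bar>) \<le> u A"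
    and \<epsilon>: "(\<Sum>A\<in>Pow V. 2 * opnorm (\<Phi> A) * (sinh (u A))\<^sup>2) \<le> \<epsilon>"
  shows "cmod (gibbs M \<beta> Oxy) \<le> exp (c * \<theta> x) * (opnorm Oxy * exp (\<beta> * \<epsilon>))"
proof -
  define T where "T = wsum n \<theta> S V"
  have T: "T \<in> carrier_mat n n" by (simp add: T_def)
  define H where "H = wsum n (\<lambda>_. 1) \<Phi> (Pow V)"
  have H: "hamiltonian M = H"
    unfolding hamiltonian_def H_def using finite_V \<Phi>_carrier by (intro msum_eq_wsum) auto
  have Hc: "H \<in> carrier_mat n n" by (simp add: H_def)
  have B: "Oxy \<in> carrier_mat n n"
    using corr algs_carrier by (auto simp: u1_correlator_def)
  have "T * Oxy = Oxy * T + complex_of_real (c * \<theta> x) \<cdot>\<^sub>m Oxy"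
  proof (rule eq_matI)
    fix i j assume "i < dim_row (Oxy * T + complex_of_real (c * \<theta> x) \<cdot>\<^sub>m Oxy)"
      "j < dim_col (Oxy * T + complex_of_real (c * \<theta> x) \<cdot>\<^sub>m Oxy)"
    then have ij: "i < n" "j < n" using B by auto
    \<comment> \<open>The weight at \<open>y\<close> is 0, so the unknown commutator of
      \<open>S y\<close> never contributes. If \<open>x = y\<close>, the charge relation at
      \<open>x\<close> still applies, hence the case \<open>z = x\<close> in the disjunction
      below.\<close>
    have z: "complex_of_real (\<theta> z) * (S z * Oxy) $$ (i, j)
        = complex_of_real (\<theta> z) * (Oxy * S z) $$ (i, j)
          + (if z = x then complex_of_real (c * \<theta> x) * Oxy $$ (i, j) else 0)" if z: "z \<in> V" for z
    proof -
      have k1: "commutator (S z) Oxy $$ (i, j) = (S z * Oxy) $$ (i, j) - (Oxy * S z) $$ (i, j)"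
        using S_carrier[OF z] B ij by (simp add: commutator_def del: index_mult_mat(1))
      have k2: "commutator (S z) Oxy $$ (i, j)
          = (if z = x then complex_of_real c * Oxy $$ (i, j) else 0)" if "z \<noteq> y \<or> z = x"
        using corr z that B ij by (auto simp: u1_correlator_def)
      have k: "(S z * Oxy) $$ (i, j) = (if z = x then complex_of_real c * Oxy $$ (i, j) else 0)
          + (Oxy * S z) $$ (i, j)" if "z \<noteq> y \<or> z = x"
        using k2[OF that] unfolding k1 by (simp only: diff_eq_eq)
      show ?thesis
      proof (cases "z \<noteq> y \<or> z = x")
        case True
        show ?thesis unfolding k[OF True] by (simp add: distrib_left del: index_mult_mat(1))
      next
        case False
        then show ?thesis using \<theta> by (simp del: index_mult_mat(1))
      qed
    qed
    have "(T * Oxy) $$ (i, j) = (\<Sum>z\<in>V. complex_of_real (\<theta> z) * (S z * Oxy) $$ (i, j))"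
      unfolding T_def using S_carrier B ij by (subst wsum_mult_right) (auto simp: wsum_index)
    also have "\<dots> = (\<Sum>z\<in>V. complex_of_real (\<theta> z) * (Oxy * S z) $$ (i, j)
          + (if z = x then complex_of_real (c * \<theta> x) * Oxy $$ (i, j) else 0))"
      by (intro sum.cong refl z)
    also have "\<dots> = (\<Sum>z\<in>V. complex_of_real (\<theta> z) * (Oxy * S z) $$ (i, j))
        + complex_of_real (c * \<theta> x) * Oxy $$ (i, j)"
      using finite_V xy by (simp add: sum.distrib del: index_mult_mat(1))
    also have "(\<Sum>z\<in>V. complex_of_real (\<theta> z) * (Oxy * S z) $$ (i, j)) = (Oxy * T) $$ (i, j)"
      unfolding T_def using S_carrier B ij by (subst wsum_mult_left) (auto simp: wsum_index)
    finally show "(T * Oxy) $$ (i, j) = (Oxy * T + complex_of_real (c * \<theta> x) \<cdot>\<^sub>m Oxy) $$ (i, j)"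
      using B T ij by (simp del: index_mult_mat(1))
  qed (use B T in auto)
  note RB = rotation_charge[OF T B this]
  have fin: "finite (Pow V)" using finite_V by simp
  have \<epsilon>0: "0 \<le> \<epsilon>"
    by (rule order_trans[OF sum_nonneg \<epsilon>]) (auto intro!: mult_nonneg_nonneg opnorm_\<Phi>_nonneg)
  have "cmod (mtrace (Oxy * mexp (complex_of_real (- \<beta>) \<cdot>\<^sub>m H)) / mtrace (mexp (complex_of_real (- \<beta>) \<cdot>\<^sub>m H)))
    \<le> cmod (complex_of_real (exp (c * \<theta> x))) * (opnorm Oxy * exp (\<beta> * \<epsilon>))"
  proof (rule rotated_trace_bound[OF Hc _ hdim_pos mexp_carrier[OF T] _ mexp_uminus_left[OF T]
        mexp_uminus_right[OF T] mat_bound_opnorm[OF B] RB _ \<epsilon>0 \<beta>])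
    show "hermitian_mat H" unfolding H_def
      using \<Phi>_carrier \<Phi>_hermitian by (intro wsum_hermitian) auto
    show "mexp (- T) \<in> carrier_mat n n" using T by simp
    fix w :: "complex vec" assume w: "w \<in> carrier_vec n"
    let ?G = "\<lambda>A. mexp T * \<Phi> A * mexp (- T)"
    have Tc: "mexp T \<in> carrier_mat n n" "mexp (- T) \<in> carrier_mat n n" using T by auto
    have HG: "mexp T * H * mexp (- T) = wsum n (\<lambda>_. 1) ?G (Pow V)"
      unfolding H_def using Tc \<Phi>_carrier
      by (subst wsum_mult_left) (auto intro!: wsum_mult_right)
    have 1: "cip n w (mexp T * H * mexp (- T) *\<^sub>v w) = (\<Sum>A\<in>Pow V. cip n w (?G A *\<^sub>v w))"
      unfolding HG using Tc \<Phi>_carrier by (subst cip_wsum[OF fin _ w]) auto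
    have 2: "cip n w (H *\<^sub>v w) = (\<Sum>A\<in>Pow V. cip n w (\<Phi> A *\<^sub>v w))"
      unfolding H_def using \<Phi>_carrier by (subst cip_wsum[OF fin _ w]) auto
    have "Re (cip n w (H *\<^sub>v w)) - \<epsilon> * (vnorm w)\<^sup>2
        \<le> Re (cip n w (H *\<^sub>v w)) - (\<Sum>A\<in>Pow V. 2 * opnorm (\<Phi> A) * (sinh (u A))\<^sup>2) * (vnorm w)\<^sup>2"
      using \<epsilon> by (intro diff_left_mono mult_right_mono) auto
    also have "\<dots> = (\<Sum>A\<in>Pow V. Re (cip n w (\<Phi> A *\<^sub>v w)) - 2 * opnorm (\<Phi> A) * (sinh (u A))\<^sup>2 * (vnorm w)\<^sup>2)"
      unfolding 2 by (simp add: sum_subtractf sum_distrib_right)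
    also have "\<dots> \<le> (\<Sum>A\<in>Pow V. Re (cip n w (?G A *\<^sub>v w)))"
    proof (rule sum_mono)
      fix A assume "A \<in> Pow V"
      then have A: "A \<subseteq> V" by simp
      show "Re (cip n w (\<Phi> A *\<^sub>v w)) - 2 * opnorm (\<Phi> A) * (sinh (u A))\<^sup>2 * (vnorm w)\<^sup>2
          \<le> Re (cip n w (?G A *\<^sub>v w))"
        unfolding T_def by (rule rotated_interaction_form[OF A w u[OF A]])
    qed
    also have "\<dots> = Re (cip n w (mexp T * H * mexp (- T) *\<^sub>v w))" unfolding 1 by simp
    finally show "Re (cip n w (H *\<^sub>v w)) - \<epsilon> * (vnorm w)\<^sup>2
      \<le> Re (cip n w (mexp T * H * mexp (- T) *\<^sub>v w))" .
  qed
  then show ?thesis unfolding gibbs_def H by simp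
qed

end

section \<open>Graph distances and the logarithmic profile\<close>

lemma graph_dist_walk:
  assumes "finite_graph V E" "x \<in> V" "y \<in> V"
  shows "(x, y) \<in> E ^^ graph_dist E x y"
proof -
  have "(x, y) \<in> E\<^sup>*" using assms by (simp add: finite_graph_def)
  then obtain m where "(x, y) \<in> E ^^ m" by (auto simp: rtrancl_power)
  then show ?thesis unfolding graph_dist_def by (rule LeastI)
qed

lemma graph_dist_triangle:
  assumes "finite_graph V E" "x \<in> V" "y \<in> V" "z \<in> V"
  shows "graph_dist E x z \<le> graph_dist E x y + graph_dist E y z"
proof -
  have "(x, z) \<in> E ^^ (graph_dist E x y + graph_dist E y z)"
    unfolding relpow_add using graph_dist_walk[OF assms(1)] assms by blast
  then show ?thesis unfolding graph_dist_def[of E x z] by (rule Least_le)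
qed

lemma graph_dist_self [simp]: "graph_dist E x x = 0"
  unfolding graph_dist_def by (rule Least_eq_0) simp

lemma graph_dist_eq_0:
  assumes "finite_graph V E" "x \<in> V" "y \<in> V" "graph_dist E x y = 0"
  shows "x = y"
  using graph_dist_walk[OF assms(1-3)] assms(4) by simp

lemma graph_dist_le_diam:
  assumes "finite A" "x \<in> A" "y \<in> A"
  shows "graph_dist E x y \<le> graph_diam E A"
proof -
  have "{graph_dist E x y | x y. x \<in> A \<and> y \<in> A} = (\<lambda>(x, y). graph_dist E x y) ` (A \<times> A)" by auto
  then have "finite {graph_dist E x y | x y. x \<in> A \<and> y \<in> A}" using assms by simp
  then show ?thesis unfolding graph_diam_def using assms by (intro Max_ge) auto
qed

text \<open>Spheres have at most \<open>card V\<close> points. Boundedness is what lets the supremum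
  in \<open>perimeter_const\<close> be used as a bound on each sphere.\<close>

lemma bdd_above_perimeter:
  assumes "finite V"
  shows "bdd_above {real (card {y \<in> V. graph_dist E x y = l}) / real l | x l. x \<in> V \<and> l \<ge> 1}"
proof (rule bdd_aboveI)
  fix r assume "r \<in> {real (card {y \<in> V. graph_dist E x y = l}) / real l | x l. x \<in> V \<and> l \<ge> 1}"
  then obtain x l where r: "r = real (card {y \<in> V. graph_dist E x y = l}) / real l" "l \<ge> 1" by auto
  have "card {y \<in> V. graph_dist E x y = l} \<le> card V" using assms by (intro card_mono) auto
  then have "r \<le> real (card V) / 1" unfolding r using \<open>l \<ge> 1\<close> by (intro frac_le) auto
  then show "r \<le> real (card V)" by simp
qed

lemma sphere_card_le:
  assumes "finite V" "x \<in> V" "1 \<le> l"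
  shows "real (card {y \<in> V. graph_dist E x y = l}) \<le> perimeter_const V E * real l"
proof -
  have "real (card {y \<in> V. graph_dist E x y = l}) / real l \<le> perimeter_const V E"
    unfolding perimeter_const_def using assms by (intro cSup_upper bdd_above_perimeter) auto
  then show ?thesis using assms by (simp add: pos_divide_le_eq)
qed

lemma perimeter_const_nonneg:
  assumes "finite V" "V \<noteq> {}" shows "0 \<le> perimeter_const V E"
proof -
  obtain x where "x \<in> V" using assms by auto
  from sphere_card_le[OF assms(1) this, of 1 E] show ?thesis
    using of_nat_0_le_iff order_trans by fastforce
qed

text \<open>Since \<open>l (l + 2) \<le> (l + 1)^2\<close>, the shell at distance \<open>l\<close>
  contributes at most \<open>\<gamma> / (l + 2)\<close>, which is at most
  \<open>\<gamma> (ln (l + 2) - ln (l + 1))\<close>, and the logarithms telescope. The leading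
  constant is exactly \<open>\<gamma>\<close>; the shell at distance 0 accounts for the summand
  1.\<close>

lemma sum_shells_le:
  fixes N :: "nat \<Rightarrow> real"
  assumes "N 0 \<le> 1" "\<And>l. 1 \<le> l \<Longrightarrow> N l \<le> \<gamma> * real l" "0 \<le> \<gamma>"
  shows "(\<Sum>l<D. N l / (real l + 1)\<^sup>2) \<le> 1 + \<gamma> * ln (real D + 1)"
proof (induction D)
  case (Suc D)
  show ?case
  proof (cases "D = 0")
    case True
    then show ?thesis using assms by (simp add: add_increasing2)
  next
    case False
    have "N D / (real D + 1)\<^sup>2 \<le> \<gamma> * real D / (real D + 1)\<^sup>2"
      using assms(2)[of D] False by (intro divide_right_mono) auto
    also have "\<dots> = \<gamma> * (real D / (real D + 1)\<^sup>2)" by simp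
    also have "real D / (real D + 1)\<^sup>2 \<le> 1 / (real D + 2)"
    proof -
      have "real D * (real D + 2) \<le> 1 * (real D + 1)\<^sup>2"
        by (simp add: power2_eq_square algebra_simps)
      then have "real D \<le> (real D + 1)\<^sup>2 / (real D + 2)" by (subst pos_le_divide_eq) simp_all
      then show ?thesis by (subst pos_divide_le_eq) simp_all
    qed
    also have "1 / (real D + 2) \<le> ln (real D + 2) - ln (real D + 1)"
    proof -
      have "ln ((real D + 1) / (real D + 2)) \<le> (real D + 1) / (real D + 2) - 1"
        by (intro ln_le_minus_one) simp
      also have "\<dots> = - (1 / (real D + 2))" by (simp add: field_simps)
      finally show ?thesis by (simp add: ln_div)
    qed
    finally have "N D / (real D + 1)\<^sup>2 \<le> \<gamma> * (ln (real D + 2) - ln (real D + 1))"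
      using assms(3) by (simp add: mult_left_mono)
    then show ?thesis using Suc.IH by (simp add: algebra_simps)
  qed
qed simp

text \<open>Convexity of the exponential between 0 and \<open>y\<close>: the tangent at
  \<open>t y\<close> lies below the graph at both ends, and in the weighted combination the linear
  terms cancel.\<close>

lemma exp_chord:
  fixes t y :: real
  assumes "0 \<le> t" "t \<le> 1"
  shows "exp (t * y) \<le> 1 - t + t * exp y"
proof -
  have "exp (t * y) * (1 + (1 - t) * y) \<le> exp (t * y) * exp ((1 - t) * y)"
    by (intro mult_left_mono exp_ge_add_one_self) simp
  also have "\<dots> = exp y" by (simp add: algebra_simps flip: exp_add)
  finally have 1: "t * (exp (t * y) * (1 + (1 - t) * y)) \<le> t * exp y"
    using assms by (intro mult_left_mono) auto
  have "exp (t * y) * (1 + - (t * y)) \<le> exp (t * y) * exp (- (t * y))"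
    by (intro mult_left_mono exp_ge_add_one_self) simp
  also have "\<dots> = 1" by (simp flip: exp_add)
  finally have 2: "(1 - t) * (exp (t * y) * (1 + - (t * y))) \<le> (1 - t) * 1"
    using assms by (intro mult_left_mono) auto
  from 1 2 show ?thesis by (simp add: algebra_simps)
qed

text \<open>From \<open>1 - exp (- 2 u) \<le> 2 u\<close> one gets
  \<open>sinh u \<le> u * exp u\<close>. The factor \<open>exp (2 u)\<close> separates the quadratic
  cost from the excess of large supports.\<close>

lemma sinh_sq_le:
  fixes u :: real assumes "0 \<le> u" shows "(sinh u)\<^sup>2 \<le> u\<^sup>2 * exp (2 * u)"
proof -
  have "1 + - (2 * u) \<le> exp (- (2 * u))" by (rule exp_ge_add_one_self)
  then have "exp u * (1 - exp (- (2 * u))) \<le> exp u * (2 * u)" by (intro mult_left_mono) auto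
  moreover have e: "exp u * (1 - exp (- (2 * u))) = 2 * sinh u"
    by (simp add: sinh_def right_diff_distrib flip: exp_add)
  ultimately have "2 * sinh u \<le> exp u * (2 * u)" by (simp only: e)
  then have "sinh u \<le> u * exp u" by (simp add: mult.commute mult.left_commute)
  then have "(sinh u)\<^sup>2 \<le> (u * exp u)\<^sup>2" using assms by (intro power_mono) auto
  then show ?thesis by (simp add: power_mult_distrib exp_double)
qed

text \<open>The factor \<open>exp (2 u)\<close> is interpolated between \<open>1\<close> and the weight with parameter \<open>K\<close>, so
  that for small \<open>\<kappa>\<close> only the weight with parameter \<open>0\<close> remains.\<close>

lemma rotation_cost_le:
  fixes v \<delta> m \<kappa> K :: real
  assumes v: "0 \<le> v" and \<delta>: "0 \<le> \<delta>" and m: "0 \<le> m" and \<kappa>: "0 \<le> \<kappa>" "\<kappa> \<le> K" "0 < K"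
  shows "(sinh (v * (\<kappa> * ln (1 + \<delta> / (m + 1)))))\<^sup>2 \<le> \<kappa>\<^sup>2 / (m + 1)\<^sup>2 *
    (v\<^sup>2 * (\<delta> + 1) powr (2 * 0 * v + 2) + \<kappa> / K * (v\<^sup>2 * (\<delta> + 1) powr (2 * K * v + 2)))"
proof -
  define p where "p = ln (1 + \<delta> / (m + 1))"
  have dm: "0 \<le> \<delta> / (m + 1)" using \<delta> m by simp
  have p0: "0 \<le> p" unfolding p_def using dm by simp
  \<comment> \<open>The same logarithm is bounded twice: here by a quantity decaying in
    \<open>m\<close>, used in the quadratic factor, and next by \<open>ln (\<delta> + 1)\<close>,
    which turns the exponential factor into a power of \<open>\<delta> + 1\<close>.\<close>
  have p1: "p \<le> (\<delta> + 1) / (m + 1)"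
  proof -
    have "p \<le> \<delta> / (m + 1)" unfolding p_def using dm by (rule ln_add_one_self_le_self)
    also have "\<dots> \<le> (\<delta> + 1) / (m + 1)" using m by (intro divide_right_mono) auto
    finally show ?thesis .
  qed
  have p2: "p \<le> ln (\<delta> + 1)"
  proof -
    have "\<delta> / (m + 1) \<le> \<delta> / 1" using \<delta> m by (intro divide_left_mono) auto
    moreover have "0 < 1 + \<delta> / (m + 1)" using dm by simp
    ultimately show ?thesis unfolding p_def by (intro ln_mono) auto
  qed
  let ?u = "v * (\<kappa> * p)"
  have u0: "0 \<le> ?u" using v \<kappa> p0 by simp
  define X where "X = (\<delta> + 1) powr (2 * K * v)"
  have "2 * ?u = 2 * \<kappa> * v * p" by simp
  also have "\<dots> \<le> 2 * \<kappa> * v * ln (\<delta> + 1)" using p2 v \<kappa> by (intro mult_left_mono) auto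
  also have "\<dots> = \<kappa> / K * (2 * K * v * ln (\<delta> + 1))" using \<kappa> by simp
  finally have "exp (2 * ?u) \<le> exp (\<kappa> / K * (2 * K * v * ln (\<delta> + 1)))" by simp
  also have "\<dots> \<le> 1 - \<kappa> / K + \<kappa> / K * exp (2 * K * v * ln (\<delta> + 1))"
    using \<kappa> by (intro exp_chord) auto
  also have "\<dots> \<le> 1 + \<kappa> / K * X"
    using \<kappa> \<delta> by (simp add: X_def powr_def)
  finally have e: "exp (2 * ?u) \<le> 1 + \<kappa> / K * X" .
  have "?u \<le> v * (\<kappa> * ((\<delta> + 1) / (m + 1)))" using p1 v \<kappa> by (intro mult_left_mono) auto
  then have "?u\<^sup>2 \<le> (v * (\<kappa> * ((\<delta> + 1) / (m + 1))))\<^sup>2" using u0 by (intro power_mono) auto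
  also have "\<dots> = \<kappa>\<^sup>2 / (m + 1)\<^sup>2 * (v\<^sup>2 * (\<delta> + 1)\<^sup>2)"
    by (simp add: power_mult_distrib power_divide)
  finally have u2: "?u\<^sup>2 \<le> \<kappa>\<^sup>2 / (m + 1)\<^sup>2 * (v\<^sup>2 * (\<delta> + 1)\<^sup>2)" .
  have "(sinh ?u)\<^sup>2 \<le> ?u\<^sup>2 * exp (2 * ?u)" by (rule sinh_sq_le[OF u0])
  also have "\<dots> \<le> (\<kappa>\<^sup>2 / (m + 1)\<^sup>2 * (v\<^sup>2 * (\<delta> + 1)\<^sup>2)) * (1 + \<kappa> / K * X)"
    using u2 e by (intro mult_mono) auto
  also have "\<dots> = \<kappa>\<^sup>2 / (m + 1)\<^sup>2 * (v\<^sup>2 * (\<delta> + 1)\<^sup>2 + \<kappa> / K * (v\<^sup>2 * ((\<delta> + 1)\<^sup>2 * X)))"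
  proof -
    have "(k * (a * b)) * (1 + t * X) = k * (a * b + t * (a * (b * X)))" for k a b t :: real
      by (simp add: algebra_simps)
    then show ?thesis .
  qed
  also have "(\<delta> + 1)\<^sup>2 = (\<delta> + 1) powr (2 * 0 * v + 2)" using \<delta> by (simp add: powr_numeral)
  also have "(\<delta> + 1) powr (2 * 0 * v + 2) * X = (\<delta> + 1) powr (2 * K * v + 2)"
    unfolding X_def by (simp add: add.commute flip: powr_add)
  finally show ?thesis by (simp add: p_def)
qed

text \<open>The ratio \<open>(d + 1) / (m + 1)\<close> is at most
  \<open>1 + \<delta> / (m + 1)\<close>. Capping distances at \<open>D\<close> makes the profile
  constant from there on, so a support whose nearest point is at distance at least \<open>D\<close>
  costs nothing.\<close>

lemma log_profile_diff:
  fixes d m D \<delta> :: nat and \<kappa> L :: real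
  assumes "m \<le> d" "d \<le> m + \<delta>" "0 \<le> \<kappa>"
  shows "\<bar>\<kappa> * (L - ln (real (min d D) + 1)) - \<kappa> * (L - ln (real (min m D) + 1))\<bar>
    \<le> (if m < D then \<kappa> * ln (1 + real \<delta> / (real m + 1)) else 0)"
proof (cases "m < D")
  case False
  then have "min d D = D" "min m D = D" using assms by auto
  then show ?thesis using False by simp
next
  case True
  define p where "p = ln (real (min d D) + 1)"
  define q where "q = ln (real (min m D) + 1)"
  define r where "r = ln (1 + real \<delta> / (real m + 1))"
  have qp: "q \<le> p" unfolding p_def q_def using assms by (intro ln_mono) auto
  have "p \<le> ln (real m + 1 + real \<delta>)" unfolding p_def using assms by (intro ln_mono) auto
  also have "real m + 1 + real \<delta> = (real m + 1) * (1 + real \<delta> / (real m + 1))"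
    by (simp add: field_simps)
  also have "ln \<dots> = ln (real m + 1) + r"
    unfolding r_def by (rule ln_mult_pos) (simp_all add: add_pos_nonneg)
  also have "ln (real m + 1) = q" unfolding q_def using True by (simp add: min_def)
  finally have "p - q \<le> r" by simp
  have "\<kappa> * (L - p) - \<kappa> * (L - q) = - (\<kappa> * (p - q))" by (simp add: right_diff_distrib)
  then have "\<bar>\<kappa> * (L - p) - \<kappa> * (L - q)\<bar> = \<kappa> * (p - q)" using qp assms(3) by simp
  also have "\<dots> \<le> \<kappa> * r" using \<open>p - q \<le> r\<close> assms(3) by (rule mult_left_mono)
  finally show ?thesis using True by (simp add: p_def q_def r_def)
qed

section \<open>Summing the cost over supports and shells\<close>

context u1
begin

definition weight :: "real \<Rightarrow> 'v set \<Rightarrow> real" where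
  "weight K A = opnorm (\<Phi> A) * (real (card A) - 1)\<^sup>2 *
     (real (graph_diam (edges M) A) + 1) powr (2 * K * (real (card A) - 1) + 2)"

lemma weight_nonneg: "A \<subseteq> V \<Longrightarrow> 0 \<le> weight K A"
  using opnorm_\<Phi>_nonneg by (simp add: weight_def)

text \<open>The base is at least 1, and a nonempty support makes the factor of \<open>K\<close> in
  the exponent nonnegative; for the empty set that factor would be \<open>-1\<close> and reverse the
  comparison.\<close>

lemma weight_mono:
  assumes "A \<subseteq> V" "z \<in> A" "K \<le> K'" shows "weight K A \<le> weight K' A"
proof -
  have "0 < card A" using assms finite_V by (auto simp: card_gt_0_iff intro: finite_subset)
  then have "0 \<le> real (card A) - 1" by linarith
  then have "2 * K * (real (card A) - 1) + 2 \<le> 2 * K' * (real (card A) - 1) + 2"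
    using assms by (intro add_right_mono mult_right_mono) auto
  then have "(real (graph_diam (edges M) A) + 1) powr (2 * K * (real (card A) - 1) + 2)
      \<le> (real (graph_diam (edges M) A) + 1) powr (2 * K' * (real (card A) - 1) + 2)"
    by (intro powr_mono) auto
  then show ?thesis
    unfolding weight_def using opnorm_\<Phi>_nonneg[OF assms(1)] by (intro mult_left_mono) auto
qed

lemma inter_norm_weight: "inter_norm K M = (SUP z\<in>V. \<Sum>A | A \<subseteq> V \<and> z \<in> A. weight K A)"
  by (simp add: inter_norm_def weight_def)

lemma weight_sum_le: "z \<in> V \<Longrightarrow> (\<Sum>A | A \<subseteq> V \<and> z \<in> A. weight K A) \<le> inter_norm K M"
  unfolding inter_norm_weight using finite_V by (intro cSUP_upper bdd_above_finite finite_imageI)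

lemma inter_norm_mono:
  assumes "K \<le> K'" shows "inter_norm K M \<le> inter_norm K' M"
  unfolding inter_norm_weight[of K]
proof (rule cSUP_least[OF V_ne])
  fix z assume z: "z \<in> V"
  have "(\<Sum>A | A \<subseteq> V \<and> z \<in> A. weight K A) \<le> (\<Sum>A | A \<subseteq> V \<and> z \<in> A. weight K' A)"
    using weight_mono assms by (intro sum_mono) auto
  also have "\<dots> \<le> inter_norm K' M" by (rule weight_sum_le[OF z])
  finally show "(\<Sum>A | A \<subseteq> V \<and> z \<in> A. weight K A) \<le> inter_norm K' M" .
qed

lemma inter_norm_nonneg: "0 \<le> inter_norm K M"
proof -
  obtain z where z: "z \<in> V" using V_ne by auto
  have "0 \<le> (\<Sum>A | A \<subseteq> V \<and> z \<in> A. weight K A)" using weight_nonneg by (intro sum_nonneg) auto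
  then show ?thesis using weight_sum_le[OF z, of K] by linarith
qed

lemma qperimeter_nonneg: "0 \<le> qperimeter M"
  unfolding qperimeter_def by (rule perimeter_const_nonneg[OF finite_V V_ne])

text \<open>The sphere around \<open>x\<close> through \<open>y\<close> is nonempty. Hence a
  vanishing perimeter constant leaves only distance 0, the degenerate case of the final
  theorem.\<close>

lemma qdist_pos_imp_perimeter_pos:
  assumes "x \<in> V" "y \<in> V" "0 < qdist M x y" shows "0 < qperimeter M"
proof -
  have "finite {z \<in> V. graph_dist (edges M) x z = qdist M x y}" using finite_V by simp
  then have "1 \<le> card {z \<in> V. graph_dist (edges M) x z = qdist M x y}"
    using assms by (auto simp: Suc_le_eq card_gt_0_iff qdist_def)
  then have "0 < real (card {z \<in> V. graph_dist (edges M) x z = qdist M x y})" by simp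
  also have "\<dots> \<le> qperimeter M * real (qdist M x y)"
    unfolding qperimeter_def using assms by (intro sphere_card_le finite_V) auto
  finally show ?thesis using assms by (simp add: zero_less_mult_iff)
qed

lemma shell_sum_le:
  assumes x: "x \<in> V" and \<gamma>: "qperimeter M \<le> \<gamma>"
  shows "(\<Sum>z | z \<in> V \<and> qdist M x z < D. 1 / (real (qdist M x z) + 1)\<^sup>2) \<le> 1 + \<gamma> * ln (real D + 1)"
proof -
  let ?d = "qdist M x"
  let ?N = "\<lambda>l. card {z \<in> V. ?d z = l}"
  have "(\<Sum>z | z \<in> V \<and> ?d z < D. 1 / (real (?d z) + 1)\<^sup>2)
      = (\<Sum>l<D. \<Sum>z \<in> {z \<in> {z. z \<in> V \<and> ?d z < D}. ?d z = l}. 1 / (real (?d z) + 1)\<^sup>2)"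
    using finite_V by (intro sum.group[symmetric]) auto
  also have "\<dots> = (\<Sum>l<D. real (?N l) / (real l + 1)\<^sup>2)"
  proof (rule sum.cong[OF refl])
    fix l assume l: "l \<in> {..<D}"
    then have "{z \<in> {z. z \<in> V \<and> ?d z < D}. ?d z = l} = {z \<in> V. ?d z = l}" by auto
    then show "(\<Sum>z \<in> {z \<in> {z. z \<in> V \<and> ?d z < D}. ?d z = l}. 1 / (real (?d z) + 1)\<^sup>2)
        = real (?N l) / (real l + 1)\<^sup>2"
      by simp
  qed
  also have "\<dots> \<le> 1 + \<gamma> * ln (real D + 1)"
  proof (rule sum_shells_le)
    have "{z \<in> V. ?d z = 0} \<subseteq> {x}"
      using graph_dist_eq_0[OF graph x] by (auto simp: qdist_def)
    then have "?N 0 \<le> card {x}" by (intro card_mono) auto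
    then show "real (?N 0) \<le> 1" by simp
    fix l :: nat assume "1 \<le> l"
    then have "real (?N l) \<le> qperimeter M * real l"
      unfolding qdist_def qperimeter_def by (intro sphere_card_le finite_V x)
    also have "\<dots> \<le> \<gamma> * real l" using \<gamma> by (intro mult_right_mono) auto
    finally show "real (?N l) \<le> \<gamma> * real l" .
  qed (use \<gamma> qperimeter_nonneg in simp)
  finally show ?thesis .
qed

text \<open>Each support is charged to its point nearest to \<open>x\<close>. Exchanging the sums,
  the supports through a given site are controlled by the interaction norm and the sites by the
  shell sum, with weight \<open>1 / (d + 1)^2\<close> from the squared slope of the profile.\<close>

theorem decay_bound:
  assumes corr: "u1_correlator M c x y Oxy" and xy: "x \<in> V" "y \<in> V" and \<beta>: "0 < \<beta>"
    and \<kappa>: "0 \<le> \<kappa>" "\<kappa> \<le> K" "0 < K"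
    and N: "inter_norm 0 M \<le> N0" "inter_norm K M \<le> N" and \<gamma>: "qperimeter M \<le> \<gamma>"
  defines "L \<equiv> ln (real (qdist M x y) + 1)"
  shows "cmod (gibbs M \<beta> Oxy) \<le> exp (- (\<bar>c\<bar> * \<kappa> * L)) *
    (opnorm Oxy * exp (\<beta> * (2 * \<kappa>\<^sup>2 * (N0 + \<kappa> / K * N) * (1 + \<gamma> * L))))"
proof -
  define d where "d = qdist M x"
  define D where "D = d y"
  have LD: "L = ln (real D + 1)" by (simp add: L_def D_def d_def)
  define \<delta> where "\<delta> A = graph_diam (edges M) A" for A
  define m where "m A = Min (d ` A)" for A
  \<comment> \<open>The sign of the rotation is opposite to that of \<open>c\<close>, so that
    \<open>exp (c * \<theta> x)\<close> is at most 1 in either case.\<close>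
  define s :: real where "s = (if 0 \<le> c then -1 else 1)"
  have s: "\<bar>s\<bar> = 1" "c * s = - \<bar>c\<bar>" by (auto simp: s_def)
  define g where "g k = \<kappa> * (L - ln (real (min k D) + 1))" for k
  define u where "u A = (if A \<noteq> {} \<and> m A < D
    then (real (card A) - 1) * (\<kappa> * ln (1 + real (\<delta> A) / (real (m A) + 1))) else 0)" for A
  have fin: "finite A" if "A \<subseteq> V" for A using that finite_V by (rule finite_subset)
  have m_ex: "\<exists>z\<in>A. d z = m A" if "A \<subseteq> V" "A \<noteq> {}" for A
  proof -
    have "m A \<in> d ` A" unfolding m_def using fin that by (intro Min_in) auto
    then show ?thesis by auto
  qed
  have u: "(\<Sum>z\<in>A. \<bar>s * g (d z) - s * g (m A)\<bar>) \<le> u A" if A: "A \<subseteq> V" for A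
  proof (cases "A = {}")
    case False
    then obtain z0 where z0: "z0 \<in> A" "d z0 = m A" using m_ex[OF A] by auto
    define b where "b = (if m A < D then \<kappa> * ln (1 + real (\<delta> A) / (real (m A) + 1)) else 0)"
    have le: "\<bar>s * g (d z) - s * g (m A)\<bar> \<le> b" if z: "z \<in> A" for z
    proof -
      have "m A \<le> d z" unfolding m_def using fin[OF A] z by (intro Min_le) auto
      moreover have "z0 \<in> V" "z \<in> V" using A z z0 by auto
      then have "d z \<le> m A + \<delta> A"
        using graph_dist_triangle[OF graph xy(1), of z0 z] graph_dist_le_diam[OF fin[OF A] z0(1) z, of "edges M"]
          z0(2) by (simp add: d_def qdist_def \<delta>_def)
      ultimately have "\<bar>g (d z) - g (m A)\<bar> \<le> b"
        unfolding g_def b_def using \<kappa>(1) by (rule log_profile_diff)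
      moreover have "\<bar>s * g (d z) - s * g (m A)\<bar> = \<bar>g (d z) - g (m A)\<bar>"
        using s(1) by (simp add: abs_mult flip: right_diff_distrib)
      ultimately show ?thesis by simp
    qed
    \<comment> \<open>The reference value is the profile at the nearest point \<open>z0\<close>,
      whose term therefore vanishes; this leaves \<open>card A - 1\<close> terms, the number
      occurring in the interaction norm.\<close>
    have "(\<Sum>z\<in>A. \<bar>s * g (d z) - s * g (m A)\<bar>) = (\<Sum>z\<in>A - {z0}. \<bar>s * g (d z) - s * g (m A)\<bar>)"
      using fin[OF A] z0 by (intro sum.mono_neutral_right) auto
    also have "\<dots> \<le> real (card (A - {z0})) * b" using le by (intro sum_bounded_above) auto
    also have "real (card (A - {z0})) = real (card A) - 1"
      using card_Suc_Diff1[OF fin[OF A] z0(1)] by linarith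
    also have "(real (card A) - 1) * b = u A" using False by (simp add: u_def b_def)
    finally show ?thesis .
  qed (simp add: u_def)
  define w where "w A = weight 0 A + \<kappa> / K * weight K A" for A
  have w0: "0 \<le> w A" if "A \<subseteq> V" for A
    unfolding w_def using weight_nonneg[OF that] \<kappa> by simp
  define h where "h z = 2 * \<kappa>\<^sup>2 / (real (d z) + 1)\<^sup>2" for z
  have h0: "0 \<le> h z" for z by (simp add: h_def)
  \<comment> \<open>The term of the nearest point alone pays the cost; the remaining terms are
    nonnegative and are added so that the sums over supports and sites can be exchanged.\<close>
  have cost: "2 * opnorm (\<Phi> A) * (sinh (u A))\<^sup>2 \<le> (\<Sum>z\<in>V. if z \<in> A \<and> d z < D then h z * w A else 0)"
    if A: "A \<subseteq> V" for A
  proof (cases "A \<noteq> {} \<and> m A < D")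
    case False
    then have "u A = 0" by (auto simp: u_def)
    then show ?thesis using w0[OF A] h0 by (auto intro!: sum_nonneg)
  next
    case True
    then obtain z0 where z0: "z0 \<in> A" "d z0 = m A" using m_ex[OF A] by auto
    have "card A > 0" using True fin[OF A] by (simp add: card_gt_0_iff)
    then have v: "0 \<le> real (card A) - 1" by linarith
    have "(sinh (u A))\<^sup>2 \<le> \<kappa>\<^sup>2 / (real (m A) + 1)\<^sup>2 *
      ((real (card A) - 1)\<^sup>2 * (real (\<delta> A) + 1) powr (2 * 0 * (real (card A) - 1) + 2)
        + \<kappa> / K * ((real (card A) - 1)\<^sup>2 * (real (\<delta> A) + 1) powr (2 * K * (real (card A) - 1) + 2)))"
      (is "_ \<le> ?k * ?W")
      using rotation_cost_le[OF v _ _ \<kappa>, of "real (\<delta> A)" "real (m A)"] True by (simp add: u_def)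
    then have "2 * opnorm (\<Phi> A) * (sinh (u A))\<^sup>2 \<le> 2 * opnorm (\<Phi> A) * (?k * ?W)"
      using opnorm_\<Phi>_nonneg[OF A] by (intro mult_left_mono) auto
    also have "\<dots> = (2 * ?k) * (opnorm (\<Phi> A) * ?W)" by simp
    also have "opnorm (\<Phi> A) * ?W = w A"
      by (simp add: w_def weight_def \<delta>_def distrib_left mult.assoc mult.left_commute)
    also have "2 * ?k = h z0" by (simp add: h_def z0)
    also have "h z0 * w A = (if z0 \<in> A \<and> d z0 < D then h z0 * w A else 0)"
      using z0 True by simp
    also have "\<dots> \<le> (\<Sum>z\<in>V. if z \<in> A \<and> d z < D then h z * w A else 0)"
      using z0 A finite_V w0[OF A] h0 by (intro member_le_sum) auto
    finally show ?thesis .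
  qed
  let ?N = "N0 + \<kappa> / K * N"
  have wsum_le: "(\<Sum>A | A \<subseteq> V \<and> z \<in> A. w A) \<le> ?N" if z: "z \<in> V" for z
  proof -
    have "(\<Sum>A | A \<subseteq> V \<and> z \<in> A. w A)
        = (\<Sum>A | A \<subseteq> V \<and> z \<in> A. weight 0 A) + \<kappa> / K * (\<Sum>A | A \<subseteq> V \<and> z \<in> A. weight K A)"
      unfolding w_def by (simp add: sum.distrib sum_distrib_left)
    also have "\<dots> \<le> ?N"
      using weight_sum_le[OF z] N \<kappa> by (intro add_mono mult_left_mono) (auto intro: order_trans)
    finally show ?thesis .
  qed
  have "0 \<le> inter_norm 0 M" "0 \<le> inter_norm K M" by (rule inter_norm_nonneg)+
  then have N0: "0 \<le> ?N" using N \<kappa> by simp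
  have "(\<Sum>A\<in>Pow V. 2 * opnorm (\<Phi> A) * (sinh (u A))\<^sup>2)
      \<le> (\<Sum>A\<in>Pow V. \<Sum>z\<in>V. if z \<in> A \<and> d z < D then h z * w A else 0)"
    using cost by (intro sum_mono) auto
  also have "\<dots> = (\<Sum>z\<in>V. \<Sum>A\<in>Pow V. if z \<in> A \<and> d z < D then h z * w A else 0)"
    by (rule sum.swap)
  also have "\<dots> \<le> (\<Sum>z\<in>V. if d z < D then h z * ?N else 0)"
  proof (rule sum_mono)
    fix z assume z: "z \<in> V"
    have "(\<Sum>A\<in>Pow V. if z \<in> A \<and> d z < D then h z * w A else 0)
        = (if d z < D then h z * (\<Sum>A\<in>Pow V. if z \<in> A then w A else 0) else 0)"
      unfolding sum_distrib_left by (auto intro!: sum.cong)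
    also have "(\<Sum>A\<in>Pow V. if z \<in> A then w A else 0) = (\<Sum>A | A \<subseteq> V \<and> z \<in> A. w A)"
      using finite_V by (intro sum.mono_neutral_cong_right) auto
    finally show "(\<Sum>A\<in>Pow V. if z \<in> A \<and> d z < D then h z * w A else 0)
        \<le> (if d z < D then h z * ?N else 0)"
      using wsum_le[OF z] h0 by (auto intro!: mult_left_mono)
  qed
  also have "\<dots> = (\<Sum>z | z \<in> V \<and> d z < D. h z * ?N)"
    using finite_V by (intro sum.mono_neutral_cong_right) auto
  also have "\<dots> = 2 * \<kappa>\<^sup>2 * ?N * (\<Sum>z | z \<in> V \<and> d z < D. 1 / (real (d z) + 1)\<^sup>2)"
    unfolding sum_distrib_left by (intro sum.cong) (auto simp: h_def)
  also have "\<dots> \<le> 2 * \<kappa>\<^sup>2 * ?N * (1 + \<gamma> * L)"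
    unfolding LD d_def using shell_sum_le[OF xy(1) \<gamma>] N0 by (intro mult_left_mono) auto
  finally have \<epsilon>: "(\<Sum>A\<in>Pow V. 2 * opnorm (\<Phi> A) * (sinh (u A))\<^sup>2) \<le> 2 * \<kappa>\<^sup>2 * ?N * (1 + \<gamma> * L)" .
  have gy: "s * g (d y) = 0" by (simp add: g_def LD D_def)
  have gx: "c * (s * g (d x)) = - (\<bar>c\<bar> * \<kappa> * L)"
  proof -
    have "d x = 0" by (simp add: d_def qdist_def)
    then have "g (d x) = \<kappa> * L" by (simp add: g_def)
    then have "c * (s * g (d x)) = (c * s) * (\<kappa> * L)" by simp
    then show ?thesis by (simp add: s(2))
  qed
  show ?thesis
    using gibbs_bound[OF corr xy gy \<beta> u \<epsilon>] unfolding gx .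
qed

end

section \<open>Choice of the slope\<close>

text \<open>The offset \<open>\<beta> powr (-1/2)\<close> keeps the optimal slope finite for \<open>N0 = 0\<close> without changing the
  limit, and dominates the contribution of \<open>N\<close> because of the last entry of the minimum.\<close>

definition slope :: "real \<Rightarrow> real \<Rightarrow> real \<Rightarrow> real \<Rightarrow> real \<Rightarrow> real \<Rightarrow> real" where
  "slope c g K N0 N \<beta> = min (min 1 K)
     (min (c / (4 * g * \<beta> * (N0 + \<beta> powr (-1/2)))) (\<beta> powr (-1/2) * K / (N + 1)))"

text \<open>The coefficient of \<open>- L\<close> left when the cost is subtracted from the gain,
  with \<open>N0 + \<kappa> / K * N\<close> replaced by \<open>n = N0 + \<beta> powr (-1/2)\<close>.
  The quadratic \<open>c \<kappa> - 2 \<beta> g n \<kappa>^2\<close> is maximal at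
  \<open>\<kappa> = c / (4 g \<beta> n)\<close>, the third entry of the minimum in
  \<open>slope\<close>.\<close>

definition rate :: "real \<Rightarrow> real \<Rightarrow> real \<Rightarrow> real \<Rightarrow> real \<Rightarrow> real \<Rightarrow> real" where
  "rate c g K N0 N \<beta> = slope c g K N0 N \<beta> *
     (c - 2 * \<beta> * slope c g K N0 N \<beta> * g * (N0 + \<beta> powr (-1/2)))"

lemma slope_bounds:
  assumes "0 < c" "0 < g" "0 < K" "0 \<le> N0" "0 \<le> N" "0 < \<beta>"
  shows "0 < slope c g K N0 N \<beta>" "slope c g K N0 N \<beta> \<le> 1" "slope c g K N0 N \<beta> \<le> K"
    "2 * \<beta> * slope c g K N0 N \<beta> * g * (N0 + \<beta> powr (-1/2)) \<le> c / 2"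
    "slope c g K N0 N \<beta> / K * N \<le> \<beta> powr (-1/2)"
proof -
  let ?k = "slope c g K N0 N \<beta>" and ?e = "\<beta> powr (-1/2)"
  have e: "0 < ?e" using assms by simp
  have n1: "0 < N0 + ?e" using assms e by linarith
  have P: "0 < 4 * g * \<beta> * (N0 + ?e)" using assms n1 by simp
  show k0: "0 < ?k" unfolding slope_def using assms P e by simp
  show "?k \<le> 1" "?k \<le> K" unfolding slope_def by simp_all
  have "?k \<le> c / (4 * g * \<beta> * (N0 + ?e))" unfolding slope_def by simp
  then have "?k * (4 * g * \<beta> * (N0 + ?e)) \<le> c" using P by (simp add: pos_le_divide_eq)
  moreover have "2 * \<beta> * ?k * g * (N0 + ?e) = ?k * (4 * g * \<beta> * (N0 + ?e)) / 2" by simp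
  ultimately show "2 * \<beta> * ?k * g * (N0 + ?e) \<le> c / 2" by linarith
  have "?k \<le> ?e * K / (N + 1)" unfolding slope_def by simp
  then have "?k / K \<le> (?e * K / (N + 1)) / K" using assms by (intro divide_right_mono) auto
  also have "\<dots> = ?e / (N + 1)" using assms by simp
  finally have "?k / K * N \<le> ?e / (N + 1) * N" using assms by (intro mult_right_mono)
  also have "\<dots> \<le> ?e" using assms e by (simp add: pos_divide_le_eq)
  finally show "?k / K * N \<le> ?e" .
qed

text \<open>Up to the optimal slope the cost consumes at most half of the gain. This yields
  positivity of the rate for every \<beta> and its divergence after multiplication by \<beta> when
  \<open>N0 = 0\<close>.\<close>

lemma rate_ge:
  assumes "0 < c" "0 < g" "0 < K" "0 \<le> N0" "0 \<le> N" "0 < \<beta>"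
  shows "slope c g K N0 N \<beta> * (c / 2) \<le> rate c g K N0 N \<beta>"
  unfolding rate_def using slope_bounds[OF assms] by (intro mult_left_mono) linarith+

text \<open>The summand 1 in \<open>1 + g * L\<close>, coming from the site \<open>x\<close> itself,
  produces a term without \<open>L\<close>. As the slope is at most 1 and the cost coefficient at
  most \<open>c / 2\<close>, this term stays below \<open>c / (2 g)\<close>, uniformly in \<beta>
  and in the norms.\<close>

lemma exponent_le:
  assumes "0 < c" "0 < g" "0 < K" "0 \<le> N0" "0 \<le> N" "0 < \<beta>" "0 \<le> L"
  defines "\<kappa> \<equiv> slope c g K N0 N \<beta>"
  shows "- (c * \<kappa> * L) + \<beta> * (2 * \<kappa>\<^sup>2 * (N0 + \<kappa> / K * N) * (1 + g * L))
    \<le> - rate c g K N0 N \<beta> * L + c / (2 * g)"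
proof -
  let ?n = "N0 + \<beta> powr (-1/2)"
  note k = slope_bounds[OF assms(1-6), folded \<kappa>_def]
  have "\<beta> * (2 * \<kappa>\<^sup>2 * (N0 + \<kappa> / K * N) * (1 + g * L)) \<le> \<beta> * (2 * \<kappa>\<^sup>2 * ?n * (1 + g * L))"
    using k(5) assms by (intro mult_left_mono mult_right_mono) auto
  also have "\<dots> = \<kappa> * (2 * \<beta> * \<kappa> * g * ?n) / g + \<kappa> * (2 * \<beta> * \<kappa> * g * ?n) * L"
    using assms(2) by (simp add: field_simps power2_eq_square)
  also have "\<kappa> * (2 * \<beta> * \<kappa> * g * ?n) / g \<le> 1 * (c / 2) / g"
    using k assms by (intro divide_right_mono mult_mono) auto
  finally show ?thesis unfolding rate_def \<kappa>_def[symmetric] by (simp add: algebra_simps)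
qed

lemma rate_tendsto:
  assumes c: "0 < c" and g: "0 < g" and K: "0 < K" and N0: "0 \<le> N0" and N: "0 \<le> N"
  shows "((\<lambda>\<beta>. ereal (\<beta> * rate c g K N0 N \<beta>)) \<longlongrightarrow> ereal (c\<^sup>2) / ereal (8 * g * N0)) at_top"
proof (cases "N0 = 0")
  case True
  \<comment> \<open>All four entries of the minimum, multiplied by \<beta>, diverge; the last two
    grow like the square root of \<beta>. So does the product with the slope, and the limit is
    infinite.\<close>
  have "filterlim (\<lambda>\<beta>::real. \<beta> * 1) at_top at_top" by real_asymp
  moreover have "filterlim (\<lambda>\<beta>::real. \<beta> * K) at_top at_top" using K by real_asymp
  moreover have "filterlim (\<lambda>\<beta>::real. \<beta> * (c / (4 * g * \<beta> * (0 + \<beta> powr (-1/2))))) at_top at_top"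
    using c g by real_asymp
  moreover have "filterlim (\<lambda>\<beta>::real. \<beta> * (\<beta> powr (-1/2) * K / (N + 1))) at_top at_top"
    using K N by real_asymp
  ultimately have ev: "\<forall>\<^sub>F \<beta> in at_top. Z \<le> \<beta> * 1 \<and> Z \<le> \<beta> * K \<and>
      Z \<le> \<beta> * (c / (4 * g * \<beta> * (0 + \<beta> powr (-1/2)))) \<and> Z \<le> \<beta> * (\<beta> powr (-1/2) * K / (N + 1))" for Z
    unfolding filterlim_at_top by (intro eventually_conj) auto
  have "filterlim (\<lambda>\<beta>. \<beta> * rate c g K N0 N \<beta>) at_top at_top"
    unfolding filterlim_at_top
  proof
    fix Z :: real
    show "\<forall>\<^sub>F \<beta> in at_top. Z \<le> \<beta> * rate c g K N0 N \<beta>"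
      using ev[of "Z * (2 / c)"] eventually_gt_at_top[of 0]
    proof eventually_elim
      case (elim \<beta>)
      then have "Z * (2 / c) \<le> \<beta> * slope c g K N0 N \<beta>"
        unfolding slope_def True by (simp add: min_mult_distrib_left del: times_divide_eq_right)
      then have "Z * (2 / c) * (c / 2) \<le> \<beta> * slope c g K N0 N \<beta> * (c / 2)"
        using c by (intro mult_right_mono) auto
      also have "\<dots> = \<beta> * (slope c g K N0 N \<beta> * (c / 2))" by simp
      also have "\<dots> \<le> \<beta> * rate c g K N0 N \<beta>"
        using rate_ge[OF c g K N0 N] elim by (intro mult_left_mono) auto
      finally show ?case using c by simp
    qed
  qed
  then have "((\<lambda>\<beta>. ereal (\<beta> * rate c g K N0 N \<beta>)) \<longlongrightarrow> \<infinity>) at_top"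
    by (simp add: tendsto_PInfty_eq_at_top)
  moreover have "ereal (c\<^sup>2) / ereal (8 * g * N0) = \<infinity>" using True c by simp
  ultimately show ?thesis by simp
next
  case False
  with N0 have N0: "0 < N0" by simp
  \<comment> \<open>The unconstrained optimum decays like \<open>1 / \<beta>\<close>, faster than
    the other entries of the minimum, so it eventually is the slope. There exactly half of the gain
    is spent, which gives \<open>c^2 / (8 g n)\<close> for \<beta> times the rate.\<close>
  define f where "f \<beta> = c / (4 * g * \<beta> * (N0 + \<beta> powr (-1/2)))" for \<beta>
  have "(f \<longlongrightarrow> 0) at_top" unfolding f_def using c g N0 by real_asymp
  then have "\<forall>\<^sub>F \<beta> in at_top. f \<beta> < min 1 K" using K by (intro order_tendstoD) auto
  moreover have "((\<lambda>\<beta>. f \<beta> / (\<beta> powr (-1/2) * K / (N + 1))) \<longlongrightarrow> 0) at_top"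
    unfolding f_def using c g N0 K N by real_asymp
  then have "\<forall>\<^sub>F \<beta> in at_top. f \<beta> / (\<beta> powr (-1/2) * K / (N + 1)) < 1" by (intro order_tendstoD) auto
  ultimately have "\<forall>\<^sub>F \<beta> in at_top. c\<^sup>2 / (8 * g * (N0 + \<beta> powr (-1/2))) = \<beta> * rate c g K N0 N \<beta>"
    using eventually_gt_at_top[of 0]
  proof eventually_elim
    case (elim \<beta>)
    have e: "0 < \<beta> powr (-1/2)" using elim by simp
    have "f \<beta> \<le> \<beta> powr (-1/2) * K / (N + 1)"
      using elim K N e by (simp add: pos_divide_less_eq pos_le_divide_eq less_imp_le)
    then have s: "slope c g K N0 N \<beta> = f \<beta>"
      unfolding slope_def f_def[symmetric] using elim by simp
    define n1 where "n1 = N0 + \<beta> powr (-1/2)"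
    have "0 < n1" using N0 e unfolding n1_def by linarith
    then show ?case
      unfolding rate_def s unfolding f_def n1_def[symmetric]
      using g elim by (simp add: power2_eq_square)
  qed
  moreover have "((\<lambda>\<beta>. c\<^sup>2 / (8 * g * (N0 + \<beta> powr (-1/2)))) \<longlongrightarrow> c\<^sup>2 / (8 * g * (N0 + 0))) at_top"
  proof (intro tendsto_divide tendsto_mult tendsto_add tendsto_const)
    show "((\<lambda>\<beta>::real. \<beta> powr (-1/2)) \<longlongrightarrow> 0) at_top" by real_asymp
  qed (use g N0 in simp)
  ultimately have "((\<lambda>\<beta>. \<beta> * rate c g K N0 N \<beta>) \<longlongrightarrow> c\<^sup>2 / (8 * g * (N0 + 0))) at_top"
    by (rule Lim_transform_eventually[rotated])
  then show ?thesis using g N0 by (simp add: tendsto_ereal)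
qed

text \<open>Uniformity is encoded by choosing one \<open>C\<close> and one \<open>\<xi>\<close> for
  an arbitrary family; \<open>\<xi>\<close> sees a system only through the two norms. The case
  \<open>c = 0\<close> is excluded because the identity would then be a correlator, with expectation
  1 at all distances.\<close>

theorem theorem6p1:
  fixes M :: "'i \<Rightarrow> 'v qsystem"
    and Obs :: "'i \<Rightarrow> 'v \<Rightarrow> 'v \<Rightarrow> complex mat"
    and c :: real
  assumes "\<And>i. u1_system (M i)"
    and "\<And>i x y. x \<in> sites (M i) \<Longrightarrow> y \<in> sites (M i) \<Longrightarrow> u1_correlator (M i) c x y (Obs i x y)"
    and "c \<noteq> 0"
    and "bdd_above {opnorm (Obs i x y) | i x y. x \<in> sites (M i) \<and> y \<in> sites (M i)}"
    and "bdd_above (range (\<lambda>i. qperimeter (M i)))"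
  shows "\<exists>C>0. \<exists>\<xi> :: real \<Rightarrow> real \<Rightarrow> real \<Rightarrow> real \<Rightarrow> real.
    (\<forall>K>0. \<forall>N0\<ge>0. \<forall>N\<ge>0. \<forall>\<beta>>0. \<xi> K N0 N \<beta> > 0) \<and>
    (\<forall>K>0. \<forall>i. \<forall>x\<in>sites (M i). \<forall>y\<in>sites (M i). \<forall>\<beta>>0.
       cmod (gibbs (M i) \<beta> (Obs i x y)) \<le>
         C * (real (qdist (M i) x y) + 1) powr
           (- \<xi> K (inter_norm 0 (M i)) (inter_norm K (M i)) \<beta>)) \<and>
    (\<forall>K>0. bdd_above (range (\<lambda>i. inter_norm K (M i))) \<longrightarrow>
       (\<forall>i. \<forall>x\<in>sites (M i). \<forall>y\<in>sites (M i). \<forall>\<beta>>0.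
          cmod (gibbs (M i) \<beta> (Obs i x y)) \<le>
            C * (real (qdist (M i) x y) + 1) powr
              (- \<xi> K (family_norm 0 M) (family_norm K M) \<beta>)) \<and>
       ((\<lambda>\<beta>. ereal (\<beta> * \<xi> K (family_norm 0 M) (family_norm K M) \<beta>)) \<longlongrightarrow>
          ereal (c\<^sup>2) / ereal (8 * family_perimeter M * family_norm 0 M)) at_top)"
proof -
  have u1: "u1 (M i)" for i by (rule u1.intro[OF assms(1)])
  define g where "g = family_perimeter M"
  have gi: "qperimeter (M i) \<le> g" for i
    unfolding g_def family_perimeter_def using assms(5) by (intro cSUP_upper) auto
  have g0: "0 \<le> g" using u1.qperimeter_nonneg[OF u1] gi order_trans by blast
  obtain b where b: "\<And>i x y. \<lbrakk>x \<in> sites (M i); y \<in> sites (M i)\<rbrakk> \<Longrightarrow> opnorm (Obs i x y) \<le> b"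
    using assms(4) unfolding bdd_above_def by blast
  have ob: "opnorm (Obs i x y) \<le> \<bar>b\<bar> + 1" if "x \<in> sites (M i)" "y \<in> sites (M i)" for i x y
    using b[OF that] by simp
  \<comment> \<open>The exponential absorbs the constant from \<open>exponent_le\<close>. For
    \<open>g = 0\<close> the quotient is 0 by convention and the factor is 1.\<close>
  define C where "C = (\<bar>b\<bar> + 1) * exp (\<bar>c\<bar> / (2 * g))"
  have C: "0 < C" unfolding C_def by (simp add: add_nonneg_pos)
  have c: "0 < \<bar>c\<bar>" using assms(3) by simp
  \<comment> \<open>If \<open>g = 0\<close>, all distances are 0 and every positive exponent is
    admissible; the value 1 makes \<beta> times the exponent diverge, in agreement with the quotient
    by 0 in the limit.\<close>
  define \<xi> where "\<xi> K N0 N \<beta> = (if g = 0 then 1 else rate \<bar>c\<bar> g K N0 N \<beta>)" for K N0 N \<beta>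
  have pos: "0 < \<xi> K N0 N \<beta>" if "0 < K" "0 \<le> N0" "0 \<le> N" "0 < \<beta>" for K N0 N \<beta>
  proof (cases "g = 0")
    case False
    then have g: "0 < g" using g0 by simp
    have "0 < slope \<bar>c\<bar> g K N0 N \<beta> * (\<bar>c\<bar> / 2)"
      using slope_bounds(1)[OF c g that] c by simp
    also have "\<dots> \<le> \<xi> K N0 N \<beta>" using rate_ge[OF c g that] False by (simp add: \<xi>_def)
    finally show ?thesis .
  qed (simp add: \<xi>_def)
  have main: "cmod (gibbs (M i) \<beta> (Obs i x y)) \<le> C * (real (qdist (M i) x y) + 1) powr (- \<xi> K N0 N \<beta>)"
    if K: "0 < K" and xy: "x \<in> sites (M i)" "y \<in> sites (M i)" and \<beta>: "0 < \<beta>"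
      and N0: "inter_norm 0 (M i) \<le> N0" and N: "inter_norm K (M i) \<le> N" for i x y K N0 N \<beta>
  proof -
    let ?D = "real (qdist (M i) x y) + 1"
    note corr = assms(2)[OF xy]
    have n0: "0 \<le> N0" "0 \<le> N"
      using u1.inter_norm_nonneg[OF u1, of 0 i] u1.inter_norm_nonneg[OF u1, of K i] N0 N by linarith+
    show ?thesis
    proof (cases "g = 0")
      case True
      have "qdist (M i) x y = 0"
      proof (rule ccontr)
        assume "qdist (M i) x y \<noteq> 0"
        then show False
          using u1.qdist_pos_imp_perimeter_pos[OF u1 xy] gi[of i] True by simp
      qed
      \<comment> \<open>Slope 0 in \<open>decay_bound\<close> means no rotation and gives the
        trivial bound by the operator norm.\<close>
      moreover have "cmod (gibbs (M i) \<beta> (Obs i x y)) \<le> opnorm (Obs i x y)"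
        using u1.decay_bound[OF u1 corr xy \<beta> order_refl _ K N0 N gi] K by simp
      ultimately show ?thesis using ob[OF xy] True by (simp add: C_def)
    next
      case False
      then have g: "0 < g" using g0 by simp
      define \<kappa> where "\<kappa> = slope \<bar>c\<bar> g K N0 N \<beta>"
      note k = slope_bounds[OF c g K n0 \<beta>, folded \<kappa>_def]
      have L: "0 \<le> ln ?D" by simp
      let ?E = "\<beta> * (2 * \<kappa>\<^sup>2 * (N0 + \<kappa> / K * N) * (1 + g * ln ?D))"
      have "cmod (gibbs (M i) \<beta> (Obs i x y)) \<le> exp (- (\<bar>c\<bar> * \<kappa> * ln ?D)) * (opnorm (Obs i x y) * exp ?E)"
        using k(1) by (intro u1.decay_bound[OF u1 corr xy \<beta> _ k(3) K N0 N gi]) simp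
      also have "\<dots> = opnorm (Obs i x y) * exp (- (\<bar>c\<bar> * \<kappa> * ln ?D) + ?E)"
        by (simp only: exp_add ac_simps)
      also have "\<dots> \<le> (\<bar>b\<bar> + 1) * exp (- rate \<bar>c\<bar> g K N0 N \<beta> * ln ?D + \<bar>c\<bar> / (2 * g))"
        using exponent_le[OF c g K n0 \<beta> L] ob[OF xy] by (intro mult_mono) (simp_all add: \<kappa>_def)
      also have "\<dots> = C * exp (- rate \<bar>c\<bar> g K N0 N \<beta> * ln ?D)"
        unfolding C_def by (simp only: exp_add ac_simps)
      also have "exp (- rate \<bar>c\<bar> g K N0 N \<beta> * ln ?D) = ?D powr (- \<xi> K N0 N \<beta>)"
        using False by (simp add: \<xi>_def powr_def)
      finally show ?thesis .
    qed
  qed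
  show ?thesis
  proof (intro exI[of _ C] exI[of _ \<xi>] conjI allI impI ballI C)
    fix K N0 N \<beta> :: real
    assume "K > 0" "N0 \<ge> 0" "N \<ge> 0" "\<beta> > 0"
    then show "\<xi> K N0 N \<beta> > 0" by (rule pos)
  next
    fix K \<beta> :: real and i x y
    assume "K > 0" "x \<in> sites (M i)" "y \<in> sites (M i)" "\<beta> > 0"
    then show "cmod (gibbs (M i) \<beta> (Obs i x y)) \<le> C * (real (qdist (M i) x y) + 1) powr
        (- \<xi> K (inter_norm 0 (M i)) (inter_norm K (M i)) \<beta>)"
      by (intro main order_refl)
  next
    fix K :: real
    assume K: "K > 0" and bdd: "bdd_above (range (\<lambda>i. inter_norm K (M i)))"
    have fK: "inter_norm K (M i) \<le> family_norm K M" for i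
      unfolding family_norm_def using bdd by (intro cSUP_upper) auto
    \<comment> \<open>Monotonicity of the norm in its parameter carries the uniform bound from
      \<open>K\<close> down to 0, so that both family norms are genuine suprema.\<close>
    have "bdd_above (range (\<lambda>i. inter_norm 0 (M i)))"
    proof (rule bdd_aboveI2)
      fix i
      have "inter_norm 0 (M i) \<le> inter_norm K (M i)"
        using K by (intro u1.inter_norm_mono[OF u1]) simp
      then show "inter_norm 0 (M i) \<le> family_norm K M" using fK[of i] by linarith
    qed
    then have f0: "inter_norm 0 (M i) \<le> family_norm 0 M" for i
      unfolding family_norm_def by (intro cSUP_upper) auto
    {
      fix i x y and \<beta> :: real
      assume "x \<in> sites (M i)" "y \<in> sites (M i)" "\<beta> > 0"
      then show "cmod (gibbs (M i) \<beta> (Obs i x y)) \<le> C * (real (qdist (M i) x y) + 1) powr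
          (- \<xi> K (family_norm 0 M) (family_norm K M) \<beta>)"
        using K f0 fK by (intro main)
    }
    show "((\<lambda>\<beta>. ereal (\<beta> * \<xi> K (family_norm 0 M) (family_norm K M) \<beta>)) \<longlongrightarrow>
        ereal (c\<^sup>2) / ereal (8 * family_perimeter M * family_norm 0 M)) at_top"
    proof (cases "g = 0")
      case True
      have "filterlim (\<lambda>\<beta>::real. \<beta>) at_top at_top" by (rule filterlim_ident)
      then have "((\<lambda>\<beta>. ereal \<beta>) \<longlongrightarrow> \<infinity>) at_top" by (simp add: tendsto_PInfty_eq_at_top)
      moreover have "ereal (c\<^sup>2) / ereal (8 * family_perimeter M * family_norm 0 M) = \<infinity>"
        using True assms(3) by (simp flip: g_def)
      ultimately show ?thesis using True by (simp add: \<xi>_def)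
    next
      case False
      then have g: "0 < g" using g0 by simp
      have "0 \<le> family_norm 0 M" "0 \<le> family_norm K M"
        using u1.inter_norm_nonneg[OF u1] f0 fK order_trans by blast+
      from rate_tendsto[OF c g K this] show ?thesis using False by (simp add: \<xi>_def g_def)
    qed
  qed
qed

end
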